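(* Let $\mathrm S$ be a dependent type theory with identity types and discrete identity types, and let $\mathfrak C_{\mathrm S}$ be its $2$-category of contexts. For every context $\Delta$ and type $B$ in context $\Delta$, the dependent projection $\pi_B\colon\Delta.B\to\Delta$ in $\mathfrak C_{\mathrm S}$ may be equipped with the structure of a normal isofibration.
   Context: **Type theory.** $\mathrm S$ is a dependent type theory with the four judgement forms $A\ \mathsf{type}$, $a:A$, $A=B\ \mathsf{type}$, $a=b:A$ (the last two are definitional equality), made relative to contexts $\Gamma=(x_1:A_1,\dots,x_n:A_n)$ with each $A_i$ a type in context $(x_1:A_1,\dots,x_{i-1}:A_{i-1})$. It has the equality rules (definitional equality is a congruence) and the structural rules (weakening, contraction, exchange, substitution). Every rule is read relative to an arbitrary ambient context and every operation is stable under substitution in it. Furthermore $\mathrm S$ has: - identity types: from $a,b:A$ form $\mathrm{Id}_A(a,b)$; $\mathrm r(a):\mathrm{Id}_A(a,a)$; from $x,y:A,\,p:\mathrm{Id}_A(x,y),\,\Delta\vdash C(x,y,p)\ \mathsf{type}$ and $x:A,\,\Delta[x,x,\mathrm r(x)/x,y,p]\vdash d(x):C(x,x,\mathrm r(x))$ infer $x,y:A,\,p:\mathrm{Id}_A(x,y),\,\Delta\vdash\mathrm J_d(x,y,p):C(x,y,p)$, with $\mathrm J_d(x,x,\mathrm r(x))=d(x)$; - discrete identity types: if $p,q:\mathrm{Id}_A(a,b)$ and $\alpha:\mathrm{Id}_{\mathrm{Id}_A(a,b)}(p,q)$ then $p=q$ and $\alpha=\mathrm r(p)$ definitionally. Vector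 notation is used: an element $a:\Gamma$ of a context is a list of terms of the successive types, and $x:\Gamma\vdash\Delta(x)\ \mathsf{ctxt}$ denotes a telescope over $\Gamma$. **Identity contexts.** The identity rules extend from types to contexts by induction on length. For a single type, elimination into a context $\Theta=(u:\Lambda,v:D(u))$ is componentwise: from $d=(d_1,d_2)$ form $\mathrm J_{d_1}$, then $\mathrm J_{d_2}$ eliminating into $D(x,y,p,\mathrm J_{d_1}(x,y,p))$. For the empty context, $\mathrm{Id}_{()}=()$ and $\mathrm J_d=d$. For $\Phi=(x:\Lambda,y:D(x))$: transport $p^*(z):\Upsilon(x)$ for $x:\Lambda\vdash\Upsilon(x)\ \mathsf{ctxt}$, $p:\mathrm{Id}_\Lambda(x,x')$, $z:\Upsilon(x')$ is defined by $\mathrm{Id}_\Lambda$-elimination from $\mathrm r(x)^*(z)=z$; $\mathrm{Id}_\Phi((x,y),(x',y')):=(p:\mathrm{Id}_\Lambda(x,x'),\,q:\mathrm{Id}_{D(x)}(y,p^*y'))$; $\mathrm r(x,y):=(\mathrm r(x),\mathrm r(y))$; elimination for $\mathrm{Id}_\Phi$ is obtained by first applying elimination for $\mathrm{Id}_{D(x)}$ to $d$, giving $d'(x,y,y',q)$, and then applying $\mathrm{Id}_\Lambda$-elimination with post-context $(y,y',q)$ to $d'$. **The 2-category $\mathfrak C_{\mathrm S}$.** (All modulo $\alpha$-conversion and definitional equality.) Objects: contexts. 1-cells $\Gamma\to\Delta$: judgements $x:\Gamma\vdash f(x):\Delta$, composed by substitution. 2-cells $f\Rightarrow g$: judgements $x:\Gamma\vdash\alpha(x):\mathrm{Id}_\Delta(fx,gx)$.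 Here $q\circ p$ is defined by elimination on $q$ with $\mathrm r(y)\circ p=p$, and $h^\bullet(p):\mathrm{Id}_\Delta(hx,hy)$ by elimination on $p$ with $h^\bullet(\mathrm r(x))=\mathrm r(hx)$; vertical composition is $\beta(x)\circ\alpha(x)$, identities are $\mathrm r(fx)$, whiskerings are $(\alpha k)(x)=\alpha(kx)$, $(h\alpha)(x)=h^\bullet(\alpha(x))$. It is locally groupoidal. For a type $B$ in context $\Delta$, $\Delta.B=(x:\Delta,y:B(x))$ and $\pi_B\colon\Delta.B\to\Delta$ is $(x,y)\mapsto x$. **Normal isofibrations.** A morphism $p\colon X\to Y$ of a 2-category is a *cloven isofibration* if for every $f\colon W\to Y$, $g\colon W\to X$ and invertible 2-cell $\alpha\colon f\Rightarrow pg$ we are given a 1-cell $s_\alpha\colon W\to X$ and a 2-cell $\sigma_\alpha\colon s_\alpha\Rightarrow g$ with $ps_\alpha=f$ and $p\sigma_\alpha=\alpha$, naturally in $W$: $s_{\alpha k}=s_\alpha k$ and $\sigma_{\alpha k}=\sigma_\alpha k$ for every $k\colon W'\to W$. It is *normal* if $s_{\mathrm{id}_{pg}}=g$ and $\sigma_{\mathrm{id}_{pg}}=\mathrm{id}_g$ for every $g\colon W\to X$. *)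

theory Defs
  imports Main
begin

section \<open>Raw expressions\<close>

text \<open>
  Types and terms share one grammar of raw expressions in de Bruijn notation, so that
  \<alpha>-equivalent expressions are equal. An argument \<open>(k, t)\<close> of an operator is an expression
  \<open>t\<close> in which \<open>k\<close> further variables are bound. Apart from the identity types, a theory may
  use arbitrary operators \<open>Ext s\<close> with arbitrary binding.
\<close>

datatype 's symb = Id_symb | Refl_symb | J_symb | Ext 's

datatype 's exp = Var nat | Op "'s symb" "(nat \<times> 's exp) list"

definition liftr :: "nat \<Rightarrow> (nat \<Rightarrow> nat) \<Rightarrow> nat \<Rightarrow> nat" where
  "liftr k r i = (if i < k then i else r (i - k) + k)"

fun ren :: "(nat \<Rightarrow> nat) \<Rightarrow> 's exp \<Rightarrow> 's exp" where
  "ren r (Var i) = Var (r i)"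
| "ren r (Op s ts) = Op s (map (\<lambda>(k, t). (k, ren (liftr k r) t)) ts)"

definition shift :: "nat \<Rightarrow> 's exp \<Rightarrow> 's exp" where
  "shift k = ren (\<lambda>i. i + k)"

definition lifts :: "nat \<Rightarrow> (nat \<Rightarrow> 's exp) \<Rightarrow> nat \<Rightarrow> 's exp" where
  "lifts k \<sigma> i = (if i < k then Var i else shift k (\<sigma> (i - k)))"

fun subst :: "(nat \<Rightarrow> 's exp) \<Rightarrow> 's exp \<Rightarrow> 's exp" where
  "subst \<sigma> (Var i) = \<sigma> i"
| "subst \<sigma> (Op s ts) = Op s (map (\<lambda>(k, t). (k, subst (lifts k \<sigma>) t)) ts)"

fun scoped :: "nat \<Rightarrow> 's exp \<Rightarrow> bool" where
  "scoped n (Var i) \<longleftrightarrow> i < n"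
| "scoped n (Op s ts) \<longleftrightarrow> (\<forall>(k, t) \<in> set ts. scoped (k + n) t)"

text \<open>
  Contexts, telescopes and vectors of terms are lists whose \<^emph>\<open>head\<close> is the \<^emph>\<open>last\<close> entry:
  \<open>A # \<Gamma>\<close> is \<open>\<Gamma>\<close> extended by \<open>A\<close>, a telescope \<open>\<Psi>\<close> over \<open>\<Gamma>\<close> yields the context \<open>\<Psi> @ \<Gamma>\<close>,
  and \<open>Var i\<close> refers to the entry at position \<open>i\<close> of the list.
  \<open>inst ts\<close> substitutes \<open>ts\<close> for the last \<open>length ts\<close> variables and keeps the remaining ones.
\<close>

definition inst :: "'s exp list \<Rightarrow> nat \<Rightarrow> 's exp" where
  "inst ts i = (if i < length ts then ts ! i else Var (i - length ts))"

fun subst_tele :: "(nat \<Rightarrow> 's exp) \<Rightarrow> 's exp list \<Rightarrow> 's exp list" where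
  "subst_tele \<sigma> [] = []"
| "subst_tele \<sigma> (D # \<Psi>) = subst (lifts (length \<Psi>) \<sigma>) D # subst_tele \<sigma> \<Psi>"

definition subst_vec :: "(nat \<Rightarrow> 's exp) \<Rightarrow> 's exp list \<Rightarrow> 's exp list" where
  "subst_vec \<sigma> = map (subst \<sigma>)"

definition vars :: "nat \<Rightarrow> nat \<Rightarrow> 's exp list" where
  "vars k n = map Var [k..<k + n]"

definition Id_type :: "'s exp \<Rightarrow> 's exp \<Rightarrow> 's exp \<Rightarrow> 's exp" where
  "Id_type A a b = Op Id_symb [(0, A), (0, a), (0, b)]"

definition Refl :: "'s exp \<Rightarrow> 's exp \<Rightarrow> 's exp" where
  "Refl A a = Op Refl_symb [(0, A), (0, a)]"

fun bind_tele :: "nat \<Rightarrow> 's exp list \<Rightarrow> (nat \<times> 's exp) list" where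
  "bind_tele k [] = []"
| "bind_tele k (D # \<Psi>) = (k + length \<Psi>, D) # bind_tele k \<Psi>"

text \<open>
  \<open>J A \<Psi> C d a b p ts\<close> is the eliminator \<open>J\<^sub>d\<close> at \<open>a, b : A\<close>, \<open>p : Id\<^sub>A(a, b)\<close> and at the elements
  \<open>ts\<close> of the post-context \<open>\<Psi>\<close>. It binds \<open>x, y, p\<close> in \<open>\<Psi>\<close>, it binds \<open>x, y, p, \<Psi>\<close> in \<open>C\<close> and it
  binds \<open>x, \<Psi>\<close> in \<open>d\<close>. All premises of the elimination rule are recorded in the raw term: without
  \<open>\<Psi>\<close> and \<open>C\<close>, eliminators into different families \<open>C\<close> that happen to share \<open>d\<close> (such as forward
  and backward transport along a loop) would be identified.
\<close>

definition J :: "'s exp \<Rightarrow> 's exp list \<Rightarrow> 's exp \<Rightarrow> 's exp \<Rightarrow>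
    's exp \<Rightarrow> 's exp \<Rightarrow> 's exp \<Rightarrow> 's exp list \<Rightarrow> 's exp" where
  "J A \<Psi> C d a b p ts = Op J_symb
     ([(0, A)] @ bind_tele 3 \<Psi> @
      [(3 + length \<Psi>, C), (1 + length \<Psi>, d), (0, a), (0, b), (0, p)] @ map (Pair 0) ts)"


section \<open>Dependent type theories\<close>

text \<open>A theory is given by its derivable judgements of the four forms
  \<open>\<Gamma> \<turnstile> A type\<close>, \<open>\<Gamma> \<turnstile> a : A\<close>, \<open>\<Gamma> \<turnstile> A = B type\<close> and \<open>\<Gamma> \<turnstile> a = b : A\<close>.\<close>

record 's judgements =
  Ty :: "'s exp list \<Rightarrow> 's exp \<Rightarrow> bool"
  Tm :: "'s exp list \<Rightarrow> 's exp \<Rightarrow> 's exp \<Rightarrow> bool"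
  TyEq :: "'s exp list \<Rightarrow> 's exp \<Rightarrow> 's exp \<Rightarrow> bool"
  TmEq :: "'s exp list \<Rightarrow> 's exp \<Rightarrow> 's exp \<Rightarrow> 's exp \<Rightarrow> bool"

fun Ctxt :: "'s judgements \<Rightarrow> 's exp list \<Rightarrow> bool" where
  "Ctxt S [] \<longleftrightarrow> True"
| "Ctxt S (A # \<Gamma>) \<longleftrightarrow> Ctxt S \<Gamma> \<and> Ty S \<Gamma> A"

fun CtxtEq :: "'s judgements \<Rightarrow> 's exp list \<Rightarrow> 's exp list \<Rightarrow> bool" where
  "CtxtEq S [] [] \<longleftrightarrow> True"
| "CtxtEq S (A # \<Gamma>) (B # \<Delta>) \<longleftrightarrow> CtxtEq S \<Gamma> \<Delta> \<and> TyEq S \<Gamma> A B"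
| "CtxtEq S _ _ \<longleftrightarrow> False"

text \<open>\<open>Elem S \<Gamma> ts \<Psi>\<close>: in context \<open>\<Gamma>\<close>, the vector \<open>ts\<close> is an element of the telescope \<open>\<Psi>\<close> over \<open>\<Gamma>\<close>.
  A closed context is, unchanged, a telescope over every \<open>\<Gamma>\<close>.\<close>

fun Elem :: "'s judgements \<Rightarrow> 's exp list \<Rightarrow> 's exp list \<Rightarrow> 's exp list \<Rightarrow> bool" where
  "Elem S \<Gamma> [] [] \<longleftrightarrow> Ctxt S \<Gamma>"
| "Elem S \<Gamma> (t # ts) (D # \<Psi>) \<longleftrightarrow> Elem S \<Gamma> ts \<Psi> \<and> Tm S \<Gamma> t (subst (inst ts) D)"
| "Elem S \<Gamma> _ _ \<longleftrightarrow> False"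

fun ElemEq :: "'s judgements \<Rightarrow> 's exp list \<Rightarrow> 's exp list \<Rightarrow> 's exp list \<Rightarrow> 's exp list \<Rightarrow> bool" where
  "ElemEq S \<Gamma> [] [] [] \<longleftrightarrow> Ctxt S \<Gamma>"
| "ElemEq S \<Gamma> (t # ts) (u # us) (D # \<Psi>) \<longleftrightarrow>
     ElemEq S \<Gamma> ts us \<Psi> \<and> TmEq S \<Gamma> t u (subst (inst ts) D)"
| "ElemEq S \<Gamma> _ _ _ \<longleftrightarrow> False"

text \<open>The simultaneous substitution rules, together with the variable rule, are interderivable
  with weakening, contraction, exchange and substitution for a single variable.\<close>

locale type_theory =
  fixes S :: "'s judgements"
  assumes Ty_Ctxt: "Ty S \<Gamma> A \<Longrightarrow> Ctxt S \<Gamma>"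
    and Tm_Ty: "Tm S \<Gamma> a A \<Longrightarrow> Ty S \<Gamma> A"
    and TyEq_Ty: "TyEq S \<Gamma> A B \<Longrightarrow> Ty S \<Gamma> A \<and> Ty S \<Gamma> B"
    and TmEq_Tm: "TmEq S \<Gamma> a b A \<Longrightarrow> Tm S \<Gamma> a A \<and> Tm S \<Gamma> b A"
    and Ty_scoped: "Ty S \<Gamma> A \<Longrightarrow> scoped (length \<Gamma>) A"
    and Tm_scoped: "Tm S \<Gamma> a A \<Longrightarrow> scoped (length \<Gamma>) a"
    \<comment> \<open>equality rules\<close>
    and TyEq_refl: "Ty S \<Gamma> A \<Longrightarrow> TyEq S \<Gamma> A A"
    and TyEq_sym: "TyEq S \<Gamma> A B \<Longrightarrow> TyEq S \<Gamma> B A"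
    and TyEq_trans: "TyEq S \<Gamma> A B \<Longrightarrow> TyEq S \<Gamma> B C \<Longrightarrow> TyEq S \<Gamma> A C"
    and TmEq_refl: "Tm S \<Gamma> a A \<Longrightarrow> TmEq S \<Gamma> a a A"
    and TmEq_sym: "TmEq S \<Gamma> a b A \<Longrightarrow> TmEq S \<Gamma> b a A"
    and TmEq_trans: "TmEq S \<Gamma> a b A \<Longrightarrow> TmEq S \<Gamma> b c A \<Longrightarrow> TmEq S \<Gamma> a c A"
    and Tm_conv: "Tm S \<Gamma> a A \<Longrightarrow> TyEq S \<Gamma> A B \<Longrightarrow> Tm S \<Gamma> a B"
    and TmEq_conv: "TmEq S \<Gamma> a b A \<Longrightarrow> TyEq S \<Gamma> A B \<Longrightarrow> TmEq S \<Gamma> a b B"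
    and Ty_subst_cong: "ElemEq S \<Gamma> ts us \<Delta> \<Longrightarrow> Ty S \<Delta> A \<Longrightarrow>
          TyEq S \<Gamma> (subst (inst ts) A) (subst (inst us) A)"
    and Tm_subst_cong: "ElemEq S \<Gamma> ts us \<Delta> \<Longrightarrow> Tm S \<Delta> a A \<Longrightarrow>
          TmEq S \<Gamma> (subst (inst ts) a) (subst (inst us) a) (subst (inst ts) A)"
    \<comment> \<open>structural rules\<close>
    and Tm_Var: "Ctxt S \<Gamma> \<Longrightarrow> i < length \<Gamma> \<Longrightarrow> Tm S \<Gamma> (Var i) (shift (Suc i) (\<Gamma> ! i))"
    and Ty_subst: "Elem S \<Gamma> ts \<Delta> \<Longrightarrow> Ty S \<Delta> A \<Longrightarrow> Ty S \<Gamma> (subst (inst ts) A)"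
    and Tm_subst: "Elem S \<Gamma> ts \<Delta> \<Longrightarrow> Tm S \<Delta> a A \<Longrightarrow>
          Tm S \<Gamma> (subst (inst ts) a) (subst (inst ts) A)"
    and TyEq_subst: "Elem S \<Gamma> ts \<Delta> \<Longrightarrow> TyEq S \<Delta> A B \<Longrightarrow>
          TyEq S \<Gamma> (subst (inst ts) A) (subst (inst ts) B)"
    and TmEq_subst: "Elem S \<Gamma> ts \<Delta> \<Longrightarrow> TmEq S \<Delta> a b A \<Longrightarrow>
          TmEq S \<Gamma> (subst (inst ts) a) (subst (inst ts) b) (subst (inst ts) A)"

text \<open>The context \<open>\<Gamma>, x : A, y : A, p : Id\<^sub>A(x, y)\<close>, and the vector \<open>(y, p) := (x, r(x))\<close>
  over \<open>\<Gamma>, x : A\<close>.\<close>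

definition id_ext :: "'s exp \<Rightarrow> 's exp list \<Rightarrow> 's exp list" where
  "id_ext A \<Gamma> = Id_type (shift 2 A) (Var 1) (Var 0) # shift 1 A # A # \<Gamma>"

definition diag1 :: "'s exp \<Rightarrow> 's exp list" where
  "diag1 A = [Refl (shift 1 A) (Var 0), Var 0]"

locale identity_types = type_theory S for S :: "'s judgements" +
  assumes Id_form: "Tm S \<Gamma> a A \<Longrightarrow> Tm S \<Gamma> b A \<Longrightarrow> Ty S \<Gamma> (Id_type A a b)"
    and Id_intro: "Tm S \<Gamma> a A \<Longrightarrow> Tm S \<Gamma> (Refl A a) (Id_type A a a)"
    and Id_elim: "Ty S (\<Psi> @ id_ext A \<Gamma>) C \<Longrightarrow>
          Tm S (subst_tele (inst (diag1 A)) \<Psi> @ A # \<Gamma>)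
            d (subst (lifts (length \<Psi>) (inst (diag1 A))) C) \<Longrightarrow>
          Tm S \<Gamma> a A \<Longrightarrow> Tm S \<Gamma> b A \<Longrightarrow> Tm S \<Gamma> p (Id_type A a b) \<Longrightarrow>
          Elem S \<Gamma> ts (subst_tele (inst [p, b, a]) \<Psi>) \<Longrightarrow>
          Tm S \<Gamma> (J A \<Psi> C d a b p ts) (subst (inst (ts @ [p, b, a])) C)"
    and Id_comp: "Ty S (\<Psi> @ id_ext A \<Gamma>) C \<Longrightarrow>
          Tm S (subst_tele (inst (diag1 A)) \<Psi> @ A # \<Gamma>)
            d (subst (lifts (length \<Psi>) (inst (diag1 A))) C) \<Longrightarrow>
          Tm S \<Gamma> a A \<Longrightarrow>
          Elem S \<Gamma> ts (subst_tele (inst [Refl A a, a, a]) \<Psi>) \<Longrightarrow>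
          TmEq S \<Gamma> (J A \<Psi> C d a a (Refl A a) ts) (subst (inst (ts @ [a])) d)
            (subst (inst (ts @ [Refl A a, a, a])) C)"
    \<comment> \<open>definitional equality is a congruence for the new operators\<close>
    and Id_cong: "TyEq S \<Gamma> A A' \<Longrightarrow> TmEq S \<Gamma> a a' A \<Longrightarrow> TmEq S \<Gamma> b b' A \<Longrightarrow>
          TyEq S \<Gamma> (Id_type A a b) (Id_type A' a' b')"
    and Refl_cong: "TyEq S \<Gamma> A A' \<Longrightarrow> TmEq S \<Gamma> a a' A \<Longrightarrow>
          TmEq S \<Gamma> (Refl A a) (Refl A' a') (Id_type A a a)"
    and J_cong: "CtxtEq S (C # \<Psi> @ id_ext A \<Gamma>) (C' # \<Psi>' @ id_ext A' \<Gamma>) \<Longrightarrow>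
          TmEq S (subst_tele (inst (diag1 A)) \<Psi> @ A # \<Gamma>)
            d d' (subst (lifts (length \<Psi>) (inst (diag1 A))) C) \<Longrightarrow>
          TmEq S \<Gamma> a a' A \<Longrightarrow> TmEq S \<Gamma> b b' A \<Longrightarrow> TmEq S \<Gamma> p p' (Id_type A a b) \<Longrightarrow>
          ElemEq S \<Gamma> ts ts' (subst_tele (inst [p, b, a]) \<Psi>) \<Longrightarrow>
          TmEq S \<Gamma> (J A \<Psi> C d a b p ts) (J A' \<Psi>' C' d' a' b' p' ts')
            (subst (inst (ts @ [p, b, a])) C)"

locale discrete_identity_types = identity_types S for S :: "'s judgements" +
  assumes Id_discrete: "Tm S \<Gamma> p (Id_type A a b) \<Longrightarrow> Tm S \<Gamma> q (Id_type A a b) \<Longrightarrow>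
          Tm S \<Gamma> \<alpha> (Id_type (Id_type A a b) p q) \<Longrightarrow>
          TmEq S \<Gamma> p q (Id_type A a b) \<and> TmEq S \<Gamma> \<alpha> (Refl (Id_type A a b) p) (Id_type (Id_type A a b) p q)"


section \<open>Identity contexts\<close>

text \<open>
  Componentwise elimination for a single type \<open>A\<close> into a context \<open>\<Theta>\<close>. The result is the vector
  of open terms \<open>J\<^sub>d(x, y, p)\<close> in context \<open>\<Psi>, p, y, x\<close> (last variable first), whence the
  weakening of the parameters.
\<close>

definition J_open :: "'s exp \<Rightarrow> 's exp list \<Rightarrow> 's exp \<Rightarrow> 's exp \<Rightarrow> 's exp" where
  "J_open A \<Psi> C d = (let m = length \<Psi>; w = (\<lambda>i. Var (i + (3 + m))) in
     J (subst w A) (subst_tele (lifts 3 w) \<Psi>) (subst (lifts (3 + m) w) C)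
       (subst (lifts (1 + m) w) d) (Var (m + 2)) (Var (m + 1)) (Var m) (vars 0 m))"

fun J_type :: "'s exp \<Rightarrow> 's exp list \<Rightarrow> 's exp list \<Rightarrow> 's exp list \<Rightarrow> 's exp list" where
  "J_type A \<Psi> (D # \<Theta>) (d # ds) =
     (let js = J_type A \<Psi> \<Theta> ds in J_open A \<Psi> (subst (inst js) D) d # js)"
| "J_type A \<Psi> _ _ = []"

text \<open>
  From here on \<open>\<Lambda>\<close>, \<open>\<Phi>\<close> are closed contexts, of length \<open>n\<close>. The open vector
  \<open>J_ctxt \<Phi> \<Psi> \<Theta> d\<close> is the result of \<open>Id\<^sub>\<Phi>\<close>-elimination, in context \<open>\<Psi>, p, y, x\<close> where
  \<open>x, y : \<Phi>\<close> and \<open>p : Id\<^sub>\<Phi>(x, y)\<close>, into the telescope \<open>\<Theta>\<close>. In the following two definitions, \<open>JL\<close>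
  stands for elimination over a context of length \<open>n\<close>.
  The transport \<open>p\<^sup>*z\<close> is an open vector in context \<open>z, p, x', x\<close>.
\<close>

type_synonym 's elim = "'s exp list \<Rightarrow> 's exp list \<Rightarrow> 's exp list \<Rightarrow> 's exp list"

definition transport :: "nat \<Rightarrow> 's elim \<Rightarrow> 's exp list \<Rightarrow> 's exp list" where
  "transport n JL \<Upsilon> = (let k = length \<Upsilon> in
     JL (subst_tele (inst (vars n n)) \<Upsilon>)
        (subst_tele (inst (vars (k + 2 * n) n)) \<Upsilon>) (vars 0 k))"

text \<open>The type \<open>Id\<^bsub>D(x)\<^esub>(y, p\<^sup>*y')\<close>.\<close>

definition Id_over :: "nat \<Rightarrow> 's elim \<Rightarrow> 's exp \<Rightarrow> 's exp list \<Rightarrow> 's exp list \<Rightarrow> 's exp list \<Rightarrow>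
    's exp \<Rightarrow> 's exp \<Rightarrow> 's exp" where
  "Id_over n JL D x x' p y y' =
     Id_type (subst (inst x) D) y (subst (inst (y' # p @ x' @ x)) (hd (transport n JL [D])))"

fun refl_ctxt :: "'s exp list \<Rightarrow> 's exp list" where
  "refl_ctxt [] = []"
| "refl_ctxt (D # \<Lambda>) = Refl (shift 1 D) (Var 0) # map (shift 1) (refl_ctxt \<Lambda>)"

text \<open>
  Elimination over \<open>\<Lambda>, D\<close> from elimination over \<open>\<Lambda>\<close>. The context of the result is
  \<open>\<Psi>, q, p, y', x', y, x\<close> with \<open>x, x' : \<Lambda>\<close>; elimination over \<open>\<Lambda>\<close> is performed in
  \<open>\<Psi>, q, y', y, p, x', x\<close>. Substitution of \<open>reord\<close> passes from the former to the
  latter, that of \<open>back\<close> in the other direction, and \<open>dia\<close> sets \<open>(x', p) := (x, r(x))\<close>.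
\<close>

definition J_step :: "'s exp \<Rightarrow> 's exp list \<Rightarrow> 's elim \<Rightarrow> 's elim" where
  "J_step D \<Lambda> JL \<Psi> \<Theta> d =
     (let n = length \<Lambda>; m = length \<Psi>;
          reord = inst (Var 0 # vars 3 n @ Var 1 # vars (n + 3) n @ Var 2 # vars (2 * n + 3) n);
          back = inst (Var 0 # Var (n + 1) # Var (2 * n + 2) #
                       vars 1 n @ vars (n + 2) n @ vars (2 * n + 3) n);
          dia = inst (vars 0 3 @ map (shift 3) (refl_ctxt \<Lambda>) @ vars 3 n @ vars 3 n);
          Y = subst (inst (vars (2 * n) n)) D;
          Y' = subst (inst (vars (n + 1) n)) D;
          Q = Id_over n JL D (vars (2 * n + 2) n) (vars (n + 2) n) (vars 2 n) (Var 1) (Var 0);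
          \<Psi>' = subst_tele reord \<Psi>;
          \<Theta>' = subst_tele (lifts m reord) \<Theta>;
          d' = J_type D (subst_tele dia \<Psi>') (subst_tele (lifts m dia) \<Theta>') d
      in subst_vec (lifts m back) (JL (\<Psi>' @ [Q, Y', Y]) \<Theta>' d'))"

primrec J_ctxt :: "'s exp list \<Rightarrow> 's elim" where
  "J_ctxt [] = (\<lambda>\<Psi> \<Theta> d. d)"
| "J_ctxt (D # \<Lambda>) = J_step D \<Lambda> (J_ctxt \<Lambda>)"

text \<open>\<open>Id_gen \<Phi>\<close> is the telescope \<open>Id\<^sub>\<Phi>(x, x')\<close> over \<open>x', x\<close>.\<close>

primrec Id_gen :: "'s exp list \<Rightarrow> 's exp list" where
  "Id_gen [] = []"
| "Id_gen (D # \<Lambda>) = (let n = length \<Lambda> in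
     Id_over n (J_ctxt \<Lambda>) D (vars (2 * n + 2) n) (vars (n + 1) n) (vars 0 n)
       (Var (2 * n + 1)) (Var n) #
     subst_tele (inst (vars 1 n @ vars (n + 2) n)) (Id_gen \<Lambda>))"

definition Id_ctxt :: "'s exp list \<Rightarrow> 's exp list \<Rightarrow> 's exp list \<Rightarrow> 's exp list" where
  "Id_ctxt \<Phi> a b = subst_tele (inst (b @ a)) (Id_gen \<Phi>)"


section \<open>Normal isofibrations\<close>

text \<open>The data of a (strict) 2-category. Composition of 1-cells and of 2-cells is written in
  the order \<open>g \<circ> f\<close>; \<open>lwhisk h \<alpha>\<close> is \<open>h\<alpha>\<close> and \<open>rwhisk \<alpha> k\<close> is \<open>\<alpha>k\<close>.\<close>

record ('o, 'a, 'c) two_category =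
  Obj :: "'o set"
  Hom :: "'o \<Rightarrow> 'o \<Rightarrow> 'a set"
  Cell :: "'a \<Rightarrow> 'a \<Rightarrow> 'c set"
  ident :: "'o \<Rightarrow> 'a"
  comp1 :: "'a \<Rightarrow> 'a \<Rightarrow> 'a"
  idcell :: "'a \<Rightarrow> 'c"
  vcomp :: "'c \<Rightarrow> 'c \<Rightarrow> 'c"
  lwhisk :: "'a \<Rightarrow> 'c \<Rightarrow> 'c"
  rwhisk :: "'c \<Rightarrow> 'a \<Rightarrow> 'c"

definition invertible_cell :: "('o, 'a, 'c) two_category \<Rightarrow> 'a \<Rightarrow> 'a \<Rightarrow> 'c \<Rightarrow> bool" where
  "invertible_cell K f g \<alpha> \<longleftrightarrow> \<alpha> \<in> Cell K f g \<and>
     (\<exists>\<beta> \<in> Cell K g f. vcomp K \<beta> \<alpha> = idcell K f \<and> vcomp K \<alpha> \<beta> = idcell K g)"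

text \<open>The lift of \<open>\<alpha> : f \<Rightarrow> pg\<close> with \<open>f : W \<rightarrow> Y\<close> and \<open>g : W \<rightarrow> X\<close> is \<open>\<sigma> W f g \<alpha> : s W f g \<alpha> \<Rightarrow> g\<close>.\<close>

definition cloven_isofibration :: "('o, 'a, 'c) two_category \<Rightarrow> 'o \<Rightarrow> 'o \<Rightarrow> 'a \<Rightarrow>
    ('o \<Rightarrow> 'a \<Rightarrow> 'a \<Rightarrow> 'c \<Rightarrow> 'a) \<Rightarrow> ('o \<Rightarrow> 'a \<Rightarrow> 'a \<Rightarrow> 'c \<Rightarrow> 'c) \<Rightarrow> bool" where
  "cloven_isofibration K X Y p s \<sigma> \<longleftrightarrow> X \<in> Obj K \<and> Y \<in> Obj K \<and> p \<in> Hom K X Y \<and>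
     (\<forall>W \<in> Obj K. \<forall>f \<in> Hom K W Y. \<forall>g \<in> Hom K W X. \<forall>\<alpha>. invertible_cell K f (comp1 K p g) \<alpha> \<longrightarrow>
        s W f g \<alpha> \<in> Hom K W X \<and> \<sigma> W f g \<alpha> \<in> Cell K (s W f g \<alpha>) g \<and>
        comp1 K p (s W f g \<alpha>) = f \<and> lwhisk K p (\<sigma> W f g \<alpha>) = \<alpha> \<and>
        (\<forall>W' \<in> Obj K. \<forall>k \<in> Hom K W' W.
           s W' (comp1 K f k) (comp1 K g k) (rwhisk K \<alpha> k) = comp1 K (s W f g \<alpha>) k \<and>
           \<sigma> W' (comp1 K f k) (comp1 K g k) (rwhisk K \<alpha> k) = rwhisk K (\<sigma> W f g \<alpha>) k))"

definition normal_isofibration :: "('o, 'a, 'c) two_category \<Rightarrow> 'o \<Rightarrow> 'o \<Rightarrow> 'a \<Rightarrow>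
    ('o \<Rightarrow> 'a \<Rightarrow> 'a \<Rightarrow> 'c \<Rightarrow> 'a) \<Rightarrow> ('o \<Rightarrow> 'a \<Rightarrow> 'a \<Rightarrow> 'c \<Rightarrow> 'c) \<Rightarrow> bool" where
  "normal_isofibration K X Y p s \<sigma> \<longleftrightarrow> cloven_isofibration K X Y p s \<sigma> \<and>
     (\<forall>W \<in> Obj K. \<forall>g \<in> Hom K W X.
        s W (comp1 K p g) g (idcell K (comp1 K p g)) = g \<and>
        \<sigma> W (comp1 K p g) g (idcell K (comp1 K p g)) = idcell K g)"


section \<open>The 2-category of contexts\<close>

subsection \<open>Operations on representatives\<close>

text \<open>\<open>g(f(x))\<close>, and more generally the substitution of \<open>f\<close> into a vector.\<close>

definition vec_at :: "'s exp list \<Rightarrow> 's exp list \<Rightarrow> 's exp list" where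
  "vec_at g f = subst_vec (inst f) g"

text \<open>\<open>q \<circ> p\<close> by elimination on \<open>q : Id\<^sub>\<Delta>(y, z)\<close> with post-context \<open>x : \<Delta>, p : Id\<^sub>\<Delta>(x, y)\<close>;
  the open vector lives in context \<open>p, x, q, z, y\<close>.\<close>

definition comp_gen :: "'s exp list \<Rightarrow> 's exp list" where
  "comp_gen \<Delta> = (let n = length \<Delta> in
     J_ctxt \<Delta> (Id_ctxt \<Delta> (vars 0 n) (vars (3 * n) n) @ \<Delta>)
       (Id_ctxt \<Delta> (vars n n) (vars (3 * n) n)) (vars 0 n))"

text \<open>\<open>\<beta> \<circ> \<alpha>\<close> for \<open>\<alpha> : f \<Rightarrow> g\<close> and \<open>\<beta> : g \<Rightarrow> h\<close>.\<close>

definition vcomp_rep :: "'s exp list \<Rightarrow> 's exp list \<Rightarrow> 's exp list \<Rightarrow> 's exp list \<Rightarrow>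
    's exp list \<Rightarrow> 's exp list \<Rightarrow> 's exp list" where
  "vcomp_rep \<Delta> f g h \<beta> \<alpha> = vec_at (comp_gen \<Delta>) (\<alpha> @ f @ \<beta> @ h @ g)"

text \<open>\<open>h\<^sup>\<bullet>(p)\<close> for \<open>h : \<Gamma> \<rightarrow> \<Delta>\<close>, an open vector in context \<open>p, y, x\<close> with \<open>p : Id\<^sub>\<Gamma>(x, y)\<close>.\<close>

definition ap_gen :: "'s exp list \<Rightarrow> 's exp list \<Rightarrow> 's exp list \<Rightarrow> 's exp list" where
  "ap_gen \<Gamma> h \<Delta> = (let n = length \<Gamma> in
     J_ctxt \<Gamma> [] (Id_ctxt \<Delta> (vec_at h (vars (2 * n) n)) (vec_at h (vars n n))) (vec_at (refl_ctxt \<Delta>) h))"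

text \<open>\<open>h\<alpha>\<close> for \<open>\<alpha> : f \<Rightarrow> g\<close> into \<open>\<Gamma>\<close> and \<open>h : \<Gamma> \<rightarrow> \<Delta>\<close>.\<close>

definition lwhisk_rep :: "'s exp list \<Rightarrow> 's exp list \<Rightarrow> 's exp list \<Rightarrow> 's exp list \<Rightarrow>
    's exp list \<Rightarrow> 's exp list \<Rightarrow> 's exp list" where
  "lwhisk_rep \<Gamma> h \<Delta> f g \<alpha> = vec_at (ap_gen \<Gamma> h \<Delta>) (\<alpha> @ g @ f)"

subsection \<open>Cells modulo definitional equality\<close>

text \<open>0-, 1- and 2-cells are equivalence classes of well-formed representatives
  \<open>\<Gamma>\<close>, \<open>(\<Gamma>, f, \<Delta>)\<close> and \<open>(\<Gamma>, f, \<alpha>, g, \<Delta>)\<close>, where \<open>f, g : \<Gamma> \<rightarrow> \<Delta>\<close> and \<open>\<alpha> : f \<Rightarrow> g\<close>.\<close>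

type_synonym 's ob = "'s exp list set"
type_synonym 's arr = "('s exp list \<times> 's exp list \<times> 's exp list) set"
type_synonym 's cell =
  "('s exp list \<times> 's exp list \<times> 's exp list \<times> 's exp list \<times> 's exp list) set"

definition ob_class :: "'s judgements \<Rightarrow> 's exp list \<Rightarrow> 's ob" where
  "ob_class S \<Gamma> = {\<Gamma>'. CtxtEq S \<Gamma> \<Gamma>'}"

definition arr_class :: "'s judgements \<Rightarrow> 's exp list \<Rightarrow> 's exp list \<Rightarrow> 's exp list \<Rightarrow> 's arr" where
  "arr_class S \<Gamma> f \<Delta> =
     {(\<Gamma>', f', \<Delta>'). CtxtEq S \<Gamma> \<Gamma>' \<and> CtxtEq S \<Delta> \<Delta>' \<and> ElemEq S \<Gamma> f f' \<Delta>}"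

definition cell_class :: "'s judgements \<Rightarrow> 's exp list \<Rightarrow> 's exp list \<Rightarrow> 's exp list \<Rightarrow>
    's exp list \<Rightarrow> 's exp list \<Rightarrow> 's cell" where
  "cell_class S \<Gamma> f \<alpha> g \<Delta> =
     {(\<Gamma>', f', \<alpha>', g', \<Delta>'). CtxtEq S \<Gamma> \<Gamma>' \<and> CtxtEq S \<Delta> \<Delta>' \<and>
        ElemEq S \<Gamma> f f' \<Delta> \<and> ElemEq S \<Gamma> g g' \<Delta> \<and> ElemEq S \<Gamma> \<alpha> \<alpha>' (Id_ctxt \<Delta> f g)}"

text \<open>Operations on classes are unions of the classes obtained from all composable
  representatives.\<close>

definition ctxt_two_category :: "'s judgements \<Rightarrow> ('s ob, 's arr, 's cell) two_category" where
  "ctxt_two_category S =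
   \<lparr> Obj = {ob_class S \<Gamma> | \<Gamma>. Ctxt S \<Gamma>},
     Hom = (\<lambda>X Y. {arr_class S \<Gamma> f \<Delta> | \<Gamma> f \<Delta>.
       \<Gamma> \<in> X \<and> \<Delta> \<in> Y \<and> Ctxt S \<Gamma> \<and> Ctxt S \<Delta> \<and> Elem S \<Gamma> f \<Delta>}),
     Cell = (\<lambda>F G. {cell_class S \<Gamma> f \<alpha> g \<Delta> | \<Gamma> f \<alpha> g \<Delta>.
       (\<Gamma>, f, \<Delta>) \<in> F \<and> (\<Gamma>, g, \<Delta>) \<in> G \<and> Elem S \<Gamma> \<alpha> (Id_ctxt \<Delta> f g)}),
     ident = (\<lambda>X. \<Union>{arr_class S \<Gamma> (vars 0 (length \<Gamma>)) \<Gamma> | \<Gamma>. \<Gamma> \<in> X}),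
     comp1 = (\<lambda>G F. \<Union>{arr_class S \<Gamma> (vec_at g f) \<Theta> | \<Gamma> f \<Delta> g \<Theta>.
       (\<Gamma>, f, \<Delta>) \<in> F \<and> (\<Delta>, g, \<Theta>) \<in> G}),
     idcell = (\<lambda>F. \<Union>{cell_class S \<Gamma> f (vec_at (refl_ctxt \<Delta>) f) f \<Delta> | \<Gamma> f \<Delta>. (\<Gamma>, f, \<Delta>) \<in> F}),
     vcomp = (\<lambda>B A. \<Union>{cell_class S \<Gamma> f (vcomp_rep \<Delta> f g h \<beta> \<alpha>) h \<Delta> | \<Gamma> f \<alpha> g \<beta> h \<Delta>.
       (\<Gamma>, f, \<alpha>, g, \<Delta>) \<in> A \<and> (\<Gamma>, g, \<beta>, h, \<Delta>) \<in> B}),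
     lwhisk = (\<lambda>H A. \<Union>{cell_class S \<Gamma> (vec_at h f) (lwhisk_rep \<Delta> h \<Theta> f g \<alpha>) (vec_at h g) \<Theta> |
       \<Gamma> f \<alpha> g \<Delta> h \<Theta>. (\<Gamma>, f, \<alpha>, g, \<Delta>) \<in> A \<and> (\<Delta>, h, \<Theta>) \<in> H}),
     rwhisk = (\<lambda>A K. \<Union>{cell_class S \<Gamma> (vec_at f k) (vec_at \<alpha> k) (vec_at g k) \<Theta> |
       \<Gamma> k \<Delta> f \<alpha> g \<Theta>. (\<Gamma>, k, \<Delta>) \<in> K \<and> (\<Delta>, f, \<alpha>, g, \<Theta>) \<in> A}) \<rparr>"

definition dep_proj :: "'s judgements \<Rightarrow> 's exp list \<Rightarrow> 's exp \<Rightarrow> 's arr" where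
  "dep_proj S \<Delta> B = arr_class S (B # \<Delta>) (vars 1 (length \<Delta>)) \<Delta>"

end

theory Submission
  imports Defs
begin

text \<open>
  Given \<open>\<alpha> : f \<Rightarrow> \<pi>(g, b)\<close>, the lift is \<open>s\<^sub>\<alpha> = (f, \<alpha>\<^sup>*b)\<close> with \<open>\<sigma>\<^sub>\<alpha> = (\<alpha>, r(\<alpha>\<^sup>*b))\<close>, which has the right
  type because \<open>Id\<close> over \<open>\<Delta>.B\<close> compares \<open>\<alpha>\<^sup>*b\<close> with \<open>\<alpha>\<^sup>*b\<close>. Transport is a fixed open term, so the lift
  commutes with substitution, and \<open>r(x)\<^sup>*b = b\<close> gives normality. That \<open>\<pi>\<sigma>\<^sub>\<alpha> = \<alpha>\<close> is a consequence of
  discreteness: \<open>\<pi>\<^sup>\<bullet>(p, q)\<close> and \<open>p\<close> agree when \<open>p, q\<close> are reflexivities, and two elements of an identity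
  context that agree there are propositionally, hence definitionally, equal. Elimination over identity
  contexts is shown to be well-typed, to compute and to respect definitional equality by
  induction on the length of the context.
\<close>

section \<open>Substitution\<close>

text \<open>Typing, congruence and computation of elimination over a context have to go through one
  induction. The identity context of \<open>\<Lambda>, D\<close> contains transport over
  \<open>\<Lambda>\<close>, so even its well-formedness needs elimination over
  \<open>\<Lambda>\<close>. The pair \<open>(r(x), r(y))\<close> has the right type only because
  transport along \<open>r(x)\<close> is definitionally the identity, which is the computation rule
  for \<open>\<Lambda>\<close>. Types built from earlier components therefore often agree only up to
  definitional equality, and conversions have to be carried along. Congruence is stated for two
  equal contexts \<open>\<Lambda>\<close> and \<open>\<Lambda>'\<close> because cells are classes:
  the operations range over all representatives, contexts included, and each has to be independent
  of that choice. The post-context stays arbitrary in the induction, since the step for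
  \<open>\<Lambda>, D\<close> eliminates over \<open>\<Lambda>\<close> with \<open>y, y', q\<close>
  added to it.\<close>

lemma exp_induct [case_names Var Op]:
  assumes "\<And>i. P (Var i)" and "\<And>s ts. (\<And>k t. (k, t) \<in> set ts \<Longrightarrow> P t) \<Longrightarrow> P (Op s ts)"
  shows "P t"
proof (induction t)
  case (Op s ts)
  show ?case
    by (rule assms(2), rule Op) auto
qed (rule assms(1))

lemma ren_ren: "ren r (ren r' t) = ren (\<lambda>i. r (r' i)) t"
proof (induction t arbitrary: r r' rule: exp_induct)
  case (Op s ts)
  have eq: "(\<lambda>i. liftr k r (liftr k r' i)) = liftr k (\<lambda>i. r (r' i))" for k
    by (auto simp: liftr_def)
  show ?case
    using Op by (auto simp: eq)
qed simp

lemma ren_eq_subst: "ren r t = subst (\<lambda>i. Var (r i)) t"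
proof (induction t arbitrary: r rule: exp_induct)
  case (Op s ts)
  have eq: "lifts k (\<lambda>i. Var (r i)) = (\<lambda>i. Var (liftr k r i))" for k
    by (auto simp: lifts_def liftr_def shift_def)
  show ?case
    using Op by (auto simp: eq)
qed simp

lemma subst_ren: "subst \<sigma> (ren r t) = subst (\<lambda>i. \<sigma> (r i)) t"
proof (induction t arbitrary: r \<sigma> rule: exp_induct)
  case (Op s ts)
  have eq: "(\<lambda>i. lifts k \<sigma> (liftr k r i)) = lifts k (\<lambda>i. \<sigma> (r i))" for k
    by (auto simp: lifts_def liftr_def shift_def)
  show ?case
    using Op by (auto simp: eq)
qed simp

lemma ren_subst: "ren r (subst \<sigma> t) = subst (\<lambda>i. ren r (\<sigma> i)) t"
proof (induction t arbitrary: r \<sigma> rule: exp_induct)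
  case (Op s ts)
  have eq: "(\<lambda>i. ren (liftr k r) (lifts k \<sigma> i)) = lifts k (\<lambda>i. ren r (\<sigma> i))" for k
    by (auto simp: lifts_def liftr_def shift_def ren_ren)
  show ?case
    using Op by (auto simp: eq)
qed simp

text \<open>Under a binder this needs the laws that move \<open>shift\<close> past a substitution,
  which is why renamings come first. With it, an equation between iterated substitutions is checked
  on variables only.\<close>

lemma subst_subst: "subst \<sigma> (subst \<tau> t) = subst (\<lambda>i. subst \<sigma> (\<tau> i)) t"
proof (induction t arbitrary: \<sigma> \<tau> rule: exp_induct)
  case (Op s ts)
  have eq: "(\<lambda>i. subst (lifts k \<sigma>) (lifts k \<tau> i)) = lifts k (\<lambda>i. subst \<sigma> (\<tau> i))" for k
    by (auto simp: lifts_def shift_def subst_ren ren_subst)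
  show ?case
    using Op by (auto simp: eq)
qed simp

lemma lifts_Var [simp]: "lifts k Var = Var"
  by (auto simp: lifts_def shift_def)

lemma subst_Var [simp]: "subst Var t = t"
  by (induction t rule: exp_induct) (auto intro!: map_idI)

lemma shift_eq_subst: "shift k t = subst (\<lambda>i. Var (i + k)) t"
  by (simp add: shift_def ren_eq_subst)

lemma lifts_eq: "lifts k \<sigma> i = (if i < k then Var i else subst (\<lambda>j. Var (j + k)) (\<sigma> (i - k)))"
  by (simp add: lifts_def shift_eq_subst)

lemma lifts_0 [simp]: "lifts 0 \<sigma> = \<sigma>"
  by (auto simp: lifts_eq)

text \<open>Substitutions are total functions on indices, and formulas for the same morphism often
  differ beyond the context. Comparing them on the variables in scope yields most later equalities
  of raw terms.\<close>

lemma subst_eqI: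
  assumes "scoped n t" "\<And>i. i < n \<Longrightarrow> \<sigma> i = \<tau> i"
  shows "subst \<sigma> t = subst \<tau> t"
  using assms
proof (induction t arbitrary: n \<sigma> \<tau> rule: exp_induct)
  case (Op s ts)
  have "subst (lifts k \<sigma>) t = subst (lifts k \<tau>) t" if "(k, t) \<in> set ts" for k t
  proof (rule Op(1)[OF that])
    show "scoped (k + n) t" using Op(2) that by auto
  qed (use Op(3) in \<open>auto simp: lifts_eq\<close>)
  then show ?case by auto
qed auto

lemma subst_lifts_subst: "subst (lifts k \<sigma>) (subst (lifts k \<tau>) t) = subst (lifts k (\<lambda>i. subst \<sigma> (\<tau> i))) t"
proof -
  have "(\<lambda>i. subst (lifts k \<sigma>) (lifts k \<tau> i)) = lifts k (\<lambda>i. subst \<sigma> (\<tau> i))"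
    by (auto simp: lifts_eq subst_subst)
  then show ?thesis by (simp add: subst_subst)
qed

lemma lifts_lifts: "lifts k (lifts l \<sigma>) = lifts (k + l) \<sigma>"
  by (auto simp: lifts_eq subst_subst fun_eq_iff diff_diff_eq add.commute add.left_commute)

lemma length_subst_tele [simp]: "length (subst_tele \<sigma> \<Psi>) = length \<Psi>"
  by (induction \<Psi>) auto

lemma subst_tele_subst_tele:
  "subst_tele \<sigma> (subst_tele \<tau> \<Psi>) = subst_tele (\<lambda>i. subst \<sigma> (\<tau> i)) \<Psi>"
  by (induction \<Psi>) (auto simp: subst_lifts_subst)

lemma subst_tele_append:
  "subst_tele \<sigma> (\<Psi> @ \<Phi>) = subst_tele (lifts (length \<Phi>) \<sigma>) \<Psi> @ subst_tele \<sigma> \<Phi>"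
  by (induction \<Psi>) (auto simp: lifts_lifts)

lemma subst_tele_Var [simp]: "subst_tele Var \<Psi> = \<Psi>"
  by (induction \<Psi>) auto

fun scoped_tele :: "nat \<Rightarrow> 's exp list \<Rightarrow> bool" where
  "scoped_tele n [] \<longleftrightarrow> True"
| "scoped_tele n (D # \<Psi>) \<longleftrightarrow> scoped_tele n \<Psi> \<and> scoped (n + length \<Psi>) D"

lemma subst_tele_eqI:
  assumes "scoped_tele n \<Psi>" "\<And>i. i < n \<Longrightarrow> \<sigma> i = \<tau> i"
  shows "subst_tele \<sigma> \<Psi> = subst_tele \<tau> \<Psi>"
  using assms
proof (induction \<Psi>)
  case (Cons D \<Psi>)
  have "subst (lifts (length \<Psi>) \<sigma>) D = subst (lifts (length \<Psi>) \<tau>) D"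
    by (rule subst_eqI[where n = "n + length \<Psi>"]) (use Cons in \<open>auto simp: lifts_eq\<close>)
  then show ?case using Cons by auto
qed auto

lemma subst_tele_closed: "scoped_tele 0 \<Psi> \<Longrightarrow> subst_tele \<sigma> \<Psi> = \<Psi>"
  using subst_tele_eqI[of 0 \<Psi> \<sigma> Var] by simp

lemma inst_Nil [simp]: "inst [] = Var"
  by (auto simp: inst_def)

lemma inst_Cons_0 [simp]: "inst (t # ts) 0 = t"
  by (auto simp: inst_def)

lemma inst_Cons_Suc [simp]: "inst (t # ts) (Suc i) = inst ts i"
  by (auto simp: inst_def)

lemma inst_append: "inst (ts @ us) i = (if i < length ts then ts ! i else inst us (i - length ts))"
  by (auto simp: inst_def nth_append)

lemma inst_eq_nth: "i < length ts \<Longrightarrow> inst ts i = ts ! i"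
  by (auto simp: inst_def)

lemma inst_length [simp]: "inst ts (i + length ts) = Var i" "inst ts (length ts + i) = Var i"
  by (auto simp: inst_def)

lemma length_vars [simp]: "length (vars k n) = n"
  by (simp add: vars_def)

lemma vars_nth [simp]: "i < n \<Longrightarrow> vars k n ! i = Var (i + k)"
  by (simp add: vars_def)

lemma inst_vars: "i < n \<Longrightarrow> inst (vars k n) i = Var (i + k)"
  by (simp add: inst_def)

lemma vars_0 [simp]: "vars k 0 = []"
  by (simp add: vars_def)

lemma inst_lifts: "subst (inst ts) (lifts (length ts) (inst us) i) = inst (ts @ us) i"
  by (auto simp: lifts_eq inst_append inst_eq_nth subst_subst)

lemma subst_inst_lifts: "length ts = k \<Longrightarrow> subst (inst ts) (subst (lifts k \<sigma>) t) =
    subst (\<lambda>i. if i < k then ts ! i else \<sigma> (i - k)) t"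
  unfolding subst_subst by (rule arg_cong[where f = "\<lambda>s. subst s t"])
    (auto simp: lifts_eq inst_eq_nth subst_subst)

lemma length_subst_vec [simp]: "length (subst_vec \<sigma> ts) = length ts"
  by (simp add: subst_vec_def)

lemma subst_vec_Nil [simp]: "subst_vec \<sigma> [] = []"
  by (simp add: subst_vec_def)

lemma subst_vec_Cons [simp]: "subst_vec \<sigma> (t # ts) = subst \<sigma> t # subst_vec \<sigma> ts"
  by (simp add: subst_vec_def)

lemma subst_vec_nth [simp]: "i < length ts \<Longrightarrow> subst_vec \<sigma> ts ! i = subst \<sigma> (ts ! i)"
  by (simp add: subst_vec_def)

lemma subst_vec_subst_vec: "subst_vec \<sigma> (subst_vec \<tau> ts) = subst_vec (\<lambda>i. subst \<sigma> (\<tau> i)) ts"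
  by (simp add: subst_vec_def subst_subst)

lemma subst_vec_Var [simp]: "subst_vec Var ts = ts"
  by (simp add: subst_vec_def map_idI)

lemma map_shift_eq: "map (shift k) ts = subst_vec (\<lambda>i. Var (i + k)) ts"
  by (simp add: subst_vec_def shift_eq_subst)

lemma subst_vec_eqI:
  "(\<And>t. t \<in> set ts \<Longrightarrow> scoped n t) \<Longrightarrow> (\<And>i. i < n \<Longrightarrow> \<sigma> i = \<tau> i) \<Longrightarrow> subst_vec \<sigma> ts = subst_vec \<tau> ts"
  by (auto simp: subst_vec_def intro: subst_eqI)

text \<open>Both sides send the first \<open>length ts\<close> variables to the substituted vector
  and the rest to \<sigma>. In this form the type of an entry, which depends on the earlier entries,
  passes through a substitution.\<close>

lemma subst_inst_vec: "subst \<sigma> (subst (inst ts) t) = subst (inst (subst_vec \<sigma> ts)) (subst (lifts (length ts) \<sigma>) t)"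
  by (simp add: subst_inst_lifts)
    (auto simp: subst_subst inst_def intro!: arg_cong[where f = "\<lambda>s. subst s t"])

lemma subst_Id_type [simp]: "subst \<sigma> (Id_type A a b) = Id_type (subst \<sigma> A) (subst \<sigma> a) (subst \<sigma> b)"
  by (simp add: Id_type_def)

lemma subst_Refl [simp]: "subst \<sigma> (Refl A a) = Refl (subst \<sigma> A) (subst \<sigma> a)"
  by (simp add: Refl_def)

lemma map_bind_tele:
  "map (\<lambda>(j, t). (j, subst (lifts j \<sigma>) t)) (bind_tele k \<Psi>) = bind_tele k (subst_tele (lifts k \<sigma>) \<Psi>)"
  by (induction \<Psi>) (auto simp: lifts_lifts add.commute)

lemma subst_J: "subst \<sigma> (J A \<Psi> C d a b p ts) =
    J (subst \<sigma> A) (subst_tele (lifts 3 \<sigma>) \<Psi>) (subst (lifts (3 + length \<Psi>) \<sigma>) C)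
      (subst (lifts (1 + length \<Psi>) \<sigma>) d) (subst \<sigma> a) (subst \<sigma> b) (subst \<sigma> p) (subst_vec \<sigma> ts)"
  by (simp add: J_def map_bind_tele subst_vec_def)

section \<open>Definitional equality of substitutions\<close>

text \<open>\<open>SubEq S \<Gamma> \<sigma> \<tau> \<Delta>\<close>: the morphisms \<open>\<sigma>, \<tau> : \<Gamma> \<rightarrow> \<Delta>\<close> are definitionally equal; the values of
  \<open>\<sigma>\<close> and \<open>\<tau>\<close> beyond \<open>length \<Delta>\<close> are irrelevant. Well-typedness of terms, vectors and substitutions
  is handled throughout as definitional equality to themselves.\<close>

fun SubEq :: "'s judgements \<Rightarrow> 's exp list \<Rightarrow> (nat \<Rightarrow> 's exp) \<Rightarrow> (nat \<Rightarrow> 's exp) \<Rightarrow> 's exp list \<Rightarrow> bool" where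
  "SubEq S \<Gamma> \<sigma> \<tau> [] \<longleftrightarrow> Ctxt S \<Gamma>"
| "SubEq S \<Gamma> \<sigma> \<tau> (A # \<Delta>) \<longleftrightarrow> SubEq S \<Gamma> (\<lambda>i. \<sigma> (Suc i)) (\<lambda>i. \<tau> (Suc i)) \<Delta> \<and>
     TmEq S \<Gamma> (\<sigma> 0) (\<tau> 0) (subst (\<lambda>i. \<sigma> (Suc i)) A)"

lemma ElemEq_induct [consumes 1, case_names Nil Cons]:
  assumes "ElemEq S \<Gamma> ts us \<Psi>" "Ctxt S \<Gamma> \<Longrightarrow> P [] [] []"
    "\<And>t ts u us D \<Psi>. ElemEq S \<Gamma> ts us \<Psi> \<Longrightarrow> TmEq S \<Gamma> t u (subst (inst ts) D) \<Longrightarrow>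
      P ts us \<Psi> \<Longrightarrow> P (t # ts) (u # us) (D # \<Psi>)"
  shows "P ts us \<Psi>"
  using assms(1)
proof (induction \<Psi> arbitrary: ts us)
  case Nil
  then show ?case using assms(2) by (cases ts; cases us) auto
next
  case (Cons D \<Psi>)
  then show ?case using assms(3) by (cases ts; cases us) auto
qed

lemma Elem_induct [consumes 1, case_names Nil Cons]:
  assumes "Elem S \<Gamma> ts \<Psi>" "Ctxt S \<Gamma> \<Longrightarrow> P [] []"
    "\<And>t ts D \<Psi>. Elem S \<Gamma> ts \<Psi> \<Longrightarrow> Tm S \<Gamma> t (subst (inst ts) D) \<Longrightarrow>
      P ts \<Psi> \<Longrightarrow> P (t # ts) (D # \<Psi>)"
  shows "P ts \<Psi>"
  using assms(1)
proof (induction \<Psi> arbitrary: ts)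
  case Nil
  then show ?case using assms(2) by (cases ts) auto
next
  case (Cons D \<Psi>)
  then show ?case using assms(3) by (cases ts) auto
qed

lemma CtxtEq_induct [consumes 1, case_names Nil Cons]:
  assumes "CtxtEq S \<Gamma> \<Gamma>'" "P [] []"
    "\<And>A \<Gamma> A' \<Gamma>'. CtxtEq S \<Gamma> \<Gamma>' \<Longrightarrow> TyEq S \<Gamma> A A' \<Longrightarrow> P \<Gamma> \<Gamma>' \<Longrightarrow> P (A # \<Gamma>) (A' # \<Gamma>')"
  shows "P \<Gamma> \<Gamma>'"
  using assms(1)
proof (induction \<Gamma> arbitrary: \<Gamma>')
  case Nil
  then show ?case using assms(2) by (cases \<Gamma>') auto
next
  case (Cons D \<Psi>)
  then show ?case using assms(3) by (cases \<Gamma>') auto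
qed

lemma ElemEq_length: "ElemEq S \<Gamma> ts us \<Psi> \<Longrightarrow> length ts = length \<Psi> \<and> length us = length \<Psi>"
  by (induction rule: ElemEq_induct) auto

lemma ElemEq_iff_SubEq:
  "length ts = length \<Psi> \<Longrightarrow> length us = length \<Psi> \<Longrightarrow>
    ElemEq S \<Gamma> ts us \<Psi> \<longleftrightarrow> SubEq S \<Gamma> (inst ts) (inst us) \<Psi>"
proof (induction \<Psi> arbitrary: ts us)
  case (Cons D \<Psi>)
  then show ?case by (cases ts; cases us) auto
qed auto

lemma ElemEq_SubEq: "ElemEq S \<Gamma> ts us \<Psi> \<Longrightarrow> SubEq S \<Gamma> (inst ts) (inst us) \<Psi>"
  using ElemEq_length ElemEq_iff_SubEq by metis

lemma Elem_length: "Elem S \<Gamma> ts \<Psi> \<Longrightarrow> length ts = length \<Psi>"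
  by (induction rule: Elem_induct) auto

lemma CtxtEq_length: "CtxtEq S \<Gamma> \<Gamma>' \<Longrightarrow> length \<Gamma> = length \<Gamma>'"
  by (induction rule: CtxtEq_induct) auto

lemma CtxtEq_appendD:
  "CtxtEq S (\<Psi> @ \<Gamma>) (\<Psi>' @ \<Gamma>') \<Longrightarrow> length \<Psi> = length \<Psi>' \<Longrightarrow> CtxtEq S \<Gamma> \<Gamma>'"
proof (induction \<Psi> arbitrary: \<Psi>')
  case (Cons D \<Psi>)
  then show ?case by (cases \<Psi>') auto
qed auto

lemma Ctxt_appendD: "Ctxt S (\<Psi> @ \<Gamma>) \<Longrightarrow> Ctxt S \<Gamma>"
  by (induction \<Psi>) auto

lemma ElemEq_append:
  "length ts = length \<Psi> \<Longrightarrow> length us = length \<Delta> \<Longrightarrow> length ts' = length \<Psi> \<Longrightarrow> length us' = length \<Delta> \<Longrightarrow>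
   ElemEq S \<Gamma> (ts @ us) (ts' @ us') (\<Psi> @ \<Delta>) \<longleftrightarrow>
     ElemEq S \<Gamma> us us' \<Delta> \<and> ElemEq S \<Gamma> ts ts' (subst_tele (inst us) \<Psi>)"
proof (induction \<Psi> arbitrary: ts ts')
  case (Cons D \<Psi>)
  obtain t ts1 t' ts1' where [simp]: "ts = t # ts1" "ts' = t' # ts1'"
    using Cons.prems by (metis length_Suc_conv)
  have "subst (inst ts1) (subst (lifts (length \<Psi>) (inst us)) D) = subst (inst (ts1 @ us)) D"
    using inst_lifts[of ts1 us] Cons.prems by (simp add: subst_subst)
  then show ?case using Cons by auto
next
  case Nil
  have "ElemEq S \<Gamma> us us' \<Delta> \<Longrightarrow> Ctxt S \<Gamma>"
    by (induction S \<Gamma> us us' \<Delta> rule: ElemEq.induct) auto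
  with Nil show ?case by auto
qed

section \<open>Derived structural rules for equality of substitutions and contexts\<close>

context type_theory begin

lemma TyEqD: "TyEq S \<Gamma> A B \<Longrightarrow> Ty S \<Gamma> A" "TyEq S \<Gamma> A B \<Longrightarrow> Ty S \<Gamma> B"
  using TyEq_Ty by auto

lemma TmEqD: "TmEq S \<Gamma> a b A \<Longrightarrow> Tm S \<Gamma> a A" "TmEq S \<Gamma> a b A \<Longrightarrow> Tm S \<Gamma> b A"
  using TmEq_Tm by auto

lemma TmEq_Ty: "TmEq S \<Gamma> a b A \<Longrightarrow> Ty S \<Gamma> A"
  using TmEqD Tm_Ty by blast

lemma TmEq_refl_iff: "TmEq S \<Gamma> a a A \<longleftrightarrow> Tm S \<Gamma> a A"
  using TmEqD TmEq_refl by blast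

lemma TyEq_refl_iff: "TyEq S \<Gamma> A A \<longleftrightarrow> Ty S \<Gamma> A"
  using TyEqD TyEq_refl by blast

lemma CtxtEq_refl_iff: "CtxtEq S \<Gamma> \<Gamma> \<longleftrightarrow> Ctxt S \<Gamma>"
  by (induction \<Gamma>) (auto simp: TyEq_refl_iff)

lemma CtxtEq_Ctxt1: "CtxtEq S \<Gamma> \<Gamma>' \<Longrightarrow> Ctxt S \<Gamma>"
  by (induction rule: CtxtEq_induct) (auto dest: TyEqD)

lemma ElemEq_refl_iff: "ElemEq S \<Gamma> ts ts \<Psi> \<longleftrightarrow> Elem S \<Gamma> ts \<Psi>"
proof (induction \<Psi> arbitrary: ts)
  case Nil
  then show ?case by (cases ts) auto
next
  case (Cons D \<Psi>)
  then show ?case by (cases ts) (auto simp: TmEq_refl_iff)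
qed

lemma ElemEq_Elem: "ElemEq S \<Gamma> ts us \<Psi> \<Longrightarrow> Elem S \<Gamma> ts \<Psi>"
  by (induction rule: ElemEq_induct) (auto dest: TmEqD)

lemma ElemEq_Ctxt: "ElemEq S \<Gamma> ts us \<Psi> \<Longrightarrow> Ctxt S \<Gamma>"
  by (induction rule: ElemEq_induct) auto

lemma SubEq_Ctxt: "SubEq S \<Gamma> \<sigma> \<tau> \<Psi> \<Longrightarrow> Ctxt S \<Gamma>"
  by (induction \<Psi> arbitrary: \<sigma> \<tau>) auto

lemma Ctxt_scoped_tele: "Ctxt S \<Gamma> \<Longrightarrow> scoped_tele 0 \<Gamma>"
  by (induction \<Gamma>) (auto dest: Ty_scoped)

lemma subst_eqI_Ty:
  "Ty S \<Gamma> A \<Longrightarrow> (\<And>i. i < length \<Gamma> \<Longrightarrow> \<sigma> i = \<tau> i) \<Longrightarrow> subst \<sigma> A = subst \<tau> A"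
  using subst_eqI Ty_scoped by blast

lemma subst_eqI_Tm:
  "Tm S \<Gamma> a A \<Longrightarrow> (\<And>i. i < length \<Gamma> \<Longrightarrow> \<sigma> i = \<tau> i) \<Longrightarrow> subst \<sigma> a = subst \<tau> a"
  using subst_eqI Tm_scoped by blast

lemma Elem_scoped: "Elem S \<Gamma> ts \<Psi> \<Longrightarrow> t \<in> set ts \<Longrightarrow> scoped (length \<Gamma>) t"
  by (induction rule: Elem_induct) (auto dest: Tm_scoped)

lemma subst_vec_eqI_Elem:
  "Elem S \<Gamma> ts \<Psi> \<Longrightarrow> (\<And>i. i < length \<Gamma> \<Longrightarrow> \<sigma> i = \<tau> i) \<Longrightarrow> subst_vec \<sigma> ts = subst_vec \<tau> ts"
  by (rule subst_vec_eqI[where n = "length \<Gamma>"]) (auto dest: Elem_scoped)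

lemma subst_tele_eqI_Ctxt:
  assumes "Ctxt S (\<Psi> @ \<Gamma>)" "\<And>i. i < length \<Gamma> \<Longrightarrow> \<sigma> i = \<tau> i"
  shows "subst_tele \<sigma> \<Psi> = subst_tele \<tau> \<Psi>"
proof -
  have "Ctxt S (\<Psi> @ \<Gamma>) \<Longrightarrow> scoped_tele (length \<Gamma>) \<Psi>" for \<Psi>
    by (induction \<Psi>) (auto dest!: Ty_scoped simp: add.commute)
  then show ?thesis using subst_tele_eqI assms by blast
qed

lemma subst_tele_closed_Ctxt: "Ctxt S \<Psi> \<Longrightarrow> subst_tele \<sigma> \<Psi> = \<Psi>"
  using subst_tele_closed Ctxt_scoped_tele by blast

text \<open>Each type in \<Delta> is scoped by the entries before it, so values at later indices are
  never consulted.\<close>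

lemma SubEq_eqI:
  "Ctxt S \<Delta> \<Longrightarrow> SubEq S \<Gamma> \<sigma> \<tau> \<Delta> \<Longrightarrow> (\<And>i. i < length \<Delta> \<Longrightarrow> \<sigma> i = \<sigma>' i) \<Longrightarrow>
    (\<And>i. i < length \<Delta> \<Longrightarrow> \<tau> i = \<tau>' i) \<Longrightarrow> SubEq S \<Gamma> \<sigma>' \<tau>' \<Delta>"
proof (induction \<Delta> arbitrary: \<sigma> \<tau> \<sigma>' \<tau>')
  case (Cons A \<Delta>)
  have "subst (\<lambda>i. \<sigma> (Suc i)) A = subst (\<lambda>i. \<sigma>' (Suc i)) A"
    by (rule subst_eqI_Ty[of \<Delta>]) (use Cons.prems in auto)
  moreover have "\<sigma> 0 = \<sigma>' 0" "\<tau> 0 = \<tau>' 0"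
    using Cons.prems by auto
  moreover have "SubEq S \<Gamma> (\<lambda>i. \<sigma>' (Suc i)) (\<lambda>i. \<tau>' (Suc i)) \<Delta>"
    by (rule Cons.IH[of "\<lambda>i. \<sigma> (Suc i)" "\<lambda>i. \<tau> (Suc i)"]) (use Cons.prems in auto)
  ultimately show ?case using Cons.prems by simp
qed auto

lemma ElemEq_map_iff_SubEq:
  assumes "Ctxt S \<Delta>"
  shows "ElemEq S \<Gamma> (map \<sigma> [0..<length \<Delta>]) (map \<tau> [0..<length \<Delta>]) \<Delta> \<longleftrightarrow> SubEq S \<Gamma> \<sigma> \<tau> \<Delta>"
proof -
  have "SubEq S \<Gamma> (inst (map \<sigma> [0..<length \<Delta>])) (inst (map \<tau> [0..<length \<Delta>])) \<Delta> \<longleftrightarrow> SubEq S \<Gamma> \<sigma> \<tau> \<Delta>"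
    using SubEq_eqI[OF assms] by (auto simp: inst_eq_nth)
  then show ?thesis by (simp add: ElemEq_iff_SubEq)
qed

lemma subst_as_inst: "scoped n t \<Longrightarrow> subst \<sigma> t = subst (inst (map \<sigma> [0..<n])) t"
  by (erule subst_eqI) (auto simp: inst_eq_nth)

text \<open>The substitution rule moves the equality along \<sigma>, and the congruence rule then
  passes from \<sigma> to \<tau>. Both rules speak of vectors, hence the lists of values on the
  variables of \<Delta>.\<close>

lemma TyEq_SubEq:
  assumes "SubEq S \<Gamma> \<sigma> \<tau> \<Delta>" "TyEq S \<Delta> A B"
  shows "TyEq S \<Gamma> (subst \<sigma> A) (subst \<tau> B)"
proof -
  let ?n = "length \<Delta>"
  have ty: "Ty S \<Delta> A" "Ty S \<Delta> B" using TyEqD assms by auto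
  have e: "ElemEq S \<Gamma> (map \<sigma> [0..<?n]) (map \<tau> [0..<?n]) \<Delta>"
    using assms ElemEq_map_iff_SubEq Ty_Ctxt ty by blast
  show ?thesis
    using TyEq_trans[OF TyEq_subst[OF ElemEq_Elem[OF e] assms(2)] Ty_subst_cong[OF e ty(2)]]
      subst_as_inst[OF Ty_scoped[OF ty(1)]] subst_as_inst[OF Ty_scoped[OF ty(2)]] by metis
qed

lemma TmEq_SubEq:
  assumes "SubEq S \<Gamma> \<sigma> \<tau> \<Delta>" "TmEq S \<Delta> a b A"
  shows "TmEq S \<Gamma> (subst \<sigma> a) (subst \<tau> b) (subst \<sigma> A)"
proof -
  let ?n = "length \<Delta>"
  have ty: "Tm S \<Delta> a A" "Tm S \<Delta> b A" "Ty S \<Delta> A" using TmEqD Tm_Ty assms by blast+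
  have e: "ElemEq S \<Gamma> (map \<sigma> [0..<?n]) (map \<tau> [0..<?n]) \<Delta>"
    using assms ElemEq_map_iff_SubEq Ty_Ctxt ty by blast
  show ?thesis
    using TmEq_trans[OF TmEq_subst[OF ElemEq_Elem[OF e] assms(2)] Tm_subst_cong[OF e ty(2)]]
      subst_as_inst[OF Ty_scoped[OF ty(3)]] subst_as_inst[OF Tm_scoped[OF ty(1)]]
      subst_as_inst[OF Tm_scoped[OF ty(2)]] by metis
qed

lemma SubEq_comp:
  "SubEq S \<Gamma> \<sigma> \<tau> \<Delta> \<Longrightarrow> SubEq S \<Delta> \<rho> \<pi> \<Theta> \<Longrightarrow>
    SubEq S \<Gamma> (\<lambda>i. subst \<sigma> (\<rho> i)) (\<lambda>i. subst \<tau> (\<pi> i)) \<Theta>"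
proof (induction \<Theta> arbitrary: \<rho> \<pi>)
  case Nil
  then show ?case using SubEq_Ctxt by auto
next
  case (Cons A \<Theta>)
  then show ?case using TmEq_SubEq[OF Cons.prems(1), of "\<rho> 0" "\<pi> 0" "subst (\<lambda>i. \<rho> (Suc i)) A"]
    by (auto simp: subst_subst)
qed

lemma ElemEq_SubEq_subst:
  assumes "SubEq S \<Gamma> \<sigma> \<tau> \<Delta>" "ElemEq S \<Delta> ts us \<Psi>"
  shows "ElemEq S \<Gamma> (subst_vec \<sigma> ts) (subst_vec \<tau> us) (subst_tele \<sigma> \<Psi>)"
  using assms(2)
proof (induction rule: ElemEq_induct)
  case (Cons t ts u us D \<Psi>)
  have "length ts = length \<Psi>" using Cons ElemEq_length by metis
  then show ?case
    using Cons TmEq_SubEq[OF assms(1) Cons(2)] by (simp add: subst_inst_vec)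
qed (use assms SubEq_Ctxt in auto)

lemma SubEq_weaken: "Ctxt S (\<Psi> @ \<Gamma>) \<Longrightarrow> SubEq S (\<Psi> @ \<Gamma>) (\<lambda>i. Var (i + length \<Psi>)) (\<lambda>i. Var (i + length \<Psi>)) \<Gamma>"
proof (induction \<Gamma> arbitrary: \<Psi>)
  case (Cons A \<Gamma>)
  have "Tm S (\<Psi> @ A # \<Gamma>) (Var (length \<Psi>)) (shift (Suc (length \<Psi>)) A)"
    using Tm_Var[OF Cons.prems, of "length \<Psi>"] by simp
  moreover have "SubEq S (\<Psi> @ A # \<Gamma>) (\<lambda>i. Var (Suc (i + length \<Psi>))) (\<lambda>i. Var (Suc (i + length \<Psi>))) \<Gamma>"
    using Cons.IH[of "\<Psi> @ [A]"] Cons.prems by simp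
  ultimately show ?case by (simp add: shift_eq_subst TmEq_refl_iff)
qed auto

lemma SubEq_Var: "Ctxt S \<Gamma> \<Longrightarrow> SubEq S \<Gamma> Var Var \<Gamma>"
  using SubEq_weaken[of "[]"] by simp

text \<open>Context conversion is recovered by letting the identity on variables act as a
  substitution between the two contexts. Both directions go together: comparing the new types over
  the second context uses the substitution back obtained one step earlier.\<close>

lemma CtxtEq_SubEq:
  "CtxtEq S \<Gamma> \<Gamma>' \<Longrightarrow> Ctxt S \<Gamma>' \<and> SubEq S \<Gamma> Var Var \<Gamma>' \<and> SubEq S \<Gamma>' Var Var \<Gamma>"
proof (induction \<Gamma> arbitrary: \<Gamma>')
  case Nil
  then show ?case by (cases \<Gamma>') auto
next
  case (Cons A \<Gamma>)
  obtain A' \<Delta> where [simp]: "\<Gamma>' = A' # \<Delta>" using Cons.prems by (cases \<Gamma>') auto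
  have eq: "CtxtEq S \<Gamma> \<Delta>" "TyEq S \<Gamma> A A'" using Cons.prems by auto
  note IH = Cons.IH[OF eq(1)]
  have eq': "TyEq S \<Delta> A A'" using TyEq_SubEq[of \<Delta> Var Var \<Gamma>] IH eq by auto
  have c: "Ctxt S (A # \<Gamma>)" "Ctxt S (A' # \<Delta>)"
    using IH TyEqD[OF eq(2)] TyEqD[OF eq'] Ty_Ctxt by auto
  have w: "SubEq S (A # \<Gamma>) (\<lambda>i. Var (Suc i)) (\<lambda>i. Var (Suc i)) \<Gamma>"
      "SubEq S (A' # \<Delta>) (\<lambda>i. Var (Suc i)) (\<lambda>i. Var (Suc i)) \<Delta>"
    using SubEq_weaken[of "[A]" \<Gamma>] SubEq_weaken[of "[A']" \<Delta>] c by auto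
  have "SubEq S (A # \<Gamma>) (\<lambda>i. Var (Suc i)) (\<lambda>i. Var (Suc i)) \<Delta>"
       "SubEq S (A' # \<Delta>) (\<lambda>i. Var (Suc i)) (\<lambda>i. Var (Suc i)) \<Gamma>"
    using SubEq_comp[OF w(1), of Var Var \<Delta>] SubEq_comp[OF w(2), of Var Var \<Gamma>] IH by auto
  moreover have "TmEq S (A # \<Gamma>) (Var 0) (Var 0) (subst (\<lambda>i. Var (Suc i)) A')"
  proof (rule TmEq_conv)
    show "TmEq S (A # \<Gamma>) (Var 0) (Var 0) (subst (\<lambda>i. Var (Suc i)) A)"
      using SubEq_Var[OF c(1)] by simp
    show "TyEq S (A # \<Gamma>) (subst (\<lambda>i. Var (Suc i)) A) (subst (\<lambda>i. Var (Suc i)) A')"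
      using TyEq_SubEq w(1) eq(2) by blast
  qed
  moreover have "TmEq S (A' # \<Delta>) (Var 0) (Var 0) (subst (\<lambda>i. Var (Suc i)) A)"
  proof (rule TmEq_conv)
    show "TmEq S (A' # \<Delta>) (Var 0) (Var 0) (subst (\<lambda>i. Var (Suc i)) A')"
      using SubEq_Var[OF c(2)] by simp
    show "TyEq S (A' # \<Delta>) (subst (\<lambda>i. Var (Suc i)) A') (subst (\<lambda>i. Var (Suc i)) A)"
      using TyEq_SubEq w(2) TyEq_sym[OF eq'] by blast
  qed
  ultimately show ?case using c by simp
qed

lemma CtxtEq_Ctxt2: "CtxtEq S \<Gamma> \<Gamma>' \<Longrightarrow> Ctxt S \<Gamma>'"
  using CtxtEq_SubEq by blast

lemma TyEq_ctxt_conv: "CtxtEq S \<Gamma> \<Gamma>' \<Longrightarrow> TyEq S \<Gamma> A B \<Longrightarrow> TyEq S \<Gamma>' A B"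
  using CtxtEq_SubEq TyEq_SubEq[of \<Gamma>' Var Var \<Gamma> A B] by simp

lemma SubEq_ctxt_conv: "CtxtEq S \<Gamma> \<Gamma>' \<Longrightarrow> SubEq S \<Gamma> \<sigma> \<tau> \<Delta> \<Longrightarrow> SubEq S \<Gamma>' \<sigma> \<tau> \<Delta>"
  using CtxtEq_SubEq SubEq_comp[of \<Gamma>' Var Var \<Gamma> \<sigma> \<tau> \<Delta>] by simp

lemma SubEq_conv: "CtxtEq S \<Delta> \<Delta>' \<Longrightarrow> SubEq S \<Gamma> \<sigma> \<tau> \<Delta> \<Longrightarrow> SubEq S \<Gamma> \<sigma> \<tau> \<Delta>'"
  using CtxtEq_SubEq SubEq_comp[of \<Gamma> \<sigma> \<tau> \<Delta> Var Var \<Delta>'] by simp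

lemma ElemEq_ctxt_conv: "CtxtEq S \<Gamma> \<Gamma>' \<Longrightarrow> ElemEq S \<Gamma> ts us \<Psi> \<Longrightarrow> ElemEq S \<Gamma>' ts us \<Psi>"
  using CtxtEq_SubEq[of \<Gamma> \<Gamma>'] ElemEq_SubEq_subst[of \<Gamma>' Var Var \<Gamma> ts us \<Psi>] by simp

lemma CtxtEq_sym: "CtxtEq S \<Gamma> \<Gamma>' \<Longrightarrow> CtxtEq S \<Gamma>' \<Gamma>"
  by (induction rule: CtxtEq_induct) (auto intro: TyEq_sym TyEq_ctxt_conv)

lemma CtxtEq_trans: "CtxtEq S \<Gamma> \<Gamma>' \<Longrightarrow> CtxtEq S \<Gamma>' \<Gamma>'' \<Longrightarrow> CtxtEq S \<Gamma> \<Gamma>''"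
proof (induction arbitrary: \<Gamma>'' rule: CtxtEq_induct)
  case (Cons A \<Gamma> A' \<Gamma>')
  obtain B \<Delta> where [simp]: "\<Gamma>'' = B # \<Delta>" using Cons.prems by (cases \<Gamma>'') auto
  show ?case
    using Cons TyEq_trans[OF Cons(2), of B] TyEq_ctxt_conv[OF CtxtEq_sym[OF Cons(1)], of A' B] by auto
qed auto

text \<open>The reversed last entry is typed at the tail of \<tau> instead of that of \<sigma>, so
  it is converted along the equality of the two instances of \<open>A\<close>.\<close>

lemma SubEq_sym: "Ctxt S \<Delta> \<Longrightarrow> SubEq S \<Gamma> \<sigma> \<tau> \<Delta> \<Longrightarrow> SubEq S \<Gamma> \<tau> \<sigma> \<Delta>"
proof (induction \<Delta> arbitrary: \<sigma> \<tau>)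
  case (Cons A \<Delta>)
  then show ?case
    using TyEq_SubEq[of \<Gamma> "\<lambda>i. \<sigma> (Suc i)" "\<lambda>i. \<tau> (Suc i)" \<Delta> A A]
    by (auto intro: TmEq_sym TmEq_conv simp: TyEq_refl_iff)
qed auto

lemma SubEq_trans: "Ctxt S \<Delta> \<Longrightarrow> SubEq S \<Gamma> \<sigma> \<tau> \<Delta> \<Longrightarrow> SubEq S \<Gamma> \<tau> \<rho> \<Delta> \<Longrightarrow> SubEq S \<Gamma> \<sigma> \<rho> \<Delta>"
proof (induction \<Delta> arbitrary: \<sigma> \<tau> \<rho>)
  case (Cons A \<Delta>)
  have "TyEq S \<Gamma> (subst (\<lambda>i. \<tau> (Suc i)) A) (subst (\<lambda>i. \<sigma> (Suc i)) A)"
    using TyEq_SubEq[of \<Gamma> "\<lambda>i. \<sigma> (Suc i)" "\<lambda>i. \<tau> (Suc i)" \<Delta> A A] Cons.prems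
    by (auto intro: TyEq_sym simp: TyEq_refl_iff)
  then have "TmEq S \<Gamma> (\<tau> 0) (\<rho> 0) (subst (\<lambda>i. \<sigma> (Suc i)) A)"
    using TmEq_conv Cons.prems by auto
  then show ?case using Cons TmEq_trans by auto
qed auto

lemma SubEq_refl1: "Ctxt S \<Delta> \<Longrightarrow> SubEq S \<Gamma> \<sigma> \<tau> \<Delta> \<Longrightarrow> SubEq S \<Gamma> \<sigma> \<sigma> \<Delta>"
  using SubEq_sym SubEq_trans by blast

lemma SubEq_append:
  assumes "Ctxt S (\<Psi> @ \<Delta>)" "length \<Psi> = m"
  shows "SubEq S \<Gamma> \<sigma> \<tau> (\<Psi> @ \<Delta>) \<longleftrightarrow> SubEq S \<Gamma> (\<lambda>i. \<sigma> (i + m)) (\<lambda>i. \<tau> (i + m)) \<Delta> \<and>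
    ElemEq S \<Gamma> (map \<sigma> [0..<m]) (map \<tau> [0..<m]) (subst_tele (\<lambda>i. \<sigma> (i + m)) \<Psi>)"
proof -
  let ?d = "length \<Delta>"
  have split: "map f [0..<m + ?d] = map f [0..<m] @ map (\<lambda>i. f (i + m)) [0..<?d]" for f :: "nat \<Rightarrow> 'a exp"
    by (rule nth_equalityI) (auto simp: nth_append)
  have "SubEq S \<Gamma> \<sigma> \<tau> (\<Psi> @ \<Delta>) \<longleftrightarrow> ElemEq S \<Gamma> (map \<sigma> [0..<m + ?d]) (map \<tau> [0..<m + ?d]) (\<Psi> @ \<Delta>)"
    using ElemEq_map_iff_SubEq[OF assms(1), of \<Gamma> \<sigma> \<tau>] assms(2) by simp
  also have "\<dots> \<longleftrightarrow> ElemEq S \<Gamma> (map (\<lambda>i. \<sigma> (i + m)) [0..<?d]) (map (\<lambda>i. \<tau> (i + m)) [0..<?d]) \<Delta> \<and>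
      ElemEq S \<Gamma> (map \<sigma> [0..<m]) (map \<tau> [0..<m]) (subst_tele (inst (map (\<lambda>i. \<sigma> (i + m)) [0..<?d])) \<Psi>)"
    unfolding split by (subst ElemEq_append) (auto simp: assms)
  also have "subst_tele (inst (map (\<lambda>i. \<sigma> (i + m)) [0..<?d])) \<Psi> = subst_tele (\<lambda>i. \<sigma> (i + m)) \<Psi>"
    by (rule subst_tele_eqI_Ctxt[OF assms(1)]) (simp add: inst_eq_nth)
  finally show ?thesis
    using ElemEq_map_iff_SubEq[OF Ctxt_appendD[OF assms(1)]] by simp
qed

text \<open>The two conclusions feed each other: the next type of the telescope is substituted along
  the lifted substitution, and lifting once more needs the context extended by that type to be well
  formed.\<close>

lemma SubEq_lifts:
  assumes "SubEq S \<Gamma> \<sigma> \<tau> \<Delta>" "CtxtEq S \<Gamma> \<Gamma>'" "CtxtEq S (\<Psi> @ \<Delta>) (\<Psi>' @ \<Delta>')" "length \<Psi> = length \<Psi>'"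
  shows "CtxtEq S (subst_tele \<sigma> \<Psi> @ \<Gamma>) (subst_tele \<tau> \<Psi>' @ \<Gamma>') \<and>
    SubEq S (subst_tele \<sigma> \<Psi> @ \<Gamma>) (lifts (length \<Psi>) \<sigma>) (lifts (length \<Psi>) \<tau>) (\<Psi> @ \<Delta>)"
  using assms(4,3)
proof (induction \<Psi> \<Psi>' rule: list_induct2)
  case Nil
  then show ?case using assms by auto
next
  case (Cons D \<Psi> D' \<Psi>')
  let ?G = "subst_tele \<sigma> \<Psi> @ \<Gamma>" and ?m = "length \<Psi>"
  let ?A = "subst (lifts ?m \<sigma>) D"
  have IH: "CtxtEq S ?G (subst_tele \<tau> \<Psi>' @ \<Gamma>')" "SubEq S ?G (lifts ?m \<sigma>) (lifts ?m \<tau>) (\<Psi> @ \<Delta>)"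
    using Cons by auto
  have D: "TyEq S ?G ?A (subst (lifts ?m \<tau>) D')"
    using TyEq_SubEq IH(2) Cons.prems by auto
  have c: "Ctxt S (?A # ?G)"
    using TyEqD(1)[OF D] Ty_Ctxt by auto
  have w: "SubEq S (?A # ?G) (\<lambda>i. Var (Suc i)) (\<lambda>i. Var (Suc i)) ?G"
    using SubEq_weaken[of "[?A]" ?G] c by simp
  have eq: "lifts (Suc m) \<rho> (Suc i) = subst (\<lambda>i. Var (Suc i)) (lifts m \<rho> i)" for \<rho> i m
    by (auto simp: lifts_eq subst_subst)
  have "TmEq S (?A # ?G) (Var 0) (Var 0) (subst (\<lambda>i. Var (Suc i)) ?A)"
    using SubEq_Var[OF c] by simp
  moreover have "lifts (Suc m) \<rho> 0 = Var 0" for \<rho> :: "nat \<Rightarrow> 's exp" and m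
    by (simp add: lifts_eq)
  ultimately show ?case
    using SubEq_comp[OF w IH(2)] IH(1) D Cons.hyps by (simp add: eq subst_subst)
qed

lemma CtxtEq_subst_tele:
  "SubEq S \<Gamma> \<sigma> \<tau> \<Delta> \<Longrightarrow> CtxtEq S \<Gamma> \<Gamma>' \<Longrightarrow> CtxtEq S (\<Psi> @ \<Delta>) (\<Psi>' @ \<Delta>') \<Longrightarrow> length \<Psi> = length \<Psi>' \<Longrightarrow>
    CtxtEq S (subst_tele \<sigma> \<Psi> @ \<Gamma>) (subst_tele \<tau> \<Psi>' @ \<Gamma>')"
  using SubEq_lifts by blast

lemma SubEq_lifts_same:
  "SubEq S \<Gamma> \<sigma> \<tau> \<Delta> \<Longrightarrow> Ctxt S (\<Psi> @ \<Delta>) \<Longrightarrow>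
    SubEq S (subst_tele \<sigma> \<Psi> @ \<Gamma>) (lifts (length \<Psi>) \<sigma>) (lifts (length \<Psi>) \<tau>) (\<Psi> @ \<Delta>)"
  using SubEq_lifts[of \<Gamma> \<sigma> \<tau> \<Delta> \<Gamma> \<Psi> \<Psi> \<Delta>] SubEq_Ctxt by (simp add: CtxtEq_refl_iff)

lemma Ctxt_subst_tele:
  "SubEq S \<Gamma> \<sigma> \<tau> \<Delta> \<Longrightarrow> Ctxt S (\<Psi> @ \<Delta>) \<Longrightarrow> Ctxt S (subst_tele \<sigma> \<Psi> @ \<Gamma>)"
  using SubEq_lifts_same SubEq_Ctxt by blast

lemma Ctxt_append_closed: "Ctxt S \<Psi> \<Longrightarrow> Ctxt S \<Gamma> \<Longrightarrow> Ctxt S (\<Psi> @ \<Gamma>)"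
  using Ctxt_subst_tele[of \<Gamma> Var Var "[]" \<Psi>] by simp

lemma CtxtEq_append_closed: "CtxtEq S \<Psi> \<Psi>' \<Longrightarrow> CtxtEq S \<Gamma> \<Gamma>' \<Longrightarrow> CtxtEq S (\<Psi> @ \<Gamma>) (\<Psi>' @ \<Gamma>')"
  using CtxtEq_subst_tele[of \<Gamma> Var Var "[]" \<Gamma>' \<Psi> \<Psi>' "[]"] CtxtEq_length CtxtEq_Ctxt1 by auto

lemma SubEq_inst:
  assumes "ElemEq S \<Gamma> ts us \<Psi>"
  shows "SubEq S \<Gamma> (inst ts) (inst us) (\<Psi> @ \<Gamma>)"
  using assms
proof (induction rule: ElemEq_induct)
  case Nil
  then show ?case using SubEq_Var by simp
qed auto

lemma ElemEq_iff_SubEq_append: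
  assumes "length ts = length \<Psi>" "length us = length \<Psi>"
  shows "ElemEq S \<Gamma> ts us \<Psi> \<longleftrightarrow> SubEq S \<Gamma> (inst ts) (inst us) (\<Psi> @ \<Gamma>)"
proof
  assume "SubEq S \<Gamma> (inst ts) (inst us) (\<Psi> @ \<Gamma>)"
  moreover have "SubEq S \<Gamma> (inst ts) (inst us) (\<Psi> @ \<Gamma>) \<Longrightarrow> SubEq S \<Gamma> (inst ts) (inst us) \<Psi>"
    using assms
  proof (induction \<Psi> arbitrary: ts us)
    case Nil
    then show ?case using SubEq_Ctxt by auto
  next
    case (Cons D \<Psi>)
    then show ?case by (cases ts; cases us) auto
  qed
  ultimately show "ElemEq S \<Gamma> ts us \<Psi>"
    using ElemEq_iff_SubEq assms by blast
qed (rule SubEq_inst)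

lemma ElemEq_sym: "Ctxt S (\<Psi> @ \<Gamma>) \<Longrightarrow> ElemEq S \<Gamma> ts us \<Psi> \<Longrightarrow> ElemEq S \<Gamma> us ts \<Psi>"
  using SubEq_sym ElemEq_iff_SubEq_append ElemEq_length by metis

lemma ElemEq_trans:
  "Ctxt S (\<Psi> @ \<Gamma>) \<Longrightarrow> ElemEq S \<Gamma> ts us \<Psi> \<Longrightarrow> ElemEq S \<Gamma> us vs \<Psi> \<Longrightarrow> ElemEq S \<Gamma> ts vs \<Psi>"
  using SubEq_trans[of "\<Psi> @ \<Gamma>"] ElemEq_iff_SubEq_append ElemEq_length by metis

lemma ElemEq_conv:
  assumes "CtxtEq S (\<Psi> @ \<Gamma>) (\<Psi>' @ \<Gamma>)" "ElemEq S \<Gamma> ts us \<Psi>"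
  shows "ElemEq S \<Gamma> ts us \<Psi>'"
proof -
  have "length \<Psi> = length \<Psi>'" using CtxtEq_length[OF assms(1)] by simp
  then show ?thesis
    using SubEq_conv[OF assms(1)] assms(2) ElemEq_iff_SubEq_append ElemEq_length by metis
qed

text \<open>A block of variables is the restriction of a weakening. The offset \<open>k + n\<close>
  in the types arises because the block itself must also be skipped to reach \<Gamma>.\<close>

lemma ElemEq_vars:
  assumes "Ctxt S (\<Phi> @ \<Psi> @ \<Gamma>)" "length \<Phi> = k" "length \<Psi> = n"
  shows "ElemEq S (\<Phi> @ \<Psi> @ \<Gamma>) (vars k n) (vars k n) (subst_tele (\<lambda>i. Var (i + (k + n))) \<Psi>)"
proof -
  have "SubEq S (\<Phi> @ \<Psi> @ \<Gamma>) (\<lambda>i. Var (i + k)) (\<lambda>i. Var (i + k)) (\<Psi> @ \<Gamma>)"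
    using SubEq_weaken[OF assms(1)] assms by simp
  then have "ElemEq S (\<Phi> @ \<Psi> @ \<Gamma>) (map (\<lambda>i. Var (i + k)) [0..<n]) (map (\<lambda>i. Var (i + k)) [0..<n])
      (subst_tele (\<lambda>i. Var (i + (k + n))) \<Psi>)"
    using SubEq_append[OF Ctxt_appendD[OF assms(1)] assms(3)] by (simp add: ac_simps)
  moreover have "map (\<lambda>i. Var (i + k)) [0..<n] = (vars k n :: 's exp list)"
    by (rule nth_equalityI) auto
  ultimately show ?thesis by (simp only:)
qed

lemma ElemEq_vars_closed:
  assumes "Ctxt S (\<Phi> @ \<Psi> @ \<Gamma>)" "length \<Phi> = k" "length \<Psi> = n" "Ctxt S \<Psi>"
  shows "ElemEq S (\<Phi> @ \<Psi> @ \<Gamma>) (vars k n) (vars k n) \<Psi>"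
  using ElemEq_vars[OF assms(1-3)] subst_tele_closed_Ctxt[OF assms(4)] by simp

lemma ElemEq_append_iff:
  "length ts = length \<Psi> \<Longrightarrow> length ts' = length \<Psi> \<Longrightarrow>
   ElemEq S \<Gamma> (ts @ us) (ts' @ us') (\<Psi> @ \<Delta>) \<longleftrightarrow>
     ElemEq S \<Gamma> us us' \<Delta> \<and> ElemEq S \<Gamma> ts ts' (subst_tele (inst us) \<Psi>)"
  using ElemEq_append ElemEq_length by (metis length_append add_left_cancel)

end

lemma inst_Cons: "inst (t # ts) i = (if i = 0 then t else inst ts (i - 1))"
  by (cases i) auto

lemma inst_vars_eq: "inst (vars k n) i = (if i < n then Var (i + k) else Var (i - n))"
  by (simp add: inst_def)

lemma inst_append_eq: "inst (ts @ us) i = (if i < length ts then inst ts i else inst us (i - length ts))"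
  by (simp add: inst_append inst_eq_nth)

lemmas inst_simps = inst_Cons inst_vars_eq inst_append_eq

lemma subst_cong: "(\<And>i. \<sigma> i = \<tau> i) \<Longrightarrow> subst \<sigma> t = subst \<tau> t"
  by presburger

lemma subst_tele_cong: "(\<And>i. \<sigma> i = \<tau> i) \<Longrightarrow> subst_tele \<sigma> t = subst_tele \<tau> t"
  by presburger

section \<open>Elimination for identity types\<close>

definition id_tele :: "'s exp \<Rightarrow> 's exp list" where
  "id_tele A = [Id_type (shift 2 A) (Var 1) (Var 0), shift 1 A, A]"

lemma id_ext_eq: "id_ext A \<Gamma> = id_tele A @ \<Gamma>"
  by (simp add: id_ext_def id_tele_def)

lemma length_id_tele [simp]: "length (id_tele A) = 3"
  by (simp add: id_tele_def)

lemma length_id_ext [simp]: "length (id_ext A \<Gamma>) = 3 + length \<Gamma>"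
  by (simp add: id_ext_def)

lemma subst_tele_id_tele [simp]: "subst_tele \<sigma> (id_tele A) = id_tele (subst \<sigma> A)"
  by (simp add: id_tele_def shift_eq_subst subst_subst lifts_eq numeral_2_eq_2)

text \<open>Naturality of \<open>x \<mapsto> (x, x, r(x))\<close> in the ambient context. The
  reflexivity term records its type, hence the substituted \<open>A\<close> on the left.\<close>

lemma diag1_subst: "subst (inst (diag1 (subst \<sigma> A))) (lifts 3 \<sigma> i) = subst (lifts 1 \<sigma>) (inst (diag1 A) i)"
  by (auto simp: diag1_def lifts_eq inst_simps shift_eq_subst subst_subst eval_nat_numeral intro!: subst_cong)

context identity_types begin

lemma TyEq_shift: "TyEq S \<Gamma> A A' \<Longrightarrow> TyEq S (A # \<Gamma>) (shift 1 A) (shift 1 A')"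
  using TyEq_SubEq[OF SubEq_weaken[of "[A]" \<Gamma>]] TyEqD Ty_Ctxt by (fastforce simp: shift_eq_subst)

lemma CtxtEq_id_ext:
  assumes "TyEq S \<Gamma> A A'"
  shows "CtxtEq S (id_ext A \<Gamma>) (id_ext A' \<Gamma>)"
proof -
  have c1: "Ctxt S (A # \<Gamma>)" using TyEqD(1)[OF assms] Ty_Ctxt by auto
  have e1: "TyEq S (A # \<Gamma>) (shift 1 A) (shift 1 A')" using TyEq_shift assms .
  have c2: "Ctxt S (shift 1 A # A # \<Gamma>)" using e1 c1 TyEqD by auto
  have e2: "TyEq S (shift 1 A # A # \<Gamma>) (shift 2 A) (shift 2 A')"
    using TyEq_SubEq[OF SubEq_weaken[of "[shift 1 A, A]" \<Gamma>]] assms c2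
    by (auto simp: shift_eq_subst)
  have "TmEq S (shift 1 A # A # \<Gamma>) (Var 0) (Var 0) (shift 2 A)"
    using Tm_Var[OF c2, of 0] by (simp add: TmEq_refl_iff shift_eq_subst subst_subst)
  moreover have "TmEq S (shift 1 A # A # \<Gamma>) (Var 1) (Var 1) (shift 2 A)"
    using Tm_Var[OF c2, of 1] by (simp add: TmEq_refl_iff shift_eq_subst subst_subst numeral_2_eq_2)
  ultimately show ?thesis
    unfolding id_ext_def using Id_cong[OF e2] e1 c1 assms
    by (auto simp: CtxtEq_refl_iff)
qed

lemma SubEq_diag1:
  assumes "TyEq S \<Gamma> A A'"
  shows "SubEq S (A # \<Gamma>) (inst (diag1 A)) (inst (diag1 A')) (id_ext A \<Gamma>)"
proof -
  have c1: "Ctxt S (A # \<Gamma>)" using TyEqD(1)[OF assms] Ty_Ctxt by auto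
  have e1: "TyEq S (A # \<Gamma>) (shift 1 A) (shift 1 A')" using TyEq_shift assms .
  have v: "TmEq S (A # \<Gamma>) (Var 0) (Var 0) (shift 1 A)"
    using Tm_Var[OF c1, of 0] by (simp add: TmEq_refl_iff)
  have "(\<lambda>i. inst [Var 0] (Suc i)) = Var" "inst [Var 0] = (\<lambda>i. Var (i - 1))" for i
    by (auto simp: inst_simps)
  then show ?thesis
    unfolding id_ext_def diag1_def using SubEq_Var[OF c1] v Refl_cong[OF e1 v]
    by (auto simp: shift_eq_subst subst_subst)
qed

text \<open>Premises of the congruence rule for \<open>J\<close>, with the equalities of
  \<open>A\<close>, \<open>\<Psi>\<close> and \<open>C\<close> packed into one equality of contexts.
  Equal primed and unprimed data give the premises of the elimination rule.\<close>

definition J_prem where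
  "J_prem \<Gamma> A \<Psi> C d A' \<Psi>' C' d' \<longleftrightarrow> length \<Psi> = length \<Psi>' \<and>
    CtxtEq S (C # \<Psi> @ id_ext A \<Gamma>) (C' # \<Psi>' @ id_ext A' \<Gamma>) \<and>
    TmEq S (subst_tele (inst (diag1 A)) \<Psi> @ A # \<Gamma>) d d' (subst (lifts (length \<Psi>) (inst (diag1 A))) C)"

text \<open>\<open>J_open\<close> is a \<open>J\<close> whose parameters are weakened into the
  context of its own variables, so its rules apply only after the premises have been moved there.
  What makes this work is that the diagonal commutes with substitution under the binders.\<close>

lemma J_prem_subst:
  assumes "J_prem \<Gamma> A \<Psi> C d A' \<Psi>' C' d'" "SubEq S \<Delta> \<sigma> \<sigma> \<Gamma>" "m = length \<Psi>"
  shows "J_prem \<Delta> (subst \<sigma> A) (subst_tele (lifts 3 \<sigma>) \<Psi>) (subst (lifts (3 + m) \<sigma>) C) (subst (lifts (1 + m) \<sigma>) d)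
     (subst \<sigma> A') (subst_tele (lifts 3 \<sigma>) \<Psi>') (subst (lifts (3 + m) \<sigma>) C') (subst (lifts (1 + m) \<sigma>) d')"
proof -
  have len: "length \<Psi> = length \<Psi>'" and
    C: "CtxtEq S (C # \<Psi> @ id_ext A \<Gamma>) (C' # \<Psi>' @ id_ext A' \<Gamma>)" and
    d: "TmEq S (subst_tele (inst (diag1 A)) \<Psi> @ A # \<Gamma>) d d' (subst (lifts (length \<Psi>) (inst (diag1 A))) C)"
    using assms by (auto simp: J_prem_def)
  have "CtxtEq S \<Delta> \<Delta>"
    using assms SubEq_Ctxt CtxtEq_refl_iff by blast
  then have C': "CtxtEq S (subst_tele \<sigma> (C # \<Psi> @ id_tele A) @ \<Delta>) (subst_tele \<sigma> (C' # \<Psi>' @ id_tele A') @ \<Delta>)"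
    using CtxtEq_subst_tele[OF assms(2), of \<Delta> "C # \<Psi> @ id_tele A" "C' # \<Psi>' @ id_tele A'" \<Gamma>] C len
    by (simp add: id_ext_eq)
  let ?P = "subst_tele (inst (diag1 A)) \<Psi>"
  have c: "Ctxt S ((?P @ [A]) @ \<Gamma>)" using TmEqD[OF d] Tm_Ty Ty_Ctxt by force
  have "SubEq S (subst_tele (lifts 1 \<sigma>) ?P @ subst \<sigma> A # \<Delta>) (lifts (1 + m) \<sigma>) (lifts (1 + m) \<sigma>) (?P @ A # \<Gamma>)"
    using SubEq_lifts_same[OF assms(2) c] assms(3) by (simp add: subst_tele_append)
  note d' = TmEq_SubEq[OF this d]
  have 1: "subst_tele (lifts 1 \<sigma>) ?P = subst_tele (inst (diag1 (subst \<sigma> A))) (subst_tele (lifts 3 \<sigma>) \<Psi>)"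
    unfolding subst_tele_subst_tele by (rule subst_tele_cong) (metis diag1_subst)
  have 2: "subst (lifts (1 + m) \<sigma>) (subst (lifts (length \<Psi>) (inst (diag1 A))) C) =
      subst (lifts (length (subst_tele (lifts 3 \<sigma>) \<Psi>)) (inst (diag1 (subst \<sigma> A)))) (subst (lifts (3 + m) \<sigma>) C)"
    unfolding length_subst_tele assms(3)[symmetric] lifts_lifts[of m 1 \<sigma>, simplified add.commute[of m], symmetric]
     lifts_lifts[of m 3 \<sigma>, simplified add.commute[of m], symmetric] subst_lifts_subst diag1_subst ..
  show ?thesis
    using C' d' unfolding J_prem_def 1 2
    by (simp add: len assms(3) id_ext_eq subst_tele_append lifts_lifts add.commute)
qed

text \<open>The rule is applied over \<open>\<Psi> @ id_ext A \<Gamma>\<close> itself, at the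
  variables \<open>x, y, p, \<Psi>\<close>. Weakening past these variables and then putting them
  back is the identity, which returns \<open>C\<close> (\<open>eqC\<close>).\<close>

lemma J_open_cong:
  assumes "J_prem \<Gamma> A \<Psi> C d A' \<Psi>' C' d'"
  shows "TmEq S (\<Psi> @ id_ext A \<Gamma>) (J_open A \<Psi> C d) (J_open A' \<Psi>' C' d') C"
proof -
  define m where "m = length \<Psi>"
  define w :: "nat \<Rightarrow> 's exp" where "w = (\<lambda>i. Var (i + (3 + m)))"
  let ?G = "\<Psi> @ id_ext A \<Gamma>"
  have len: "length \<Psi>' = m" and C: "Ctxt S (C # ?G)"
    using assms by (auto simp: J_prem_def m_def dest: CtxtEq_Ctxt1 TyEqD)
  then have c: "Ctxt S ?G" by simp
  have w: "SubEq S ?G w w \<Gamma>"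
    using SubEq_weaken[of "\<Psi> @ id_tele A" \<Gamma>] c by (simp add: w_def id_ext_eq m_def add.commute)
  have p: "J_prem ?G (subst w A) (subst_tele (lifts 3 w) \<Psi>) (subst (lifts (3 + m) w) C) (subst (lifts (1 + m) w) d)
     (subst w A') (subst_tele (lifts 3 w) \<Psi>') (subst (lifts (3 + m) w) C') (subst (lifts (1 + m) w) d')"
    by (rule J_prem_subst[OF assms w m_def])
  have nth: "?G ! (m + 2) = A" "?G ! (m + 1) = shift 1 A" "?G ! m = Id_type (shift 2 A) (Var 1) (Var 0)"
    by (auto simp: m_def nth_append id_ext_def)
  have a: "TmEq S ?G (Var (m + 2)) (Var (m + 2)) (subst w A)"
    using Tm_Var[OF c, of "m + 2"] unfolding nth
    by (simp add: TmEq_refl_iff m_def shift_eq_subst w_def eval_nat_numeral ac_simps)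
  have b: "TmEq S ?G (Var (m + 1)) (Var (m + 1)) (subst w A)"
    using Tm_Var[OF c, of "m + 1"] unfolding nth
    by (simp add: TmEq_refl_iff m_def shift_eq_subst w_def subst_subst eval_nat_numeral ac_simps)
  have q: "TmEq S ?G (Var m) (Var m) (Id_type (subst w A) (Var (m + 2)) (Var (m + 1)))"
    using Tm_Var[OF c, of "m"] unfolding nth
    by (simp add: TmEq_refl_iff m_def shift_eq_subst w_def subst_subst eval_nat_numeral ac_simps)
  have eq: "subst_tele (inst [Var m, Var (m + 1), Var (m + 2)]) (subst_tele (lifts 3 w) \<Psi>) = subst_tele (\<lambda>i. Var (i + m)) \<Psi>"
    unfolding subst_tele_subst_tele by (rule subst_tele_cong) (auto simp: lifts_eq w_def inst_simps eval_nat_numeral)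
  have ts: "ElemEq S ?G (vars 0 m) (vars 0 m) (subst_tele (inst [Var m, Var (m + 1), Var (m + 2)]) (subst_tele (lifts 3 w) \<Psi>))"
    using ElemEq_vars[of "[]" \<Psi> "id_ext A \<Gamma>" 0 m] c unfolding eq by (simp add: m_def)
  have eqC: "subst (inst (vars 0 m @ [Var m, Var (m + 1), Var (m + 2)])) (subst (lifts (3 + m) w) C) = C"
  proof -
    have "(\<lambda>i. subst (inst (vars 0 m @ [Var m, Var (m + 1), Var (m + 2)])) (lifts (3 + m) w i)) = Var"
      by (rule ext) (auto simp: lifts_eq w_def inst_simps eval_nat_numeral not_less less_Suc_eq)
    then show ?thesis by (simp add: subst_subst)
  qed
  show ?thesis
    using J_cong[OF p[unfolded J_prem_def, THEN conjunct2, THEN conjunct1]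
      p[unfolded J_prem_def, THEN conjunct2, THEN conjunct2] a b q ts, unfolded eqC]
    by (simp add: J_open_def Let_def len m_def[symmetric] w_def[symmetric])
qed

text \<open>The diagonal turns the open eliminator into a \<open>J\<close> at a reflexivity, so that
  \<open>Id_comp\<close> applies; weakening the method and instantiating it at the variables returns
  \<open>d\<close> (\<open>eqd\<close>).\<close>

lemma J_open_comp:
  assumes "J_prem \<Gamma> A \<Psi> C d A' \<Psi>' C' d'"
  shows "TmEq S (subst_tele (inst (diag1 A)) \<Psi> @ A # \<Gamma>)
     (subst (lifts (length \<Psi>) (inst (diag1 A))) (J_open A \<Psi> C d)) d (subst (lifts (length \<Psi>) (inst (diag1 A))) C)"
proof -
  define m where "m = length \<Psi>"
  define w :: "nat \<Rightarrow> 's exp" where "w = (\<lambda>i. Var (i + (3 + m)))"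
  define w' :: "nat \<Rightarrow> 's exp" where "w' = (\<lambda>i. Var (i + (1 + m)))"
  define \<delta> where "\<delta> = lifts m (inst (diag1 A))"
  let ?P = "subst_tele (inst (diag1 A)) \<Psi>"
  let ?G = "?P @ A # \<Gamma>"
  have C: "Ty S (\<Psi> @ id_ext A \<Gamma>) C" and d: "Tm S ?G d (subst \<delta> C)"
    using assms CtxtEq_Ctxt1 TmEqD TyEqD by (auto simp: J_prem_def \<delta>_def m_def)
  have c: "Ctxt S ?G" using d Tm_Ty Ty_Ctxt by blast
  have w: "SubEq S ?G w' w' \<Gamma>"
    using SubEq_weaken[of "?P @ [A]" \<Gamma>] c by (simp add: w'_def m_def add.commute)
  have p': "J_prem \<Gamma> A \<Psi> C d A \<Psi> C d"
    using assms d by (auto simp: J_prem_def CtxtEq_refl_iff TmEq_refl_iff TyEq_refl_iff \<delta>_def m_def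
      dest: CtxtEq_Ctxt1 TyEqD)
  have p: "J_prem ?G (subst w' A) (subst_tele (lifts 3 w') \<Psi>) (subst (lifts (3 + m) w') C) (subst (lifts (1 + m) w') d)
     (subst w' A) (subst_tele (lifts 3 w') \<Psi>) (subst (lifts (3 + m) w') C) (subst (lifts (1 + m) w') d)"
    by (rule J_prem_subst[OF p' w m_def])
  have nth: "?G ! m = A" by (auto simp: m_def nth_append)
  have a: "Tm S ?G (Var m) (subst w' A)"
    using Tm_Var[OF c, of m] unfolding nth by (simp add: m_def shift_eq_subst w'_def)
  let ?r = "Refl (subst w' A) (Var m)"
  have eq: "subst_tele (inst [?r, Var m, Var m]) (subst_tele (lifts 3 w') \<Psi>) = subst_tele (\<lambda>i. Var (i + m)) ?P"
    unfolding subst_tele_subst_tele by (rule subst_tele_cong)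
      (auto simp: lifts_eq w'_def inst_simps eval_nat_numeral diag1_def shift_eq_subst subst_subst)
  have ts: "ElemEq S ?G (vars 0 m) (vars 0 m) (subst_tele (inst [?r, Var m, Var m]) (subst_tele (lifts 3 w') \<Psi>))"
    using ElemEq_vars[of "[]" ?P "A # \<Gamma>" 0 m] c unfolding eq by (simp add: m_def)
  have eqC: "subst (inst (vars 0 m @ [?r, Var m, Var m])) (subst (lifts (3 + m) w') C) = subst \<delta> C"
    unfolding subst_subst
    by (rule subst_cong) (auto simp: \<delta>_def lifts_eq w'_def inst_simps eval_nat_numeral not_less less_Suc_eq
       diag1_def shift_eq_subst subst_subst)
  have eqd: "subst (inst (vars 0 m @ [Var m])) (subst (lifts (1 + m) w') d) = d"
  proof -
    have "(\<lambda>i. subst (inst (vars 0 m @ [Var m])) (lifts (1 + m) w' i)) = Var"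
      by (rule ext) (auto simp: lifts_eq w'_def inst_simps eval_nat_numeral not_less less_Suc_eq)
    then show ?thesis by (simp add: subst_subst)
  qed
  \<comment> \<open>Of \<open>x, y, p\<close> the diagonal leaves only \<open>x\<close>, so the
    weakening past \<open>3 + m\<close> variables becomes the one past \<open>1 + m\<close>.\<close>
  have dw: "subst \<delta> (w i) = w' i" for i
    by (auto simp: \<delta>_def w_def w'_def lifts_eq diag1_def inst_simps)
  have eqJ: "subst \<delta> (J_open A \<Psi> C d) = J (subst w' A) (subst_tele (lifts 3 w') \<Psi>) (subst (lifts (3 + m) w') C)
     (subst (lifts (1 + m) w') d) (Var m) (Var m) ?r (vars 0 m)"
  proof -
    have "subst_vec \<delta> (vars 0 m) = vars 0 m"
      by (rule nth_equalityI) (auto simp: \<delta>_def lifts_eq)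
    moreover have "\<delta> (m + 2) = Var m" "\<delta> (m + 1) = Var m" "\<delta> m = ?r"
      by (auto simp: \<delta>_def lifts_eq w'_def diag1_def inst_simps shift_eq_subst subst_subst)
    moreover have "(\<lambda>i. subst (lifts k \<delta>) (lifts k w i)) = lifts k w'" for k
      by (rule ext) (auto simp: lifts_eq dw[symmetric] subst_subst)
    ultimately show ?thesis
      by (simp add: J_open_def Let_def m_def[symmetric] w_def[symmetric] subst_J subst_subst subst_tele_subst_tele dw)
  qed
  show ?thesis
    unfolding m_def[symmetric] \<delta>_def[symmetric] eqJ eqC[symmetric]
    by (rule TmEq_trans[OF Id_comp[OF _ _ a]])
      (use p ts d eqd eqC in \<open>auto simp: J_prem_def ElemEq_refl_iff TmEq_refl_iff TyEq_refl_iff simp flip: m_def\<close>)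
qed

end

section \<open>Elimination for identity contexts\<close>

definition Id_vec_ctxt :: "'s exp list \<Rightarrow> 's exp list" where
  "Id_vec_ctxt \<Phi> = Id_gen \<Phi> @ \<Phi> @ \<Phi>"

definition diag :: "'s exp list \<Rightarrow> 's exp list" where
  "diag \<Phi> = refl_ctxt \<Phi> @ vars 0 (length \<Phi>) @ vars 0 (length \<Phi>)"

lemma length_refl_ctxt [simp]: "length (refl_ctxt \<Phi>) = length \<Phi>"
  by (induction \<Phi>) auto

lemma length_Id_gen [simp]: "length (Id_gen \<Phi>) = length \<Phi>"
  by (induction \<Phi>) (auto simp: Let_def)

lemma length_Id_vec_ctxt [simp]: "length (Id_vec_ctxt \<Phi>) = 3 * length \<Phi>"
  by (simp add: Id_vec_ctxt_def)

lemma length_diag [simp]: "length (diag \<Phi>) = 3 * length \<Phi>"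
  by (simp add: diag_def)

context identity_types begin

text \<open>Congruence and computation are proved together: the method \<open>e\<close> is typed
  over the earlier methods \<open>ds\<close>, whereas eliminating into the next type requires it
  over the restriction of \<open>js\<close> to the diagonal. The computation rule for
  \<open>js\<close> makes these types definitionally equal.\<close>

lemma J_type_cong_comp:
  assumes "length \<Psi> = length \<Psi>'" "length \<Theta> = length \<Theta>'"
    "CtxtEq S (\<Theta> @ \<Psi> @ id_ext A \<Gamma>) (\<Theta>' @ \<Psi>' @ id_ext A' \<Gamma>)"
    "ElemEq S (subst_tele (inst (diag1 A)) \<Psi> @ A # \<Gamma>) d d' (subst_tele (lifts (length \<Psi>) (inst (diag1 A))) \<Theta>)"
  shows "ElemEq S (\<Psi> @ id_ext A \<Gamma>) (J_type A \<Psi> \<Theta> d) (J_type A' \<Psi>' \<Theta>' d') \<Theta> \<and>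
    ElemEq S (subst_tele (inst (diag1 A)) \<Psi> @ A # \<Gamma>) (subst_vec (lifts (length \<Psi>) (inst (diag1 A))) (J_type A \<Psi> \<Theta> d)) d
      (subst_tele (lifts (length \<Psi>) (inst (diag1 A))) \<Theta>)"
  using assms(2-)
proof (induction \<Theta> \<Theta>' arbitrary: d d' rule: list_induct2)
  case Nil
  then have "d = []" "d' = []" using ElemEq_length[OF Nil(2)] by auto
  then show ?case using CtxtEq_Ctxt1[OF Nil(1)] ElemEq_Ctxt[OF Nil(2)] by simp
next
  case (Cons D \<Theta> D' \<Theta>')
  let ?X = "\<Psi> @ id_ext A \<Gamma>" and ?Y = "subst_tele (inst (diag1 A)) \<Psi> @ A # \<Gamma>"
  let ?\<delta> = "lifts (length \<Psi>) (inst (diag1 A))"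
  obtain e ds e' ds' where [simp]: "d = e # ds" "d' = e' # ds'"
    using ElemEq_length[OF Cons.prems(2)] by (auto simp: length_Suc_conv)
  have C: "CtxtEq S (\<Theta> @ ?X) (\<Theta>' @ \<Psi>' @ id_ext A' \<Gamma>)" "TyEq S (\<Theta> @ ?X) D D'"
    and ds: "ElemEq S ?Y ds ds' (subst_tele ?\<delta> \<Theta>)"
    and e: "TmEq S ?Y e e' (subst (inst ds) (subst (lifts (length \<Theta>) ?\<delta>) D))"
    using Cons.prems by auto
  define js where "js = J_type A \<Psi> \<Theta> ds"
  define js' where "js' = J_type A' \<Psi>' \<Theta>' ds'"
  have js: "ElemEq S ?X js js' \<Theta>" and comp: "ElemEq S ?Y (subst_vec ?\<delta> js) ds (subst_tele ?\<delta> \<Theta>)"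
    using Cons.IH[OF C(1) ds] by (auto simp: js_def js'_def)
  have ljs: "length js = length \<Theta>" using ElemEq_length[OF js] by simp
  let ?C = "subst (inst js) D" and ?C' = "subst (inst js') D'"
  have A: "TyEq S \<Gamma> A A'"
    using CtxtEq_appendD[of S "\<Theta> @ \<Psi> @ [Id_type (shift 2 A) (Var 1) (Var 0), shift 1 A]"
      "A # \<Gamma>" "\<Theta>' @ \<Psi>' @ [Id_type (shift 2 A') (Var 1) (Var 0), shift 1 A']" "A' # \<Gamma>"] C(1) assms(1) Cons.hyps
    by (simp add: id_ext_def)
  have CC: "TyEq S ?X ?C ?C'"
    using TyEq_SubEq[OF SubEq_inst[OF js] C(2)] .
  have c0: "Ctxt S ((\<Theta> @ \<Psi>) @ id_ext A \<Gamma>)"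
    using CtxtEq_Ctxt1[OF C(1)] by simp
  have \<delta>: "SubEq S (subst_tele ?\<delta> \<Theta> @ ?Y) (lifts (length \<Theta>) ?\<delta>) (lifts (length \<Theta>) ?\<delta>) (\<Theta> @ ?X)"
    using SubEq_lifts_same[OF SubEq_diag1[OF TyEq_refl[OF TyEqD(1)[OF A]]] c0]
    by (simp add: subst_tele_append lifts_lifts)
  have eqC: "subst ?\<delta> ?C = subst (inst (subst_vec ?\<delta> js)) (subst (lifts (length \<Theta>) ?\<delta>) D)"
    by (simp add: subst_inst_vec ljs)
  have "TyEq S (subst_tele ?\<delta> \<Theta> @ ?Y) (subst (lifts (length \<Theta>) ?\<delta>) D) (subst (lifts (length \<Theta>) ?\<delta>) D)"
    using TyEq_SubEq[OF \<delta>] C(2) TyEqD TyEq_refl by blast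
  from TyEq_SubEq[OF SubEq_inst[OF comp] this]
  have "TyEq S ?Y (subst (inst ds) (subst (lifts (length \<Theta>) ?\<delta>) D)) (subst ?\<delta> ?C)"
    unfolding eqC by (rule TyEq_sym)
  then have e: "TmEq S ?Y e e' (subst ?\<delta> ?C)"
    using e TmEq_conv by blast
  have P: "J_prem \<Gamma> A \<Psi> ?C e A' \<Psi>' ?C' e'"
    unfolding J_prem_def using e CC C(1) assms(1) Cons.hyps
    by (auto intro: CtxtEq_appendD)
  show ?case
    using J_open_cong[OF P] J_open_comp[OF P] js comp
    by (simp add: Let_def js_def[symmetric] js'_def[symmetric] eqC)
qed

text \<open>The first two clauses, on the identity context and its diagonal, make the premises of
  the third meaningful; at the next length they are themselves obtained from transport, an instance
  of the third.\<close>

definition elim_good :: "'s exp list \<Rightarrow> 's exp list \<Rightarrow> bool" where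
  "elim_good \<Phi> \<Phi>' \<longleftrightarrow> CtxtEq S (Id_vec_ctxt \<Phi>) (Id_vec_ctxt \<Phi>') \<and>
    SubEq S \<Phi> (inst (diag \<Phi>)) (inst (diag \<Phi>')) (Id_vec_ctxt \<Phi>) \<and>
    (\<forall>\<Psi> \<Psi>' \<Theta> \<Theta>' d d'. length \<Psi> = length \<Psi>' \<longrightarrow> length \<Theta> = length \<Theta>' \<longrightarrow>
      CtxtEq S (\<Theta> @ \<Psi> @ Id_vec_ctxt \<Phi>) (\<Theta>' @ \<Psi>' @ Id_vec_ctxt \<Phi>') \<longrightarrow>
      ElemEq S (subst_tele (inst (diag \<Phi>)) \<Psi> @ \<Phi>) d d' (subst_tele (lifts (length \<Psi>) (inst (diag \<Phi>))) \<Theta>) \<longrightarrow>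
      ElemEq S (\<Psi> @ Id_vec_ctxt \<Phi>) (J_ctxt \<Phi> \<Psi> \<Theta> d) (J_ctxt \<Phi>' \<Psi>' \<Theta>' d') \<Theta> \<and>
      ElemEq S (subst_tele (inst (diag \<Phi>)) \<Psi> @ \<Phi>) (subst_vec (lifts (length \<Psi>) (inst (diag \<Phi>))) (J_ctxt \<Phi> \<Psi> \<Theta> d)) d
        (subst_tele (lifts (length \<Psi>) (inst (diag \<Phi>))) \<Theta>))"

lemma elim_good_Nil: "elim_good [] []"
  unfolding elim_good_def
proof (intro conjI allI impI)
  fix \<Psi> \<Psi>' \<Theta> \<Theta>' d d'
  assume *: "CtxtEq S (\<Theta> @ \<Psi> @ Id_vec_ctxt []) (\<Theta>' @ \<Psi>' @ Id_vec_ctxt [])"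
    and **: "ElemEq S (subst_tele (inst (diag [])) \<Psi> @ []) d d' (subst_tele (lifts (length \<Psi>) (inst (diag []))) \<Theta>)"
  have [simp]: "inst (diag []) = Var" by (simp add: diag_def)
  show "ElemEq S (\<Psi> @ Id_vec_ctxt []) (J_ctxt [] \<Psi> \<Theta> d) (J_ctxt [] \<Psi>' \<Theta>' d') \<Theta>"
    using ** by (simp add: Id_vec_ctxt_def)
  have "ElemEq S \<Psi> d d \<Theta>" using ** ElemEq_Elem ElemEq_refl_iff by simp
  then show "ElemEq S (subst_tele (inst (diag [])) \<Psi> @ []) (subst_vec (lifts (length \<Psi>) (inst (diag []))) (J_ctxt [] \<Psi> \<Theta> d)) d
        (subst_tele (lifts (length \<Psi>) (inst (diag []))) \<Theta>)" by simp
qed (auto simp: Id_vec_ctxt_def)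

end

definition transp_term :: "'s exp \<Rightarrow> 's exp list \<Rightarrow> 's exp" where
  "transp_term D \<Lambda> = hd (transport (length \<Lambda>) (J_ctxt \<Lambda>) [D])"

text \<open>The part of the identity context of \<open>\<Lambda>, D\<close> lying over that of
  \<open>\<Lambda>\<close>. All of \<open>x, x', p\<close> precede \<open>y, y', q\<close>, so that
  elimination over \<open>\<Lambda>\<close> can treat the latter as post-context.\<close>

definition Id_fib :: "'s exp \<Rightarrow> 's exp list \<Rightarrow> 's exp list" where
  "Id_fib D \<Lambda> = (let n = length \<Lambda> in
    [Id_over n (J_ctxt \<Lambda>) D (vars (2 * n + 2) n) (vars (n + 2) n) (vars 2 n) (Var 1) (Var 0),
     subst (inst (vars (n + 1) n)) D, subst (inst (vars (2 * n) n)) D])"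

lemma length_Id_fib [simp]: "length (Id_fib D \<Lambda>) = 3"
  by (simp add: Id_fib_def Let_def)

text \<open>\<open>reord\<close> and \<open>unreord\<close> are the local \<open>reord\<close> and
  \<open>back\<close> of \<open>J_step\<close>; as separate constants they can be shown to be
  mutually inverse and well typed.\<close>

definition reord :: "nat \<Rightarrow> 's exp list" where
  "reord n = Var 0 # vars 3 n @ Var 1 # vars (n + 3) n @ Var 2 # vars (2 * n + 3) n"

definition unreord :: "nat \<Rightarrow> 's exp list" where
  "unreord n = Var 0 # Var (n + 1) # Var (2 * n + 2) # vars 1 n @ vars (n + 2) n @ vars (2 * n + 3) n"

lemma inst_ge: "length ts \<le> i \<Longrightarrow> inst ts i = Var (i - length ts)"
  by (simp add: inst_def)

lemma reord_eq: "inst (reord n) i = (if i < 3 * n + 3 then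
   Var (if i = 0 then 0 else if i < n + 1 then i + 2 else if i = n + 1 then 1 else if i < 2 * n + 2 then i + 1
     else if i = 2 * n + 2 then 2 else i) else Var (i - (3 * n + 3)))"
  by (auto simp: reord_def inst_simps inst_ge)

lemma unreord_eq: "inst (unreord n) i = (if i < 3 * n + 3 then
   Var (if i = 0 then 0 else if i = 1 then n + 1 else if i = 2 then 2 * n + 2 else if i < n + 3 then i - 2
     else if i < 2 * n + 3 then i - 1 else i) else Var (i - (3 * n + 3)))"
  by (auto simp: unreord_def inst_simps inst_ge)

lemma unreord_reord: "i < 3 * n + 3 \<Longrightarrow> subst (inst (unreord n)) (inst (reord n) i) = Var i"
  by (auto simp: reord_eq unreord_eq)

lemma reord_unreord: "i < 3 * n + 3 \<Longrightarrow> subst (inst (reord n)) (inst (unreord n) i) = Var i"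
  by (auto simp: reord_eq unreord_eq)

lemma diag_eq: "inst (diag \<Phi>) i = (let n = length \<Phi> in if i < n then refl_ctxt \<Phi> ! i
   else if i < 2 * n then Var (i - n) else if i < 3 * n then Var (i - 2 * n) else Var (i - 3 * n))"
  by (auto simp: diag_def inst_def nth_append Let_def)

text \<open>Up to reordering, the diagonal of \<open>\<Lambda>, D\<close> is composed of those of
  \<open>D\<close> and of \<open>\<Lambda>\<close>. This factorisation is why elimination in two
  stages computes.\<close>

lemma diag1_diag_reord:
  assumes "i < 3 * n + 3" "n = length \<Lambda>"
  shows "subst (inst (diag1 D)) (subst (lifts 3 (inst (diag \<Lambda>))) (inst (reord n) i)) = inst (diag (D # \<Lambda>)) i"
proof -
  have [simp]: "inst (diag1 D) (j + 3) = Var (Suc j)" "inst (diag1 D) 0 = Refl (shift 1 D) (Var 0)"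
    "inst (diag1 D) (Suc 0) = Var 0" "inst (diag1 D) 2 = Var 0" for j
    by (auto simp: diag1_def inst_simps)
  consider "i = 0" | "0 < i" "i < n + 1" | "i = n + 1" | "n + 1 < i" "i < 2 * n + 2" | "i = 2 * n + 2" | "2 * n + 2 < i"
    by linarith
  then show ?thesis
    by cases (use assms in \<open>auto simp: reord_eq diag_eq lifts_eq Let_def nth_Cons' subst_subst shift_eq_subst Suc_diff_le\<close>)
qed

lemma diag_unreord:
  assumes "i < 3 * n + 3" "n = length \<Lambda>"
  shows "subst (inst (diag (D # \<Lambda>))) (inst (unreord n) i) = subst (inst (diag1 D)) (lifts 3 (inst (diag \<Lambda>)) i)"
proof -
  have "\<exists>j < 3 * n + 3. inst (unreord n) i = (Var j :: 'a exp)" using assms by (auto simp: unreord_eq)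
  then obtain j where j: "inst (unreord n) i = (Var j :: 'a exp)" "j < 3 * n + 3" by blast
  have "subst (inst (diag (D # \<Lambda>))) (inst (unreord n) i) = inst (diag (D # \<Lambda>)) j" by (simp add: j)
  also have "\<dots> = subst (inst (diag1 D)) (subst (lifts 3 (inst (diag \<Lambda>))) (subst (inst (reord n)) (inst (unreord n) i)))"
    using diag1_diag_reord[OF j(2) assms(2), of D] by (simp add: j)
  also have "\<dots> = subst (inst (diag1 D)) (lifts 3 (inst (diag \<Lambda>)) i)"
    by (simp add: reord_unreord[OF assms(1)])
  finally show ?thesis .
qed

section \<open>Extension of a context by one type: transport, and the fibre of the identity
  context\<close>

locale elim_step = identity_types S for S :: "'s judgements" +
  fixes D D' :: "'s exp" and \<Lambda> \<Lambda>' :: "'s exp list"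
  assumes good: "elim_good \<Lambda> \<Lambda>'" and ctxt: "CtxtEq S \<Lambda> \<Lambda>'" and type: "TyEq S \<Lambda> D D'"
begin

text \<open>In the context \<open>p, x', x\<close> given by \<open>\<Xi>\<close>, the types \<open>Y\<close> and \<open>D1\<close> are \<open>D(x)\<close> and \<open>D(x')\<close>. In the
  extension by \<open>y : D(x)\<close>, \<open>Y'\<close> is \<open>D(x')\<close>, and \<open>Q\<close> is \<open>Id\<^bsub>D(x)\<^esub>(y, p\<^sup>*y')\<close> over the further \<open>y' : D(x')\<close>.
  \<open>D2\<close> is \<open>D(x)\<close> over \<open>z : D(x')\<close>, the type of \<open>p\<^sup>*z\<close>.\<close>

definition "n = length \<Lambda>"
definition "\<Xi> = Id_vec_ctxt \<Lambda>"
definition "\<Xi>' = Id_vec_ctxt \<Lambda>'"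
definition "\<delta> = inst (diag \<Lambda>)"
definition "\<delta>' = inst (diag \<Lambda>')"
definition "D1 = subst (inst (vars n n)) D"
definition "D2 = subst (inst (vars (2 * n + 1) n)) D"
definition "Y = subst (inst (vars (2 * n) n)) D"
definition "Y' = subst (inst (vars (n + 1) n)) D"
definition "Q = Id_type (subst (inst (vars (2 * n + 2) n)) D) (Var 1)
   (subst (\<lambda>i. if i = 0 then Var 0 else Var (i + 1)) (transp_term D \<Lambda>))"

lemma length_\<Lambda>': "length \<Lambda>' = n"
  using CtxtEq_length[OF ctxt] by (simp add: n_def)

lemma Ctxt_\<Lambda>: "Ctxt S \<Lambda>" "Ctxt S \<Lambda>'"
  using ctxt CtxtEq_Ctxt1 CtxtEq_Ctxt2 by blast+

lemma CtxtEq_\<Xi>: "CtxtEq S \<Xi> \<Xi>'"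
  using good by (simp add: elim_good_def \<Xi>_def \<Xi>'_def)

lemma Ctxt_\<Xi>: "Ctxt S \<Xi>" 
  using CtxtEq_\<Xi> CtxtEq_Ctxt1 by blast

lemma SubEq_\<delta>: "SubEq S \<Lambda> \<delta> \<delta>' \<Xi>"
  using good by (simp add: elim_good_def \<Xi>_def \<delta>_def \<delta>'_def)

lemma length_\<Xi>: "length \<Xi> = 3 * n"
  by (simp add: \<Xi>_def n_def)

lemma Ty_D: "Ty S \<Lambda> D" "Ty S \<Lambda> D'"
  using TyEqD type by auto

lemma D_eqI: "(\<And>i. i < n \<Longrightarrow> \<sigma> i = \<tau> i) \<Longrightarrow> subst \<sigma> D = subst \<tau> D"
  "(\<And>i. i < n \<Longrightarrow> \<sigma> i = \<tau> i) \<Longrightarrow> subst \<sigma> D' = subst \<tau> D'"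
  using subst_eqI_Ty[OF Ty_D(1), of \<sigma> \<tau>] subst_eqI_Ty[OF Ty_D(2), of \<sigma> \<tau>] by (simp_all add: n_def)

lemma vars_\<Xi>:
  assumes "Ctxt S (X @ \<Xi>)" "length X = k"
  shows "ElemEq S (X @ \<Xi>) (vars (k + n) n) (vars (k + n) n) \<Lambda>"
    "ElemEq S (X @ \<Xi>) (vars (k + 2 * n) n) (vars (k + 2 * n) n) \<Lambda>"
proof -
  have c: "Ctxt S ((X @ Id_gen \<Lambda>) @ \<Lambda> @ \<Lambda>)" "Ctxt S ((X @ Id_gen \<Lambda> @ \<Lambda>) @ \<Lambda> @ [])"
    using assms(1) by (simp_all add: \<Xi>_def Id_vec_ctxt_def)
  have e: "(X @ Id_gen \<Lambda>) @ \<Lambda> @ \<Lambda> = X @ \<Xi>" "(X @ Id_gen \<Lambda> @ \<Lambda>) @ \<Lambda> @ [] = X @ \<Xi>"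
    by (simp_all add: \<Xi>_def Id_vec_ctxt_def)
  have l: "length (X @ Id_gen \<Lambda>) = k + n" "length (X @ Id_gen \<Lambda> @ \<Lambda>) = k + 2 * n"
    using assms(2) by (simp_all add: n_def)
  show "ElemEq S (X @ \<Xi>) (vars (k + n) n) (vars (k + n) n) \<Lambda>"
    using ElemEq_vars_closed[OF c(1) l(1) n_def[symmetric] Ctxt_\<Lambda>(1)] unfolding e .
  show "ElemEq S (X @ \<Xi>) (vars (k + 2 * n) n) (vars (k + 2 * n) n) \<Lambda>"
    using ElemEq_vars_closed[OF c(2) l(2) n_def[symmetric] Ctxt_\<Lambda>(1)] unfolding e .
qed

lemma TyEq_at:
  assumes "ElemEq S \<Gamma> ts ts \<Lambda>"
  shows "TyEq S \<Gamma> (subst (inst ts) D) (subst (inst ts) D')"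
  using TyEq_SubEq[OF ElemEq_SubEq[OF assms] type] .

lemma D1: "TyEq S \<Xi> D1 (subst (inst (vars n n)) D')"
  using TyEq_at vars_\<Xi>(1)[of "[]"] Ctxt_\<Xi> by (simp add: D1_def)

lemma D2: "TyEq S (D1 # \<Xi>) D2 (subst (inst (vars (2 * n + 1) n)) D')"
  using TyEq_at vars_\<Xi>(2)[of "[D1]" 1] D1 TyEqD(1) Ctxt_\<Xi> by (auto simp: D2_def)

lemma D1_\<delta>: "subst \<delta> D1 = D"
proof -
  have "subst \<delta> D1 = subst Var D"
    unfolding D1_def subst_subst by (rule D_eqI) (auto simp: inst_simps \<delta>_def diag_eq n_def)
  then show ?thesis by simp
qed

lemma D2_\<delta>: "subst (lifts 1 \<delta>) D2 = shift 1 D"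
  unfolding D2_def subst_subst shift_eq_subst
  by (rule D_eqI) (auto simp: inst_simps \<delta>_def diag_eq n_def lifts_eq Let_def)

lemma Ctxt_D: "Ctxt S (D # \<Lambda>)" "CtxtEq S (D # \<Lambda>) (D' # \<Lambda>')"
  using type Ty_D Ctxt_\<Lambda> ctxt by auto

lemma elim:
  assumes "CtxtEq S (\<Theta> @ \<Psi> @ \<Xi>) (\<Theta>' @ \<Psi>' @ \<Xi>')" "length \<Psi> = m" "length \<Psi>' = m" "length \<Theta> = length \<Theta>'"
    "ElemEq S (subst_tele \<delta> \<Psi> @ \<Lambda>) d d' (subst_tele (lifts m \<delta>) \<Theta>)"
  shows "ElemEq S (\<Psi> @ \<Xi>) (J_ctxt \<Lambda> \<Psi> \<Theta> d) (J_ctxt \<Lambda>' \<Psi>' \<Theta>' d') \<Theta>"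
   "ElemEq S (subst_tele \<delta> \<Psi> @ \<Lambda>) (subst_vec (lifts m \<delta>) (J_ctxt \<Lambda> \<Psi> \<Theta> d)) d (subst_tele (lifts m \<delta>) \<Theta>)"
  using good[unfolded elim_good_def, THEN conjunct2, THEN conjunct2, rule_format, of \<Psi> \<Psi>' \<Theta> \<Theta>' d d'] assms
  unfolding \<Xi>_def \<Xi>'_def \<delta>_def by simp_all

text \<open>Elimination with post-context \<open>z : D(x')\<close>, target \<open>D(x)\<close> and
  the variable \<open>z\<close> as method. Over the diagonal \<open>D1\<close> and \<open>D2\<close>
  both become \<open>D\<close> up to weakening, so this method is well typed; the second claim, that
  transport along \<open>r(x)\<close> fixes \<open>z\<close>, is the computation rule.\<close>

lemma transp_term:
  "TmEq S (D1 # \<Xi>) (transp_term D \<Lambda>) (transp_term D' \<Lambda>') D2"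
  "TmEq S (D # \<Lambda>) (subst (lifts 1 \<delta>) (transp_term D \<Lambda>)) (Var 0) (shift 1 D)"
proof -
  let ?D1' = "subst (inst (vars n n)) D'" and ?D2' = "subst (inst (vars (2 * n + 1) n)) D'"
  have C: "CtxtEq S ([D2] @ [D1] @ \<Xi>) ([?D2'] @ [?D1'] @ \<Xi>')"
    using D1 D2 CtxtEq_\<Xi> by simp
  have "TmEq S (D # \<Lambda>) (Var 0) (Var 0) (shift 1 D)"
    using Tm_Var[OF Ctxt_D(1), of 0] by (simp add: TmEq_refl_iff)
  then have d: "ElemEq S (subst_tele \<delta> [D1] @ \<Lambda>) (vars 0 1) (vars 0 1) (subst_tele (lifts 1 \<delta>) [D2])"
    using Ctxt_D(1) D1_\<delta> D2_\<delta> by (simp add: vars_def)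
  have t: "transport n (J_ctxt \<Lambda>) [D] = J_ctxt \<Lambda> [D1] [D2] (vars 0 1)"
    "transport n (J_ctxt \<Lambda>') [D'] = J_ctxt \<Lambda>' [?D1'] [?D2'] (vars 0 1)"
    by (simp_all add: transport_def D1_def D2_def)
  note e = elim[OF C _ _ _ d, folded t, simplified]
  have l: "length (transport n (J_ctxt \<Lambda>) [D]) = 1" "length (transport n (J_ctxt \<Lambda>') [D']) = 1"
    using ElemEq_length[OF e(1)] by auto
  have "transport n (J_ctxt \<Lambda>) [D] = [transp_term D \<Lambda>]" "transport n (J_ctxt \<Lambda>') [D'] = [transp_term D' \<Lambda>']"
    using l by (auto simp: transp_term_def n_def[symmetric] length_\<Lambda>' length_Suc_conv)
  then show "TmEq S (D1 # \<Xi>) (transp_term D \<Lambda>) (transp_term D' \<Lambda>') D2"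
     "TmEq S (D # \<Lambda>) (subst (lifts 1 \<delta>) (transp_term D \<Lambda>)) (Var 0) (shift 1 D)"
    using e D1_\<delta> D2_\<delta> by (simp_all add: vars_def)
qed

lemma transp_term_eqI:
  "(\<And>i. i < 3 * n + 1 \<Longrightarrow> \<sigma> i = \<tau> i) \<Longrightarrow> subst \<sigma> (transp_term D \<Lambda>) = subst \<tau> (transp_term D \<Lambda>)"
  "(\<And>i. i < 3 * n + 1 \<Longrightarrow> \<sigma> i = \<tau> i) \<Longrightarrow> subst \<sigma> (transp_term D' \<Lambda>') = subst \<tau> (transp_term D' \<Lambda>')"
  using subst_eqI_Tm[OF TmEqD(1)[OF transp_term(1)], of \<sigma> \<tau>] subst_eqI_Tm[OF TmEqD(2)[OF transp_term(1)], of \<sigma> \<tau>]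
  by (simp_all add: length_\<Xi>)

lemma Id_over_eq:
  assumes "length x = n" "length x' = n" "length p = n"
  shows "Id_over n (J_ctxt \<Lambda>) D x x' p y y' =
    Id_type (subst (inst x) D) y (subst (inst (y' # p @ x' @ x)) (transp_term D \<Lambda>))"
   "Id_over n (J_ctxt \<Lambda>') D' x x' p y y' =
    Id_type (subst (inst x) D') y (subst (inst (y' # p @ x' @ x)) (transp_term D' \<Lambda>'))"
  by (simp_all add: Id_over_def transp_term_def n_def[symmetric] length_\<Lambda>')

lemma Id_fib_eq: "Id_fib D \<Lambda> = [Q, Y', Y]"
proof -
  have "subst (inst (Var 0 # vars 2 n @ vars (n + 2) n @ vars (2 * n + 2) n)) (transp_term D \<Lambda>) =
     subst (\<lambda>i. if i = 0 then Var 0 else Var (i + 1)) (transp_term D \<Lambda>)"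
    by (rule transp_term_eqI) (auto simp: inst_simps)
  then show ?thesis
    by (simp add: Id_fib_def Let_def n_def[symmetric] Id_over_eq Q_def Y'_def Y_def)
qed

lemma Id_fib_eq': "Id_fib D' \<Lambda>' = [Id_type (subst (inst (vars (2 * n + 2) n)) D') (Var 1)
     (subst (\<lambda>i. if i = 0 then Var 0 else Var (i + 1)) (transp_term D' \<Lambda>')),
     subst (inst (vars (n + 1) n)) D', subst (inst (vars (2 * n) n)) D']"
proof -
  have "subst (inst (Var 0 # vars 2 n @ vars (n + 2) n @ vars (2 * n + 2) n)) (transp_term D' \<Lambda>') =
     subst (\<lambda>i. if i = 0 then Var 0 else Var (i + 1)) (transp_term D' \<Lambda>')"
    by (rule transp_term_eqI) (auto simp: inst_simps)
  then show ?thesis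
    by (simp add: Id_fib_def Let_def length_\<Lambda>' Id_over_eq)
qed

lemma Y: "TyEq S \<Xi> Y (subst (inst (vars (2 * n) n)) D')"
  using TyEq_at vars_\<Xi>(2)[of "[]"] Ctxt_\<Xi> by (simp add: Y_def)

lemma Y': "TyEq S (Y # \<Xi>) Y' (subst (inst (vars (n + 1) n)) D')"
  using TyEq_at vars_\<Xi>(1)[of "[Y]" 1] Y TyEqD(1) Ctxt_\<Xi> by (auto simp: Y'_def)

lemma Ctxt_YY: "Ctxt S (Y' # Y # \<Xi>)"
  using Y Y' TyEqD(1) Ctxt_\<Xi> by auto

lemma CtxtEq_YY: "CtxtEq S (Y' # Y # \<Xi>) (subst (inst (vars (n + 1) n)) D' # subst (inst (vars (2 * n) n)) D' # \<Xi>')"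
  using Y Y' CtxtEq_\<Xi> by simp

lemma Q: "TyEq S (Y' # Y # \<Xi>) Q (Id_type (subst (inst (vars (2 * n + 2) n)) D') (Var 1)
     (subst (\<lambda>i. if i = 0 then Var 0 else Var (i + 1)) (transp_term D' \<Lambda>')))"
proof -
  let ?G = "Y' # Y # \<Xi>"
  \<comment> \<open>\<open>?r\<close> keeps \<open>y'\<close> as the argument of transport and skips
    \<open>y\<close>, which sits between \<open>y'\<close> and \<open>p\<close>.\<close>
  let ?r = "\<lambda>i. if i = 0 then Var 0 else Var (i + 1)"
  have w: "SubEq S ?G (\<lambda>i. Var (i + 2)) (\<lambda>i. Var (i + 2)) \<Xi>"
    using SubEq_weaken[of "[Y', Y]" \<Xi>] Ctxt_YY by (simp add: numeral_2_eq_2)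
  have e: "shift 1 Y' = subst (\<lambda>i. Var (i + 2)) D1"
    unfolding shift_eq_subst Y'_def D1_def subst_subst by (rule D_eqI) (auto simp: inst_simps)
  have "TmEq S ?G (Var 0) (Var 0) (subst (\<lambda>i. Var (i + 2)) D1)"
    using Tm_Var[OF Ctxt_YY, of 0] e by (simp add: TmEq_refl_iff)
  with w have r: "SubEq S ?G ?r ?r (D1 # \<Xi>)" by simp
  have e2: "subst ?r D2 = subst (inst (vars (2 * n + 2) n)) D"
    unfolding D2_def subst_subst by (rule D_eqI) (auto simp: inst_simps)
  have t: "TmEq S ?G (subst ?r (transp_term D \<Lambda>)) (subst ?r (transp_term D' \<Lambda>')) (subst (inst (vars (2 * n + 2) n)) D)"
    using TmEq_SubEq[OF r transp_term(1)] unfolding e2 .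
  have e1: "shift 2 Y = subst (inst (vars (2 * n + 2) n)) D"
    unfolding shift_eq_subst Y_def subst_subst by (rule D_eqI) (auto simp: inst_simps)
  have "TmEq S ?G (Var 1) (Var 1) (subst (inst (vars (2 * n + 2) n)) D)"
    using Tm_Var[OF Ctxt_YY, of 1] e1 by (simp add: TmEq_refl_iff numeral_2_eq_2)
  moreover have "TyEq S ?G (subst (inst (vars (2 * n + 2) n)) D) (subst (inst (vars (2 * n + 2) n)) D')"
    using TyEq_at vars_\<Xi>(2)[of "[Y', Y]" 2] Ctxt_YY by (simp add: add.commute)
  ultimately show ?thesis
    unfolding Q_def using t by (intro Id_cong)
qed

lemma CtxtEq_fib: "CtxtEq S (Id_fib D \<Lambda> @ \<Xi>) (Id_fib D' \<Lambda>' @ \<Xi>')"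
  using CtxtEq_YY Q by (simp add: Id_fib_eq Id_fib_eq')

lemma Y_\<delta>: "subst \<delta> Y = D"
proof -
  have "subst \<delta> Y = subst Var D"
    unfolding Y_def subst_subst by (rule D_eqI) (auto simp: inst_simps \<delta>_def diag_eq n_def Let_def)
  then show ?thesis by simp
qed

lemma Y'_\<delta>: "subst (lifts 1 \<delta>) Y' = shift 1 D"
  unfolding Y'_def subst_subst shift_eq_subst
  by (rule D_eqI) (auto simp: inst_simps \<delta>_def diag_eq n_def lifts_eq Let_def)

text \<open>Since \<open>r(x)\<^sup>*y' = y'\<close>, restricting \<open>q, y', y\<close> along \<open>x \<mapsto> (r(x), x, x)\<close> gives the context of
  \<open>Id\<^sub>D\<close>-elimination, but only up to definitional equality.\<close>

lemma fib_\<delta>: "CtxtEq S (subst_tele \<delta> (Id_fib D \<Lambda>) @ \<Lambda>) (id_ext D \<Lambda>)"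
proof -
  let ?G = "shift 1 D # D # \<Lambda>"
  have c: "Ctxt S ?G"
    using CtxtEq_Ctxt1[OF CtxtEq_id_ext[OF type]] by (simp add: id_ext_def)
  let ?r = "\<lambda>i. if i = 0 then Var 0 else Var (i + 1)"
  have w: "SubEq S ?G (\<lambda>i. Var (i + 2)) (\<lambda>i. Var (i + 2)) \<Lambda>"
    using SubEq_weaken[of "[shift 1 D, D]" \<Lambda>] c by (simp add: numeral_2_eq_2)
  have v: "TmEq S ?G (Var 0) (Var 0) (shift 2 D)" "TmEq S ?G (Var 1) (Var 1) (shift 2 D)"
    using Tm_Var[OF c, of 0] Tm_Var[OF c, of 1]
    by (simp_all add: TmEq_refl_iff shift_eq_subst subst_subst numeral_2_eq_2)
  with w have r: "SubEq S ?G ?r ?r (D # \<Lambda>)" by (simp add: shift_eq_subst)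
  have e2: "subst ?r (shift 1 D) = shift 2 D"
    by (simp add: shift_eq_subst subst_subst)
  have e3: "subst (lifts 2 \<delta>) (subst ?r (transp_term D \<Lambda>)) = subst ?r (subst (lifts 1 \<delta>) (transp_term D \<Lambda>))"
    unfolding subst_subst
    by (rule transp_term_eqI) (auto simp: lifts_eq subst_subst numeral_2_eq_2)
  have e4: "subst (lifts 2 \<delta>) (subst (inst (vars (2 * n + 2) n)) D) = shift 2 D"
    unfolding subst_subst shift_eq_subst
    by (rule D_eqI) (auto simp: inst_simps \<delta>_def diag_eq n_def lifts_eq Let_def)
  have t: "TmEq S ?G (subst (lifts 2 \<delta>) (subst ?r (transp_term D \<Lambda>))) (Var 0) (shift 2 D)"
    using TmEq_SubEq[OF r transp_term(2)] unfolding e2 e3 by simp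
  have D2: "TyEq S ?G (shift 2 D) (shift 2 D)"
    using TmEq_Ty[OF v(1)] TyEq_refl by blast
  have "TyEq S ?G (subst (lifts 2 \<delta>) Q) (Id_type (shift 2 D) (Var 1) (Var 0))"
    using Id_cong[OF D2 v(2) t] e4 by (simp add: Q_def lifts_eq)
  then show ?thesis
    unfolding Id_fib_eq id_ext_def using c Y_\<delta> Y'_\<delta>
    by (simp add: numeral_2_eq_2 CtxtEq_refl_iff TyEq_refl_iff)
qed

end

section \<open>The identity context of \<open>\<Lambda>, D\<close> compared with its
  reordering\<close>

context elim_step begin

text \<open>\<open>dom_base\<close> projects \<open>y', x', y, x\<close> onto \<open>x', x\<close>; \<open>b2\<close> and \<open>r2\<close> are \<open>unreord\<close> and \<open>reord\<close> before
  the variable \<open>q\<close> is added.\<close>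

definition dom_base :: "nat \<Rightarrow> 's exp" where "dom_base = inst (vars 1 n @ vars (n + 2) n)"
definition "P = subst_tele dom_base (Id_gen \<Lambda>)"
definition "X1 = P @ (D # \<Lambda>) @ (D # \<Lambda>)"
definition "X1' = subst_tele dom_base (Id_gen \<Lambda>') @ (D' # \<Lambda>') @ (D' # \<Lambda>')"
definition b2 :: "nat \<Rightarrow> 's exp" where "b2 = (\<lambda>i. if i = 0 then Var n else if i = 1 then Var (2 * n + 1) else lifts n dom_base (i - 2))"
definition "Q' = Id_type (subst (inst (vars (2 * n + 2) n)) D') (Var 1)
     (subst (\<lambda>i. if i = 0 then Var 0 else Var (i + 1)) (transp_term D' \<Lambda>'))"

lemma b2_eq: "b2 i = (if i = 0 then Var n else if i = 1 then Var (2 * n + 1) else if i < n + 2 then Var (i - 2)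
    else if i < 2 * n + 2 then Var (i - 1) else if i < 3 * n + 2 then Var i else Var (i - (2 * n + 2)))"
  by (auto simp: b2_def lifts_eq dom_base_def inst_simps)

text \<open>Exhibits the type of \<open>q\<close> as \<open>Q\<close> along \<open>b2\<close>, so
  that what is known of \<open>Q\<close> over the reordered context carries over. The differently
  indexed transport terms agree on their \<open>3 * n + 1\<close> variables.\<close>

lemma Id_vec_ctxt_Cons: "Id_vec_ctxt (D # \<Lambda>) = subst b2 Q # X1"
  "Id_vec_ctxt (D' # \<Lambda>') = subst b2 Q' # X1'"
proof -
  let ?v = "inst (Var n # vars 0 n @ vars (n + 1) n @ vars (2 * n + 2) n)"
  have 1: "subst b2 (subst (\<lambda>i. if i = 0 then Var 0 else Var (i + 1)) (transp_term D \<Lambda>)) = subst ?v (transp_term D \<Lambda>)"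
    unfolding subst_subst by (rule transp_term_eqI) (auto simp: inst_simps b2_eq)
  have 2: "subst b2 (subst (\<lambda>i. if i = 0 then Var 0 else Var (i + 1)) (transp_term D' \<Lambda>')) = subst ?v (transp_term D' \<Lambda>')"
    unfolding subst_subst by (rule transp_term_eqI) (auto simp: inst_simps b2_eq)
  have 3: "subst b2 (subst (inst (vars (2 * n + 2) n)) D) = subst (inst (vars (2 * n + 2) n)) D"
    "subst b2 (subst (inst (vars (2 * n + 2) n)) D') = subst (inst (vars (2 * n + 2) n)) D'"
    unfolding subst_subst by (rule D_eqI, auto simp: inst_simps b2_eq)+
  have 4: "b2 1 = Var (2 * n + 1)" by (simp add: b2_def)
  show "Id_vec_ctxt (D # \<Lambda>) = subst b2 Q # X1"
    by (simp add: Id_vec_ctxt_def Let_def n_def[symmetric] Id_over_eq X1_def P_def dom_base_def Q_def 1 3[simplified] 4[simplified])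
  show "Id_vec_ctxt (D' # \<Lambda>') = subst b2 Q' # X1'"
    by (simp add: Id_vec_ctxt_def Let_def length_\<Lambda>' Id_over_eq X1'_def dom_base_def Q'_def 2 3[simplified] 4[simplified])
qed

lemma length_P: "length P = n" by (simp add: P_def n_def)

lemma CtxtEq_DD: "CtxtEq S ((D # \<Lambda>) @ (D # \<Lambda>)) ((D' # \<Lambda>') @ (D' # \<Lambda>'))"
  using CtxtEq_append_closed Ctxt_D(2) by blast

lemma SubEq_dom_base: "SubEq S ((D # \<Lambda>) @ (D # \<Lambda>)) dom_base dom_base (\<Lambda> @ \<Lambda>)"
proof -
  let ?G = "(D # \<Lambda>) @ (D # \<Lambda>)"
  have c: "Ctxt S ([D] @ \<Lambda> @ (D # \<Lambda>))" "Ctxt S ((D # \<Lambda> @ [D]) @ \<Lambda> @ [])"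
    using CtxtEq_Ctxt1[OF CtxtEq_DD] by simp_all
  have "ElemEq S ?G (vars 1 n) (vars 1 n) \<Lambda>" "ElemEq S ?G (vars (n + 2) n) (vars (n + 2) n) \<Lambda>"
    using ElemEq_vars_closed[OF c(1) _ n_def[symmetric] Ctxt_\<Lambda>(1), of 1]
     ElemEq_vars_closed[OF c(2) _ n_def[symmetric] Ctxt_\<Lambda>(1), of "n + 2"] by (simp_all add: n_def)
  then have "ElemEq S ?G (vars 1 n @ vars (n + 2) n) (vars 1 n @ vars (n + 2) n) (\<Lambda> @ \<Lambda>)"
    by (subst ElemEq_append_iff) (auto simp: n_def[symmetric] subst_tele_closed_Ctxt Ctxt_\<Lambda>)
  then show ?thesis unfolding dom_base_def by (rule ElemEq_SubEq)
qed

lemma CtxtEq_X1: "CtxtEq S X1 X1'"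
  unfolding X1_def X1'_def P_def
  using CtxtEq_subst_tele[OF SubEq_dom_base CtxtEq_DD, of "Id_gen \<Lambda>" "Id_gen \<Lambda>'" "\<Lambda>' @ \<Lambda>'"] CtxtEq_\<Xi>
  by (simp add: \<Xi>_def \<Xi>'_def Id_vec_ctxt_def length_\<Lambda>' n_def[symmetric])

lemma SubEq_X1_\<Xi>: "SubEq S X1 (lifts n dom_base) (lifts n dom_base) \<Xi>"
  using SubEq_lifts_same[OF SubEq_dom_base, of "Id_gen \<Lambda>"] Ctxt_\<Xi>
  by (simp add: X1_def P_def \<Xi>_def Id_vec_ctxt_def n_def[symmetric])

lemma Ctxt_X1: "Ctxt S X1"
  using CtxtEq_X1 CtxtEq_Ctxt1 by blast

lemma SubEq_b2: "SubEq S X1 b2 b2 (Y' # Y # \<Xi>)"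
proof -
  have nth: "X1 ! n = D" "X1 ! (2 * n + 1) = D" and l: "length X1 = 3 * n + 2"
    by (auto simp: X1_def nth_append length_P n_def[symmetric])
  have 1: "shift (Suc n) D = subst (\<lambda>i. b2 (i + 1)) Y'" 
    unfolding shift_eq_subst Y'_def subst_subst by (rule D_eqI) (auto simp: inst_simps b2_eq)
  have 2: "shift (Suc (2 * n + 1)) D = subst (\<lambda>i. b2 (i + 2)) Y"
    unfolding shift_eq_subst Y_def subst_subst by (rule D_eqI) (auto simp: inst_simps b2_eq)
  have "TmEq S X1 (Var n) (Var n) (subst (\<lambda>i. b2 (i + 1)) Y')"
    using Tm_Var[OF Ctxt_X1, of n] l unfolding nth 1 by (simp add: TmEq_refl_iff)
  moreover have "TmEq S X1 (Var (2 * n + 1)) (Var (2 * n + 1)) (subst (\<lambda>i. b2 (i + 2)) Y)"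
    using Tm_Var[OF Ctxt_X1, of "2 * n + 1"] l unfolding nth 2 by (simp add: TmEq_refl_iff)
  moreover have "b2 0 = Var n" "b2 1 = Var (2 * n + 1)" "(\<lambda>i. b2 (i + 2)) = lifts n dom_base"
    by (auto simp: b2_def)
  ultimately show ?thesis using SubEq_X1_\<Xi> by (simp add: numeral_2_eq_2)
qed

lemma CtxtEq_Id_vec_Cons: "CtxtEq S (Id_vec_ctxt (D # \<Lambda>)) (Id_vec_ctxt (D' # \<Lambda>'))"
  unfolding Id_vec_ctxt_Cons using TyEq_SubEq[OF SubEq_b2 Q] CtxtEq_X1 by (simp add: Q'_def)

lemma Ctxt_Id_vec_Cons: "Ctxt S (Id_vec_ctxt (D # \<Lambda>))"
  using CtxtEq_Id_vec_Cons CtxtEq_Ctxt1 by blast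

lemma Ctxt_fib: "Ctxt S (Id_fib D \<Lambda> @ \<Xi>)"
  using CtxtEq_fib CtxtEq_Ctxt1 by blast

text \<open>Typed as the lift of \<open>b2\<close> past \<open>q\<close>; the vector
  \<open>unreord n\<close> agrees with that lift on the length of the context.\<close>

lemma SubEq_unreord: "SubEq S (Id_vec_ctxt (D # \<Lambda>)) (inst (unreord n)) (inst (unreord n)) (Id_fib D \<Lambda> @ \<Xi>)"
proof (rule SubEq_eqI[OF Ctxt_fib])
  show "SubEq S (Id_vec_ctxt (D # \<Lambda>)) (lifts 1 b2) (lifts 1 b2) (Id_fib D \<Lambda> @ \<Xi>)"
    using SubEq_lifts_same[OF SubEq_b2, of "[Q]"] Ctxt_fib by (simp add: Id_fib_eq Id_vec_ctxt_Cons)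
qed (auto simp: length_\<Xi> lifts_eq b2_eq unreord_eq)

definition r2 :: "nat \<Rightarrow> 's exp" where "r2 = inst (vars 2 n @ Var 0 # vars (n + 2) n @ Var 1 # vars (2 * n + 2) n)"

lemma SubEq_r2: "SubEq S (Y' # Y # \<Xi>) r2 r2 X1"
proof -
  let ?G = "Y' # Y # \<Xi>"
  have x: "ElemEq S ?G (vars (2 * n + 2) n) (vars (2 * n + 2) n) \<Lambda>"
    "ElemEq S ?G (vars (n + 2) n) (vars (n + 2) n) \<Lambda>"
    using vars_\<Xi>[of "[Y', Y]" 2] Ctxt_YY by (simp_all add: add.commute)
  have 1: "shift 2 Y = subst (inst (vars (2 * n + 2) n)) D"
    unfolding shift_eq_subst Y_def subst_subst by (rule D_eqI) (auto simp: inst_simps)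
  have 2: "shift 1 Y' = subst (inst (vars (n + 2) n)) D"
    unfolding shift_eq_subst Y'_def subst_subst by (rule D_eqI) (auto simp: inst_simps)
  have v: "TmEq S ?G (Var 1) (Var 1) (subst (inst (vars (2 * n + 2) n)) D)"
     "TmEq S ?G (Var 0) (Var 0) (subst (inst (vars (n + 2) n)) D)"
    using Tm_Var[OF Ctxt_YY, of 1] Tm_Var[OF Ctxt_YY, of 0] 1 2 by (simp_all add: TmEq_refl_iff numeral_2_eq_2)
  let ?y = "Var 1 # vars (2 * n + 2) n" and ?z = "Var 0 # vars (n + 2) n"
  have y: "ElemEq S ?G ?y ?y (D # \<Lambda>)" "ElemEq S ?G ?z ?z (D # \<Lambda>)"
    using x v by auto
  then have yz: "ElemEq S ?G (?z @ ?y) (?z @ ?y) ((D # \<Lambda>) @ (D # \<Lambda>))"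
    using subst_tele_closed_Ctxt[OF Ctxt_D(1), of "inst ?y"]
    by (subst ElemEq_append_iff) (simp_all only: length_Cons length_vars n_def[symmetric] simp_thms)
  have "ElemEq S ?G (vars 2 n) (vars 2 n) (subst_tele (\<lambda>i. Var (i + (2 + n))) (Id_gen \<Lambda>))"
    using ElemEq_vars[of "[Y', Y]" "Id_gen \<Lambda>" "\<Lambda> @ \<Lambda>" 2 n] Ctxt_YY
    by (simp add: \<Xi>_def Id_vec_ctxt_def n_def[symmetric])
  also have "subst_tele (\<lambda>i. Var (i + (2 + n))) (Id_gen \<Lambda>) = subst_tele (inst (?z @ ?y)) P"
    unfolding P_def subst_tele_subst_tele
    by (rule subst_tele_eqI_Ctxt[where \<Gamma> = "\<Lambda> @ \<Lambda>"])
      (use Ctxt_\<Xi> in \<open>auto simp: \<Xi>_def Id_vec_ctxt_def n_def[symmetric] dom_base_def inst_simps\<close>)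
  finally have "ElemEq S ?G (vars 2 n @ ?z @ ?y) (vars 2 n @ ?z @ ?y) X1"
    using yz unfolding X1_def by (subst ElemEq_append_iff) (simp_all add: length_P)
  then show ?thesis
    unfolding r2_def using ElemEq_SubEq by fastforce
qed

lemma r2_b2: "subst r2 (subst b2 Q) = Q"
proof -
  have "subst (\<lambda>i. subst r2 (b2 i)) Q = subst Var Q"
  proof (rule subst_eqI_Ty)
    show "Ty S (Y' # Y # \<Xi>) Q" using Q TyEqD by blast
  qed (auto simp: length_\<Xi> r2_def b2_eq inst_simps)
  then show ?thesis by (simp add: subst_subst)
qed

lemma SubEq_reord: "SubEq S (Id_fib D \<Lambda> @ \<Xi>) (inst (reord n)) (inst (reord n)) (Id_vec_ctxt (D # \<Lambda>))"
proof (rule SubEq_eqI[OF Ctxt_Id_vec_Cons])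
  show "SubEq S (Id_fib D \<Lambda> @ \<Xi>) (lifts 1 r2) (lifts 1 r2) (Id_vec_ctxt (D # \<Lambda>))"
    using SubEq_lifts_same[OF SubEq_r2, of "[subst b2 Q]"] Ctxt_Id_vec_Cons
    by (simp add: Id_fib_eq Id_vec_ctxt_Cons r2_b2)
qed (auto simp: n_def[symmetric] lifts_eq r2_def inst_simps reord_eq)

text \<open>Lifting the diagonal of \<open>\<Lambda>\<close> gives a substitution out of the
  restricted fibre, where \<open>q\<close> compares \<open>y\<close> with the transport of
  \<open>y'\<close> along \<open>r(x)\<close>. Conversion along \<open>fib_\<delta>\<close> replaces
  this by the plain identity type of \<open>D\<close>, so that the diagonal of \<open>D\<close> can
  be composed with it.\<close>

lemma SubEq_fib: "SubEq S (id_ext D \<Lambda>) (lifts 3 \<delta>) (lifts 3 \<delta>') (Id_fib D \<Lambda> @ \<Xi>)"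
  using SubEq_lifts_same[OF SubEq_\<delta> Ctxt_fib] SubEq_ctxt_conv[OF fib_\<delta>] by simp

text \<open>Typed as the composite in \<open>diag1_diag_reord\<close> rather than entry by entry:
  the conversion that makes \<open>(r(x), r(y))\<close> well typed is contained in
  \<open>SubEq_fib\<close>.\<close>

lemma SubEq_diag_Cons: "SubEq S (D # \<Lambda>) (inst (diag (D # \<Lambda>))) (inst (diag (D' # \<Lambda>'))) (Id_vec_ctxt (D # \<Lambda>))"
proof (rule SubEq_eqI[OF Ctxt_Id_vec_Cons])
  show "SubEq S (D # \<Lambda>) (\<lambda>i. subst (inst (diag1 D)) (subst (lifts 3 \<delta>) (inst (reord n) i)))
     (\<lambda>i. subst (inst (diag1 D')) (subst (lifts 3 \<delta>') (inst (reord n) i))) (Id_vec_ctxt (D # \<Lambda>))"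
    by (rule SubEq_comp[OF SubEq_diag1[OF type] SubEq_comp[OF SubEq_fib SubEq_reord]])
qed (simp_all add: n_def[symmetric] \<delta>_def \<delta>'_def diag1_diag_reord length_\<Lambda>')

end

text \<open>The local \<open>dia\<close> of \<open>J_step\<close>, a finite vector. On the variables
  in scope it is the diagonal of \<open>\<Lambda>\<close> lifted under \<open>y, y', q\<close>, and
  typing arguments use the lifted form.\<close>

definition dia :: "'s exp list \<Rightarrow> nat \<Rightarrow> 's exp" where
  "dia \<Lambda> = inst (vars 0 3 @ map (shift 3) (refl_ctxt \<Lambda>) @ vars 3 (length \<Lambda>) @ vars 3 (length \<Lambda>))"

lemma dia_eq: "i < 3 * length \<Lambda> + 3 \<Longrightarrow> dia \<Lambda> i = lifts 3 (inst (diag \<Lambda>)) i"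
  by (auto simp: dia_def lifts_eq inst_append_eq inst_vars_eq diag_eq Let_def inst_eq_nth shift_eq_subst)

lemma J_ctxt_Cons:
  "J_ctxt (D # \<Lambda>) \<Psi> \<Theta> d =
    (let n = length \<Lambda>; m = length \<Psi>;
       \<Psi>' = subst_tele (inst (reord n)) \<Psi>; \<Theta>' = subst_tele (lifts m (inst (reord n))) \<Theta>
     in subst_vec (lifts m (inst (unreord n)))
      (J_ctxt \<Lambda> (\<Psi>' @ Id_fib D \<Lambda>) \<Theta>'
        (J_type D (subst_tele (dia \<Lambda>) \<Psi>') (subst_tele (lifts m (dia \<Lambda>)) \<Theta>') d)))"
  by (simp add: J_step_def Let_def Id_fib_def reord_def unreord_def dia_def)

section \<open>Elimination over \<open>\<Lambda>, D\<close> from elimination over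
  \<open>\<Lambda>\<close> and over \<open>D\<close>\<close>

context elim_step begin

text \<open>The data are reordered by \<open>R\<close>, restricted to the diagonal of
  \<open>\<Lambda>\<close>, eliminated over \<open>D\<close> to \<open>k\<close>, then over
  \<open>\<Lambda>\<close> to \<open>j\<close>, and moved back by \<open>U\<close>. Restriction to
  the diagonal undoes this in turn: \<open>j\<close> becomes \<open>k\<close> and \<open>k\<close>
  becomes \<open>d\<close>, by the two computation rules.\<close>

lemma elim_Cons:
  assumes l: "length \<Psi> = m" "length \<Psi>p = m" "length \<Theta> = length \<Theta>p"
    and C: "CtxtEq S (\<Theta> @ \<Psi> @ Id_vec_ctxt (D # \<Lambda>)) (\<Theta>p @ \<Psi>p @ Id_vec_ctxt (D' # \<Lambda>'))"
    and d: "ElemEq S (subst_tele (inst (diag (D # \<Lambda>))) \<Psi> @ D # \<Lambda>) d d' (subst_tele (lifts m (inst (diag (D # \<Lambda>)))) \<Theta>)"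
  shows "ElemEq S (\<Psi> @ Id_vec_ctxt (D # \<Lambda>)) (J_ctxt (D # \<Lambda>) \<Psi> \<Theta> d) (J_ctxt (D' # \<Lambda>') \<Psi>p \<Theta>p d') \<Theta> \<and>
     ElemEq S (subst_tele (inst (diag (D # \<Lambda>))) \<Psi> @ D # \<Lambda>)
       (subst_vec (lifts m (inst (diag (D # \<Lambda>)))) (J_ctxt (D # \<Lambda>) \<Psi> \<Theta> d)) d (subst_tele (lifts m (inst (diag (D # \<Lambda>)))) \<Theta>)"
proof -
  define R U where "R = (inst (reord n) :: nat \<Rightarrow> 's exp)" and "U = (inst (unreord n) :: nat \<Rightarrow> 's exp)"
  define \<epsilon> where "\<epsilon> = inst (diag1 D)"
  define \<delta>1 where "\<delta>1 = inst (diag (D # \<Lambda>))"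
  define \<Psi>r \<Theta>r where "\<Psi>r = subst_tele R \<Psi>" and "\<Theta>r = subst_tele (lifts m R) \<Theta>"
  define \<Psi>rp \<Theta>rp where "\<Psi>rp = subst_tele R \<Psi>p" and "\<Theta>rp = subst_tele (lifts m R) \<Theta>p"
  let ?I = "Id_vec_ctxt (D # \<Lambda>)" and ?F = "Id_fib D \<Lambda> @ \<Xi>" and ?F' = "Id_fib D' \<Lambda>' @ \<Xi>'"
  have lr: "length \<Psi>r = m" "length \<Psi>rp = m" "length \<Theta>r = length \<Theta>" "length \<Theta>rp = length \<Theta>"
    using l by (auto simp: \<Psi>r_def \<Psi>rp_def \<Theta>r_def \<Theta>rp_def)
  have lI: "length ?I = 3 * n + 3" by (simp add: n_def[symmetric])
  have lF: "length ?F = 3 * n + 3" "length ?F' = 3 * n + 3" by (simp_all add: length_\<Xi> \<Xi>'_def length_\<Lambda>')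
  have l\<Xi>: "length \<Xi>' = 3 * n" by (simp add: \<Xi>'_def length_\<Lambda>')
  have cI: "Ctxt S (\<Theta> @ \<Psi> @ ?I)" "Ctxt S (\<Psi> @ ?I)"
    using CtxtEq_Ctxt1[OF C] Ctxt_appendD by blast+
  have R: "SubEq S ?F R R ?I" and U: "SubEq S ?I U U ?F"
    unfolding R_def U_def by (rule SubEq_reord SubEq_unreord)+
  have Cr: "CtxtEq S (\<Theta>r @ \<Psi>r @ ?F) (\<Theta>rp @ \<Psi>rp @ ?F')"
    using CtxtEq_subst_tele[OF R CtxtEq_fib, of "\<Theta> @ \<Psi>" "\<Theta>p @ \<Psi>p" "Id_vec_ctxt (D' # \<Lambda>')"] C l
    by (simp add: subst_tele_append \<Theta>r_def \<Psi>r_def \<Theta>rp_def \<Psi>rp_def)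
  have cr: "Ctxt S (\<Theta>r @ \<Psi>r @ ?F)" "Ctxt S (\<Psi>r @ ?F)" "Ctxt S (\<Theta>rp @ \<Psi>rp @ ?F')" "Ctxt S (\<Psi>rp @ ?F')"
    using CtxtEq_Ctxt1[OF Cr] CtxtEq_Ctxt2[OF Cr] Ctxt_appendD by blast+
  define \<Psi>d \<Theta>d where "\<Psi>d = subst_tele (lifts 3 \<delta>) \<Psi>r" and "\<Theta>d = subst_tele (lifts m (lifts 3 \<delta>)) \<Theta>r"
  define \<Psi>dp \<Theta>dp where "\<Psi>dp = subst_tele (lifts 3 \<delta>') \<Psi>rp" and "\<Theta>dp = subst_tele (lifts m (lifts 3 \<delta>')) \<Theta>rp"
  have dia: "subst_tele (dia \<Lambda>) \<Psi>r = \<Psi>d" "subst_tele (lifts m (dia \<Lambda>)) \<Theta>r = \<Theta>d"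
    "subst_tele (dia \<Lambda>') \<Psi>rp = \<Psi>dp" "subst_tele (lifts m (dia \<Lambda>')) \<Theta>rp = \<Theta>dp"
  proof -
    show "subst_tele (dia \<Lambda>) \<Psi>r = \<Psi>d" unfolding \<Psi>d_def
      by (rule subst_tele_eqI_Ctxt[OF cr(2)]) (simp add: length_\<Xi> dia_eq \<delta>_def n_def)
    show "subst_tele (lifts m (dia \<Lambda>)) \<Theta>r = \<Theta>d" unfolding \<Theta>d_def
      by (rule subst_tele_eqI_Ctxt[OF cr(1)]) (auto simp: lr length_\<Xi> dia_eq \<delta>_def n_def lifts_eq[of m])
    show "subst_tele (dia \<Lambda>') \<Psi>rp = \<Psi>dp" unfolding \<Psi>dp_def
      by (rule subst_tele_eqI_Ctxt[OF cr(4)]) (simp add: l\<Xi> dia_eq \<delta>'_def length_\<Lambda>')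
    show "subst_tele (lifts m (dia \<Lambda>')) \<Theta>rp = \<Theta>dp" unfolding \<Theta>dp_def
      by (rule subst_tele_eqI_Ctxt[OF cr(3)]) (auto simp: lr l\<Xi> dia_eq \<delta>'_def length_\<Lambda>' lifts_eq[of m])
  qed
  have Cd: "CtxtEq S (\<Theta>d @ \<Psi>d @ id_ext D \<Lambda>) (\<Theta>dp @ \<Psi>dp @ id_ext D' \<Lambda>)"
    using CtxtEq_subst_tele[OF SubEq_fib CtxtEq_id_ext[OF type], of "\<Theta>r @ \<Psi>r" "\<Theta>rp @ \<Psi>rp" ?F'] Cr lr
    by (simp add: subst_tele_append \<Psi>d_def \<Theta>d_def \<Psi>dp_def \<Theta>dp_def)
  have \<delta>1: "subst \<epsilon> (subst (lifts 3 \<delta>) (R i)) = \<delta>1 i" if "i < 3 * n + 3" for i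
    using that by (simp add: R_def \<epsilon>_def \<delta>_def \<delta>1_def diag1_diag_reord n_def)
  have e1: "subst_tele \<epsilon> \<Psi>d = subst_tele \<delta>1 \<Psi>"
    unfolding \<Psi>d_def \<Psi>r_def subst_tele_subst_tele
    by (rule subst_tele_eqI_Ctxt[OF cI(2)], unfold lI) (simp add: \<delta>1 flip: subst_subst)
  have e2: "subst_tele (lifts m \<epsilon>) \<Theta>d = subst_tele (lifts m \<delta>1) \<Theta>"
  proof -
    have "subst_tele (lifts m \<epsilon>) \<Theta>d = subst_tele (lifts m (\<lambda>i. subst \<epsilon> (subst (lifts 3 \<delta>) (R i)))) \<Theta>"
    proof -
      have "subst (lifts m \<sigma>) (lifts m \<tau> i) = lifts m (\<lambda>i. subst \<sigma> (\<tau> i)) i" for i and \<sigma> \<tau> :: "nat \<Rightarrow> 's exp"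
        by (auto simp: lifts_eq subst_subst)
      then show ?thesis unfolding \<Theta>d_def \<Theta>r_def subst_tele_subst_tele
        by (intro subst_tele_cong) (simp only:)
    qed
    also have "\<dots> = subst_tele (lifts m \<delta>1) \<Theta>"
      by (rule subst_tele_eqI_Ctxt[OF cI(1)]) (use l in \<open>auto simp: lifts_eq[of m] \<delta>1 n_def[symmetric]\<close>)
    finally show ?thesis .
  qed
  \<comment> \<open>The factorisation of the diagonal has turned the given typing of
    \<open>d\<close> into the premise of elimination over \<open>D\<close>.\<close>
  have d0: "ElemEq S (subst_tele \<epsilon> \<Psi>d @ D # \<Lambda>) d d' (subst_tele (lifts m \<epsilon>) \<Theta>d)"
    using d unfolding e1 e2 \<delta>1_def .
  have ld: "length \<Psi>d = m" "length \<Psi>dp = m" "length \<Theta>d = length \<Theta>dp"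
    using lr by (auto simp: \<Psi>d_def \<Psi>dp_def \<Theta>d_def \<Theta>dp_def)
  define k kp where "k = J_type D \<Psi>d \<Theta>d d" and "kp = J_type D' \<Psi>dp \<Theta>dp d'"
  have k: "ElemEq S (\<Psi>d @ id_ext D \<Lambda>) k kp \<Theta>d"
    and kc: "ElemEq S (subst_tele \<epsilon> \<Psi>d @ D # \<Lambda>) (subst_vec (lifts m \<epsilon>) k) d (subst_tele (lifts m \<epsilon>) \<Theta>d)"
    using J_type_cong_comp[OF _ ld(3) Cd, of d d'] d0 by (simp_all add: ld \<epsilon>_def k_def kp_def)
  have cd: "Ctxt S (\<Psi>d @ id_ext D \<Lambda>)" using ElemEq_Ctxt[OF k] .
  \<comment> \<open>\<open>k\<close> lives over the plain identity type of \<open>D\<close>, but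
    elimination over \<open>\<Lambda>\<close> asks for a method over the restricted fibre, where
    \<open>y'\<close> is transported along \<open>r(x)\<close>; \<open>fib_\<delta>\<close> bridges
    the two.\<close>
  have conv: "CtxtEq S (\<Psi>d @ id_ext D \<Lambda>) (\<Psi>d @ subst_tele \<delta> (Id_fib D \<Lambda>) @ \<Lambda>)"
    using CtxtEq_subst_tele[OF SubEq_refl1[OF Ctxt_fib SubEq_fib] CtxtEq_sym[OF fib_\<delta>], of \<Psi>r \<Psi>r ?F] cr(2)
    by (simp add: \<Psi>d_def CtxtEq_refl_iff)
  have k': "ElemEq S (\<Psi>d @ subst_tele \<delta> (Id_fib D \<Lambda>) @ \<Lambda>) k kp \<Theta>d"
    using ElemEq_ctxt_conv[OF conv k] .
  define j jp where "j = J_ctxt \<Lambda> (\<Psi>r @ Id_fib D \<Lambda>) \<Theta>r k" and "jp = J_ctxt \<Lambda>' (\<Psi>rp @ Id_fib D' \<Lambda>') \<Theta>rp kp"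
  have ee: "subst_tele \<delta> (\<Psi>r @ Id_fib D \<Lambda>) @ \<Lambda> = \<Psi>d @ subst_tele \<delta> (Id_fib D \<Lambda>) @ \<Lambda>"
    "subst_tele (lifts (m + 3) \<delta>) \<Theta>r = \<Theta>d"
    by (simp_all add: subst_tele_append \<Psi>d_def \<Theta>d_def lifts_lifts)
  have j: "ElemEq S (\<Psi>r @ ?F) j jp \<Theta>r"
    and jc: "ElemEq S (\<Psi>d @ subst_tele \<delta> (Id_fib D \<Lambda>) @ \<Lambda>) (subst_vec (lifts (m + 3) \<delta>) j) k \<Theta>d"
    using elim[of \<Theta>r "\<Psi>r @ Id_fib D \<Lambda>" \<Theta>rp "\<Psi>rp @ Id_fib D' \<Lambda>'" "m + 3" k kp] Cr lr k'
    unfolding ee j_def jp_def by simp_all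
  have J: "J_ctxt (D # \<Lambda>) \<Psi> \<Theta> d = subst_vec (lifts m U) j" "J_ctxt (D' # \<Lambda>') \<Psi>p \<Theta>p d' = subst_vec (lifts m U) jp"
    unfolding J_ctxt_Cons Let_def l length_\<Lambda>' n_def[symmetric] R_def[symmetric] U_def[symmetric]
      \<Psi>r_def[symmetric] \<Theta>r_def[symmetric] \<Psi>rp_def[symmetric] \<Theta>rp_def[symmetric] dia k_def[symmetric] kp_def[symmetric]
      j_def jp_def by (rule refl)+
  have UR: "subst U (R i) = Var i" if "i < 3 * n + 3" for i
    using that by (simp add: R_def U_def unreord_reord)
  have u1: "subst_tele U \<Psi>r = \<Psi>"
  proof -
    have "subst_tele (\<lambda>i. subst U (R i)) \<Psi> = subst_tele Var \<Psi>"
      by (rule subst_tele_eqI_Ctxt[OF cI(2)]) (simp add: n_def[symmetric] UR)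
    then show ?thesis by (simp add: \<Psi>r_def subst_tele_subst_tele)
  qed
  have u2: "subst_tele (lifts m U) \<Theta>r = \<Theta>"
  proof -
    have "subst_tele (\<lambda>i. subst (lifts m U) (lifts m R i)) \<Theta> = subst_tele Var \<Theta>"
    proof (rule subst_tele_eqI_Ctxt[OF cI(1)])
      fix i assume "i < length (\<Psi> @ Id_vec_ctxt (D # \<Lambda>))"
      then have i: "i < m + (3 * n + 3)" using l by (simp add: n_def)
      have "subst (lifts m U) (lifts m R i) = lifts m (\<lambda>i. subst U (R i)) i"
        by (auto simp: lifts_eq subst_subst)
      also have "\<dots> = Var i" using i by (auto simp: lifts_eq UR)
      finally show "subst (lifts m U) (lifts m R i) = Var i" .
    qed
    then show ?thesis by (simp add: \<Theta>r_def subst_tele_subst_tele)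
  qed
  have U': "SubEq S (\<Psi> @ ?I) (lifts m U) (lifts m U) (\<Psi>r @ ?F)"
    using SubEq_lifts_same[OF U cr(2)] by (simp add: u1 lr)
  have "ElemEq S (\<Psi> @ ?I) (subst_vec (lifts m U) j) (subst_vec (lifts m U) jp) \<Theta>"
    using ElemEq_SubEq_subst[OF U' j] by (simp add: u2)
  moreover have "ElemEq S (subst_tele \<delta>1 \<Psi> @ D # \<Lambda>) (subst_vec (lifts m \<delta>1) (subst_vec (lifts m U) j)) d (subst_tele (lifts m \<delta>1) \<Theta>)"
  proof -
    have jc': "ElemEq S (\<Psi>d @ id_ext D \<Lambda>) (subst_vec (lifts (m + 3) \<delta>) j) k \<Theta>d"
      using ElemEq_ctxt_conv[OF CtxtEq_sym[OF conv] jc] .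
    have \<epsilon>: "SubEq S (subst_tele \<epsilon> \<Psi>d @ D # \<Lambda>) (lifts m \<epsilon>) (lifts m \<epsilon>) (\<Psi>d @ id_ext D \<Lambda>)"
      using SubEq_lifts_same[OF SubEq_diag1[OF TyEq_refl[OF Ty_D(1)]] cd] by (simp add: \<epsilon>_def ld)
    have 1: "ElemEq S (subst_tele \<epsilon> \<Psi>d @ D # \<Lambda>) (subst_vec (lifts m \<epsilon>) (subst_vec (lifts (m + 3) \<delta>) j))
        (subst_vec (lifts m \<epsilon>) k) (subst_tele (lifts m \<epsilon>) \<Theta>d)"
      using ElemEq_SubEq_subst[OF \<epsilon> jc'] .
    have "Ctxt S (\<Theta>d @ \<Psi>d @ id_ext D \<Lambda>)" using CtxtEq_Ctxt1[OF Cd] .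
    then have "Ctxt S (subst_tele (lifts m \<epsilon>) \<Theta>d @ subst_tele \<epsilon> \<Psi>d @ D # \<Lambda>)"
      using Ctxt_subst_tele[OF \<epsilon>] by simp
    from ElemEq_trans[OF this 1 kc]
    have 2: "ElemEq S (subst_tele \<delta>1 \<Psi> @ D # \<Lambda>) (subst_vec (lifts m \<epsilon>) (subst_vec (lifts (m + 3) \<delta>) j)) d (subst_tele (lifts m \<delta>1) \<Theta>)"
      unfolding e1 e2 .
    \<comment> \<open>Restricting the reordered result in two stages is the same as moving it back
      by \<open>U\<close> and restricting to the whole diagonal at once.\<close>
    have "subst_vec (lifts m \<epsilon>) (subst_vec (lifts (m + 3) \<delta>) j) = subst_vec (lifts m \<delta>1) (subst_vec (lifts m U) j)"
      unfolding subst_vec_subst_vec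
    proof (rule subst_vec_eqI_Elem[OF ElemEq_Elem[OF j]])
      fix i assume "i < length (\<Psi>r @ Id_fib D \<Lambda> @ \<Xi>)"
      then have i: "i < m + (3 * n + 3)" using lr length_\<Xi> by simp
      have "subst (lifts m \<epsilon>) (lifts (m + 3) \<delta> i) = lifts m (\<lambda>i. subst \<epsilon> (lifts 3 \<delta> i)) i"
        unfolding lifts_lifts[symmetric] by (auto simp: lifts_eq[of m] subst_subst)
      also have "\<dots> = lifts m (\<lambda>i. subst \<delta>1 (U i)) i"
        using i diag_unreord[of "i - m" n \<Lambda> D] by (auto simp: lifts_eq[of m] \<epsilon>_def \<delta>_def \<delta>1_def U_def n_def)
      also have "\<dots> = subst (lifts m \<delta>1) (lifts m U i)"
        by (auto simp: lifts_eq[of m] subst_subst)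
      finally show "subst (lifts m \<epsilon>) (lifts (m + 3) \<delta> i) = subst (lifts m \<delta>1) (lifts m U i)" .
    qed
    then show ?thesis using 2 by simp
  qed
  ultimately show ?thesis unfolding J \<delta>1_def by blast
qed

lemma elim_good_Cons: "elim_good (D # \<Lambda>) (D' # \<Lambda>')"
  unfolding elim_good_def
proof (intro conjI allI impI CtxtEq_Id_vec_Cons SubEq_diag_Cons, goal_cases)
  case (1 \<Psi> \<Psi>' \<Theta> \<Theta>' d d')
  show ?case by (rule elim_Cons[THEN conjunct1, OF refl 1(1)[symmetric] 1(2-4)])
next
  case (2 \<Psi> \<Psi>' \<Theta> \<Theta>' d d')
  show ?case by (rule elim_Cons[THEN conjunct2, OF refl 2(1)[symmetric] 2(2-4)])
qed

end

context identity_types begin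

theorem elim_good: "CtxtEq S \<Phi> \<Phi>' \<Longrightarrow> elim_good \<Phi> \<Phi>'"
proof (induction rule: CtxtEq_induct)
  case Nil
  show ?case by (rule elim_good_Nil)
next
  case (Cons D \<Lambda> D' \<Lambda>')
  then interpret elim_step S D D' \<Lambda> \<Lambda>' by unfold_locales
  show ?case by (rule elim_good_Cons)
qed

end

section \<open>Uniqueness of elements of identity contexts\<close>

lemma Id_over_is_Id: "\<exists>A a b. Id_over n JL D x x' p y y' = Id_type A a b"
  by (auto simp: Id_over_def)

text \<open>Discreteness speaks of identity types only, so uniqueness of vectors is available for
  telescopes all of whose entries have this form; identity contexts qualify.\<close>

definition Id_types :: "'s exp list \<Rightarrow> bool" where
  "Id_types \<Theta> \<longleftrightarrow> (\<forall>D \<in> set \<Theta>. \<exists>A a b. D = Id_type A a b)"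

lemma Id_types_subst_tele: "Id_types \<Theta> \<Longrightarrow> Id_types (subst_tele \<sigma> \<Theta>)"
  by (induction \<Theta>) (fastforce simp: Id_types_def)+

lemma Id_types_Id_gen: "Id_types (Id_gen \<Phi>)"
proof (induction \<Phi>)
  case (Cons D \<Phi>)
  then have "Id_types (subst_tele \<sigma> (Id_gen \<Phi>))" for \<sigma> by (rule Id_types_subst_tele)
  then show ?case by (simp add: Id_types_def Let_def Id_over_is_Id)
qed (simp add: Id_types_def)

lemma Id_types_Id_ctxt: "Id_types (Id_ctxt \<Phi> a b)"
  unfolding Id_ctxt_def by (rule Id_types_subst_tele[OF Id_types_Id_gen])

lemma length_Id_ctxt [simp]: "length (Id_ctxt \<Phi> a b) = length \<Phi>"
  by (simp add: Id_ctxt_def)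

lemma length_vec_at [simp]: "length (vec_at g f) = length g"
  by (simp add: vec_at_def)

context identity_types begin

lemma CtxtEq_Id_vec: "CtxtEq S \<Phi> \<Phi>' \<Longrightarrow> CtxtEq S (Id_vec_ctxt \<Phi>) (Id_vec_ctxt \<Phi>')"
  and SubEq_diag: "CtxtEq S \<Phi> \<Phi>' \<Longrightarrow> SubEq S \<Phi> (inst (diag \<Phi>)) (inst (diag \<Phi>')) (Id_vec_ctxt \<Phi>)"
  using elim_good by (auto simp: elim_good_def)

lemma J_ctxt_cong_comp:
  assumes "CtxtEq S \<Phi> \<Phi>'" "length \<Theta> = length \<Theta>'"
    "CtxtEq S (\<Theta> @ Id_vec_ctxt \<Phi>) (\<Theta>' @ Id_vec_ctxt \<Phi>')"
    "ElemEq S \<Phi> d d' (subst_tele (inst (diag \<Phi>)) \<Theta>)"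
  shows "ElemEq S (Id_vec_ctxt \<Phi>) (J_ctxt \<Phi> [] \<Theta> d) (J_ctxt \<Phi>' [] \<Theta>' d') \<Theta>"
    "ElemEq S \<Phi> (subst_vec (inst (diag \<Phi>)) (J_ctxt \<Phi> [] \<Theta> d)) d (subst_tele (inst (diag \<Phi>)) \<Theta>)"
  using elim_good[OF assms(1), unfolded elim_good_def, THEN conjunct2, THEN conjunct2, rule_format,
      of "[]" "[]" \<Theta> \<Theta>' d d'] assms by simp_all

lemma ElemEq_append_closed:
  assumes "ElemEq S \<Gamma> b b' \<Phi>" "ElemEq S \<Gamma> a a' \<Phi>'" "Ctxt S \<Phi>"
  shows "ElemEq S \<Gamma> (b @ a) (b' @ a') (\<Phi> @ \<Phi>')"
  using assms ElemEq_length[OF assms(1)]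
  by (subst ElemEq_append_iff) (auto simp: subst_tele_closed_Ctxt)

lemma CtxtEq_Id_ctxt:
  assumes "ElemEq S \<Gamma> a a' \<Phi>" "ElemEq S \<Gamma> b b' \<Phi>" "CtxtEq S \<Phi> \<Phi>'" "CtxtEq S \<Gamma> \<Gamma>'"
  shows "CtxtEq S (Id_ctxt \<Phi> a b @ \<Gamma>) (Id_ctxt \<Phi>' a' b' @ \<Gamma>')"
proof -
  have "ElemEq S \<Gamma> (b @ a) (b' @ a') (\<Phi> @ \<Phi>)"
    using ElemEq_append_closed assms CtxtEq_Ctxt1 by blast
  then show ?thesis
    unfolding Id_ctxt_def
    using CtxtEq_subst_tele[OF ElemEq_SubEq assms(4), of "b @ a" "b' @ a'" "\<Phi> @ \<Phi>" "Id_gen \<Phi>" "Id_gen \<Phi>'" "\<Phi>' @ \<Phi>'"]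
      CtxtEq_Id_vec[OF assms(3)] CtxtEq_length[OF assms(3)] by (simp add: Id_vec_ctxt_def)
qed

lemma Ctxt_Id_vec: "Ctxt S \<Phi> \<Longrightarrow> Ctxt S (Id_gen \<Phi> @ \<Phi> @ \<Phi>)"
  using CtxtEq_Id_vec CtxtEq_Ctxt1 CtxtEq_refl_iff unfolding Id_vec_ctxt_def by blast

lemma Id_gen_eqI:
  assumes "Ctxt S \<Phi>" "\<And>i. i < 2 * length \<Phi> \<Longrightarrow> \<sigma> i = \<tau> i"
  shows "subst_tele \<sigma> (Id_gen \<Phi>) = subst_tele \<tau> (Id_gen \<Phi>)"
  by (rule subst_tele_eqI_Ctxt[OF Ctxt_Id_vec[OF assms(1)]]) (simp add: assms)

lemma subst_tele_Id_ctxt: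
  assumes "Ctxt S \<Phi>" "length a = length \<Phi>" "length b = length \<Phi>"
  shows "subst_tele \<sigma> (Id_ctxt \<Phi> a b) = Id_ctxt \<Phi> (subst_vec \<sigma> a) (subst_vec \<sigma> b)"
  unfolding Id_ctxt_def subst_tele_subst_tele
  by (rule Id_gen_eqI[OF assms(1)]) (simp add: inst_append inst_eq_nth assms)

lemma SubEq_Id_vec:
  assumes "ElemEq S \<Gamma> f f' \<Phi>" "ElemEq S \<Gamma> g g' \<Phi>" "ElemEq S \<Gamma> \<alpha> \<alpha>' (Id_ctxt \<Phi> f g)" "Ctxt S \<Phi>"
  shows "SubEq S \<Gamma> (inst (\<alpha> @ g @ f)) (inst (\<alpha>' @ g' @ f')) (Id_vec_ctxt \<Phi>)"
proof -
  have "ElemEq S \<Gamma> (\<alpha> @ g @ f) (\<alpha>' @ g' @ f') (Id_vec_ctxt \<Phi>)"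
    unfolding Id_vec_ctxt_def
    using ElemEq_append_closed[OF assms(2,1,4)] assms(3) ElemEq_length[OF assms(3)]
    by (subst ElemEq_append_iff) (auto simp: Id_ctxt_def)
  then show ?thesis by (rule ElemEq_SubEq)
qed

lemma ElemEq_vec_at:
  assumes "ElemEq S \<Gamma> f f' \<Delta>" "ElemEq S \<Delta> g g' \<Theta>"
  shows "ElemEq S \<Gamma> (vec_at g f) (vec_at g' f') (subst_tele (inst f) \<Theta>)"
  using ElemEq_SubEq_subst[OF ElemEq_SubEq[OF assms(1)] assms(2)] by (simp add: vec_at_def)

lemma ElemEq_vec_at_closed:
  assumes "ElemEq S \<Gamma> f f' \<Delta>" "ElemEq S \<Delta> g g' \<Theta>" "Ctxt S \<Theta>"
  shows "ElemEq S \<Gamma> (vec_at g f) (vec_at g' f') \<Theta>"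
  using ElemEq_vec_at[OF assms(1,2)] subst_tele_closed_Ctxt[OF assms(3)] by simp

lemma vec_at_vars: "length f = n \<Longrightarrow> vec_at (vars 0 n) f = f"
  by (rule nth_equalityI) (auto simp: vec_at_def inst_eq_nth)

text \<open>Read off from the typing of the diagonal, whose first block is
  \<open>refl_ctxt\<close>.\<close>

lemma refl_ctxt_cong:
  assumes "CtxtEq S \<Phi> \<Phi>'"
  shows "ElemEq S \<Phi> (refl_ctxt \<Phi>) (refl_ctxt \<Phi>') (Id_ctxt \<Phi> (vars 0 (length \<Phi>)) (vars 0 (length \<Phi>)))"
proof -
  let ?n = "length \<Phi>"
  have l: "length \<Phi>' = ?n" using CtxtEq_length[OF assms] by simp
  have "ElemEq S \<Phi> (diag \<Phi>) (diag \<Phi>') (Id_vec_ctxt \<Phi>)"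
    using SubEq_diag[OF assms] l by (subst ElemEq_iff_SubEq) auto
  then show ?thesis
    unfolding diag_def Id_vec_ctxt_def by (subst (asm) ElemEq_append_iff) (auto simp: l Id_ctxt_def)
qed

lemma refl_at_cong:
  assumes "CtxtEq S \<Phi> \<Phi>'" "ElemEq S \<Gamma> f f' \<Phi>"
  shows "ElemEq S \<Gamma> (vec_at (refl_ctxt \<Phi>) f) (vec_at (refl_ctxt \<Phi>') f') (Id_ctxt \<Phi> f f)"
proof -
  have l: "length f = length \<Phi>" using ElemEq_length[OF assms(2)] by simp
  then have "subst_vec (inst f) (vars 0 (length \<Phi>)) = f" using vec_at_vars[of f] by (simp add: vec_at_def)
  then show ?thesis
    using ElemEq_vec_at[OF assms(2) refl_ctxt_cong[OF assms(1)]] CtxtEq_Ctxt1[OF assms(1)]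
    by (simp add: subst_tele_Id_ctxt l)
qed

lemma vars_Id_vec:
  assumes "Ctxt S \<Phi>" "n = length \<Phi>"
  shows "ElemEq S (Id_vec_ctxt \<Phi>) (vars n n) (vars n n) \<Phi>"
    "ElemEq S (Id_vec_ctxt \<Phi>) (vars (2 * n) n) (vars (2 * n) n) \<Phi>"
proof -
  have c: "Ctxt S (Id_gen \<Phi> @ \<Phi> @ \<Phi>)" "Ctxt S ((Id_gen \<Phi> @ \<Phi>) @ \<Phi> @ [])"
    using Ctxt_Id_vec[OF assms(1)] by simp_all
  show "ElemEq S (Id_vec_ctxt \<Phi>) (vars n n) (vars n n) \<Phi>"
    using ElemEq_vars_closed[OF c(1) _ _ assms(1)] assms(2) by (simp add: Id_vec_ctxt_def)
  show "ElemEq S (Id_vec_ctxt \<Phi>) (vars (2 * n) n) (vars (2 * n) n) \<Phi>"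
    using ElemEq_vars_closed[OF c(2) _ _ assms(1)] assms(2) by (simp add: Id_vec_ctxt_def)
qed

text \<open>Over the diagonal both endpoint vectors restrict to \<open>h\<close>, so reflexivity at
  \<open>h\<close> is an admissible method. The second claim says that reflexivity at
  \<open>x\<close> is sent to reflexivity at \<open>h(x)\<close>.\<close>

lemma ap_gen:
  assumes "CtxtEq S \<Gamma> \<Gamma>'" "CtxtEq S \<Delta> \<Delta>'" "ElemEq S \<Gamma> h h' \<Delta>" "n = length \<Gamma>"
  shows "ElemEq S (Id_vec_ctxt \<Gamma>) (ap_gen \<Gamma> h \<Delta>) (ap_gen \<Gamma>' h' \<Delta>')
      (Id_ctxt \<Delta> (vec_at h (vars (2 * n) n)) (vec_at h (vars n n)))"
    "ElemEq S \<Gamma> (subst_vec (inst (diag \<Gamma>)) (ap_gen \<Gamma> h \<Delta>)) (vec_at (refl_ctxt \<Delta>) h) (Id_ctxt \<Delta> h h)"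
proof -
  have l: "length \<Gamma>' = n" using CtxtEq_length[OF assms(1)] assms(4) by simp
  have c: "Ctxt S \<Gamma>" "Ctxt S \<Delta>" using assms CtxtEq_Ctxt1 by blast+
  let ?\<Theta> = "Id_ctxt \<Delta> (vec_at h (vars (2 * n) n)) (vec_at h (vars n n))"
  let ?\<Theta>' = "Id_ctxt \<Delta>' (vec_at h' (vars (2 * n) n)) (vec_at h' (vars n n))"
  have C: "CtxtEq S (?\<Theta> @ Id_vec_ctxt \<Gamma>) (?\<Theta>' @ Id_vec_ctxt \<Gamma>')"
    by (intro CtxtEq_Id_ctxt ElemEq_vec_at_closed[OF _ assms(3)] vars_Id_vec assms CtxtEq_Id_vec c)
  have h: "Elem S \<Gamma> h \<Delta>" "length h = length \<Delta>" using ElemEq_Elem[OF assms(3)] ElemEq_length[OF assms(3)] by auto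
  have 1: "subst_vec (inst (diag \<Gamma>)) (vec_at h (vars n n)) = subst_vec Var h"
    unfolding vec_at_def subst_vec_subst_vec
    by (rule subst_vec_eqI_Elem[OF h(1)]) (use assms(4) in \<open>simp add: inst_vars diag_eq Let_def\<close>)
  have 2: "subst_vec (inst (diag \<Gamma>)) (vec_at h (vars (2 * n) n)) = subst_vec Var h"
    unfolding vec_at_def subst_vec_subst_vec
    by (rule subst_vec_eqI_Elem[OF h(1)]) (use assms(4) in \<open>simp add: inst_vars diag_eq Let_def\<close>)
  have \<Theta>: "subst_tele (inst (diag \<Gamma>)) ?\<Theta> = Id_ctxt \<Delta> h h"
    using 1 2 c h by (simp add: subst_tele_Id_ctxt)
  have d: "ElemEq S \<Gamma> (vec_at (refl_ctxt \<Delta>) h) (vec_at (refl_ctxt \<Delta>') h') (subst_tele (inst (diag \<Gamma>)) ?\<Theta>)"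
    unfolding \<Theta> by (rule refl_at_cong[OF assms(2,3)])
  have l\<Theta>: "length ?\<Theta> = length ?\<Theta>'" using CtxtEq_length[OF assms(2)] by simp
  have a: "ap_gen \<Gamma> h \<Delta> = J_ctxt \<Gamma> [] ?\<Theta> (vec_at (refl_ctxt \<Delta>) h)"
    "ap_gen \<Gamma>' h' \<Delta>' = J_ctxt \<Gamma>' [] ?\<Theta>' (vec_at (refl_ctxt \<Delta>') h')"
    unfolding ap_gen_def Let_def l assms(4)[symmetric] by (rule refl)+
  show "ElemEq S (Id_vec_ctxt \<Gamma>) (ap_gen \<Gamma> h \<Delta>) (ap_gen \<Gamma>' h' \<Delta>') ?\<Theta>"
    "ElemEq S \<Gamma> (subst_vec (inst (diag \<Gamma>)) (ap_gen \<Gamma> h \<Delta>)) (vec_at (refl_ctxt \<Delta>) h) (Id_ctxt \<Delta> h h)"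
    using J_ctxt_cong_comp[OF assms(1) l\<Theta> C d] unfolding \<Theta> a by auto
qed

end

context discrete_identity_types begin

text \<open>Eliminate into \<open>Id\<^bsub>Id(a, b)\<^esub>(t, u)\<close>, where reflexivity gives the required element over the diagonal,
  and apply discreteness.\<close>

lemma Id_term_unique:
  assumes "Ctxt S \<Phi>" "Tm S (Id_vec_ctxt \<Phi>) t (Id_type A a b)" "Tm S (Id_vec_ctxt \<Phi>) u (Id_type A a b)"
    "TmEq S \<Phi> (subst (inst (diag \<Phi>)) t) (subst (inst (diag \<Phi>)) u) (subst (inst (diag \<Phi>)) (Id_type A a b))"
  shows "TmEq S (Id_vec_ctxt \<Phi>) t u (Id_type A a b)"
proof -
  let ?E = "Id_type A a b" and ?\<delta> = "inst (diag \<Phi>)"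
  let ?F = "Id_type ?E t u"
  have F: "Ty S (Id_vec_ctxt \<Phi>) ?F" using Id_form assms by blast
  then have c: "CtxtEq S ([?F] @ Id_vec_ctxt \<Phi>) ([?F] @ Id_vec_ctxt \<Phi>)"
    using Ty_Ctxt by (simp add: CtxtEq_refl_iff TyEq_refl_iff)
  have t: "TmEq S \<Phi> (subst ?\<delta> t) (subst ?\<delta> t) (subst ?\<delta> ?E)"
    using TmEqD(1)[OF assms(4)] TmEq_refl by blast
  have E: "TyEq S \<Phi> (subst ?\<delta> ?E) (subst ?\<delta> ?E)"
    using TmEq_Ty[OF t] TyEq_refl by blast
  have "Tm S \<Phi> (Refl (subst ?\<delta> ?E) (subst ?\<delta> t)) (subst ?\<delta> ?F)"
    using Tm_conv[OF Id_intro[OF TmEqD(1)[OF t]] Id_cong[OF E t assms(4)]] by simp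
  then have d: "ElemEq S \<Phi> [Refl (subst ?\<delta> ?E) (subst ?\<delta> t)] [Refl (subst ?\<delta> ?E) (subst ?\<delta> t)] (subst_tele ?\<delta> [?F])"
    using assms(1) by (simp add: TmEq_refl_iff)
  have P: "CtxtEq S \<Phi> \<Phi>" using assms(1) CtxtEq_refl_iff by blast
  note e = J_ctxt_cong_comp(1)[OF P refl c d]
  then obtain \<alpha> where "J_ctxt \<Phi> [] [?F] [Refl (subst ?\<delta> ?E) (subst ?\<delta> t)] = [\<alpha>]"
    using ElemEq_length[OF e] by (auto simp: length_Suc_conv simp del: J_ctxt.simps)
  with e have "Tm S (Id_vec_ctxt \<Phi>) \<alpha> ?F" by (simp add: TmEq_refl_iff del: J_ctxt.simps)
  then show ?thesis using Id_discrete assms by blast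
qed

text \<open>Entry by entry. The last entries \<open>t\<close> and \<open>u\<close> are typed over
  different earlier vectors; the induction hypothesis identifies these, so \<open>u\<close> can be
  converted to the type of \<open>t\<close> before discreteness is applied.\<close>

lemma Id_types_unique:
  assumes "Ctxt S \<Phi>"
  shows "Id_types \<Theta> \<Longrightarrow> Ctxt S (\<Theta> @ Id_vec_ctxt \<Phi>) \<Longrightarrow> Elem S (Id_vec_ctxt \<Phi>) ts \<Theta> \<Longrightarrow> Elem S (Id_vec_ctxt \<Phi>) us \<Theta> \<Longrightarrow>
    ElemEq S \<Phi> (subst_vec (inst (diag \<Phi>)) ts) (subst_vec (inst (diag \<Phi>)) us) (subst_tele (inst (diag \<Phi>)) \<Theta>) \<Longrightarrow>
    ElemEq S (Id_vec_ctxt \<Phi>) ts us \<Theta>"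
proof (induction \<Theta> arbitrary: ts us)
  case Nil
  then show ?case using Elem_length[OF Nil(3)] Elem_length[OF Nil(4)] by simp
next
  case (Cons D \<Theta>)
  let ?X = "Id_vec_ctxt \<Phi>" and ?\<delta> = "inst (diag \<Phi>)"
  obtain t ts' u us' where [simp]: "ts = t # ts'" "us = u # us'"
    using Elem_length[OF Cons.prems(3)] Elem_length[OF Cons.prems(4)] by (auto simp: length_Suc_conv)
  have l: "length ts' = length \<Theta>" using Elem_length[OF Cons.prems(3)] by simp
  have IH: "ElemEq S ?X ts' us' \<Theta>"
    by (rule Cons.IH) (use Cons.prems in \<open>auto simp: Id_types_def\<close>)
  have D: "TyEq S (\<Theta> @ ?X) D D" using Cons.prems(2) TyEq_refl by simp
  have u: "Tm S ?X u (subst (inst ts') D)"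
    using Tm_conv[OF _ TyEq_sym[OF TyEq_SubEq[OF SubEq_inst[OF IH] D]], of u] Cons.prems(4) by simp
  have t: "Tm S ?X t (subst (inst ts') D)" using Cons.prems(3) by simp
  obtain A a b where A: "D = Id_type A a b" using Cons.prems(1) by (auto simp: Id_types_def)
  have tu: "TmEq S \<Phi> (subst ?\<delta> t) (subst ?\<delta> u) (subst ?\<delta> (subst (inst ts') D))"
    using Cons.prems(5) by (simp add: subst_inst_vec l)
  have "TmEq S ?X t u (subst (inst ts') D)"
    using Id_term_unique[OF assms] t u tu unfolding A by simp
  then show ?case using IH by simp
qed

end

section \<open>Lifting along the dependent projection\<close>

definition transport_at :: "'s exp \<Rightarrow> 's exp list \<Rightarrow> 's exp list \<Rightarrow> 's exp list \<Rightarrow> 's exp list \<Rightarrow> 's exp \<Rightarrow> 's exp" where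
  "transport_at B \<Delta> f \<alpha> g b = subst (inst (b # \<alpha> @ g @ f)) (transp_term B \<Delta>)"

definition lift_cell :: "'s exp \<Rightarrow> 's exp list \<Rightarrow> 's exp list \<Rightarrow> 's exp list \<Rightarrow> 's exp list \<Rightarrow> 's exp \<Rightarrow> 's exp list" where
  "lift_cell B \<Delta> f \<alpha> g b = Refl (subst (inst f) B) (transport_at B \<Delta> f \<alpha> g b) # \<alpha>"

text \<open>Two definitionally equal lifting problems over the same \<Gamma>; with equal halves it
  states that a single problem is well typed.\<close>

definition lift_data :: "'s judgements \<Rightarrow> 's exp \<Rightarrow> 's exp list \<Rightarrow> 's exp list \<Rightarrow> 's exp list \<Rightarrow> 's exp list \<Rightarrow> 's exp list \<Rightarrow> 's exp
    \<Rightarrow> 's exp list \<Rightarrow> 's exp list \<Rightarrow> 's exp list \<Rightarrow> 's exp \<Rightarrow> bool" where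
  "lift_data S B \<Delta> \<Gamma> f \<alpha> g b f' \<alpha>' g' b' \<longleftrightarrow> Ty S \<Delta> B \<and> ElemEq S \<Gamma> f f' \<Delta> \<and> ElemEq S \<Gamma> \<alpha> \<alpha>' (Id_ctxt \<Delta> f g) \<and>
    ElemEq S \<Gamma> (b # g) (b' # g') (B # \<Delta>)"

lemma Id_gen_Cons: "Id_gen (D # \<Lambda>) = (let n = length \<Lambda> in
     Id_over n (J_ctxt \<Lambda>) D (vars (2 * n + 2) n) (vars (n + 1) n) (vars 0 n) (Var (2 * n + 1)) (Var n) #
     subst_tele (inst (vars 1 n @ vars (n + 2) n)) (Id_gen \<Lambda>))"
  by simp

lemma vec_at_tl: "length g = n \<Longrightarrow> vec_at (vars 1 n) (b # g) = g"
  by (rule nth_equalityI) (auto simp: vec_at_def inst_eq_nth)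

lemma vec_at_Nil [simp]: "vec_at [] f = []" and vec_at_Cons: "vec_at (t # ts) f = subst (inst f) t # vec_at ts f"
  by (simp_all add: vec_at_def)

context identity_types begin

text \<open>With the induction complete, the assumptions of the inductive step hold for every
  \<open>\<Delta>\<close> and \<open>B\<close>, so its facts about transport can be reused for the
  fibration in question.\<close>

lemma elim_step_self: "Ty S \<Delta> B \<Longrightarrow> elim_step S B B \<Delta> \<Delta>"
  using elim_good[of \<Delta> \<Delta>] Ty_Ctxt TyEq_refl CtxtEq_refl_iff by unfold_locales auto

lemma transport_at_cong:
  assumes "lift_data S B \<Delta> \<Gamma> f \<alpha> g b f' \<alpha>' g' b'"
  shows "TmEq S \<Gamma> (transport_at B \<Delta> f \<alpha> g b) (transport_at B \<Delta> f' \<alpha>' g' b') (subst (inst f) B)"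
proof -
  have a: "Ty S \<Delta> B" "ElemEq S \<Gamma> f f' \<Delta>" "ElemEq S \<Gamma> \<alpha> \<alpha>' (Id_ctxt \<Delta> f g)" "ElemEq S \<Gamma> g g' \<Delta>"
    "TmEq S \<Gamma> b b' (subst (inst g) B)"
    using assms by (auto simp: lift_data_def)
  interpret E: elim_step S B B \<Delta> \<Delta> by (rule elim_step_self[OF a(1)])
  have l: "length f = E.n" "length g = E.n" "length \<alpha> = E.n"
    using a ElemEq_length E.n_def by (metis length_Id_ctxt)+
  have D1: "subst (inst (\<alpha> @ g @ f)) E.D1 = subst (inst g) B"
    unfolding E.D1_def subst_subst by (rule E.D_eqI) (auto simp: inst_simps l)
  have D2: "subst (inst (b # \<alpha> @ g @ f)) E.D2 = subst (inst f) B"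
    unfolding E.D2_def subst_subst by (rule E.D_eqI) (auto simp: inst_simps l)
  have "SubEq S \<Gamma> (inst (b # \<alpha> @ g @ f)) (inst (b' # \<alpha>' @ g' @ f')) (E.D1 # E.\<Xi>)"
    using SubEq_Id_vec[OF a(2,4,3) E.Ctxt_\<Lambda>(1)] a(5) D1 by (simp add: E.\<Xi>_def)
  from TmEq_SubEq[OF this E.transp_term(1)] show ?thesis
    unfolding D2 transport_at_def .
qed

text \<open>The computation rule of transport lives over \<open>\<Delta>, B\<close> and is
  instantiated at \<open>(g, b)\<close>. On the variables of the transport term the diagonal then
  reads \<open>b\<close>, reflexivity at \<open>g\<close>, \<open>g\<close>,
  \<open>g\<close>.\<close>

lemma transport_at_refl:
  assumes "Ty S \<Delta> B" "Elem S \<Gamma> (b # g) (B # \<Delta>)"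
  shows "TmEq S \<Gamma> (transport_at B \<Delta> g (vec_at (refl_ctxt \<Delta>) g) g b) b (subst (inst g) B)"
proof -
  interpret E: elim_step S B B \<Delta> \<Delta> by (rule elim_step_self[OF assms(1)])
  have l: "length g = E.n"
    using Elem_length[OF assms(2)] E.n_def by simp
  have bg: "SubEq S \<Gamma> (inst (b # g)) (inst (b # g)) (B # \<Delta>)"
    using ElemEq_SubEq assms(2) ElemEq_refl_iff by blast
  have 1: "subst (inst (b # g)) (subst (lifts 1 E.\<delta>) (transp_term B \<Delta>)) = transport_at B \<Delta> g (vec_at (refl_ctxt \<Delta>) g) g b"
    unfolding transport_at_def subst_subst
  proof (rule E.transp_term_eqI)
    fix i assume i: "i < 3 * E.n + 1"
    have "subst (inst (b # g)) (lifts 1 E.\<delta> i) = (if i = 0 then b else subst (inst g) (E.\<delta> (i - 1)))"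
      by (auto simp: lifts_eq subst_subst)
    also have "\<dots> = inst (b # vec_at (refl_ctxt \<Delta>) g @ g @ g) i"
      using i l E.n_def by (auto simp: E.\<delta>_def diag_eq Let_def inst_Cons inst_append nth_append vec_at_def inst_eq_nth mult_2)
    finally show "subst (inst (b # g)) (lifts 1 E.\<delta> i) = inst (b # vec_at (refl_ctxt \<Delta>) g @ g @ g) i" .
  qed
  have 2: "subst (inst (b # g)) (shift 1 B) = subst (inst g) B"
    by (simp add: shift_eq_subst subst_subst)
  show ?thesis
    using TmEq_SubEq[OF bg E.transp_term(2)] unfolding 1 2 by simp
qed

lemma lift_data_length:
  assumes "lift_data S B \<Delta> \<Gamma> f \<alpha> g b f' \<alpha>' g' b'"
  shows "length f = length \<Delta>" "length g = length \<Delta>" "length \<alpha> = length \<Delta>" "length f' = length \<Delta>" "length g' = length \<Delta>" "length \<alpha>' = length \<Delta>"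
proof -
  have a: "ElemEq S \<Gamma> f f' \<Delta>" "ElemEq S \<Gamma> \<alpha> \<alpha>' (Id_ctxt \<Delta> f g)" "ElemEq S \<Gamma> g g' \<Delta>"
    using assms by (auto simp: lift_data_def)
  show "length f = length \<Delta>" "length g = length \<Delta>" "length \<alpha> = length \<Delta>" "length f' = length \<Delta>" "length g' = length \<Delta>" "length \<alpha>' = length \<Delta>"
    using a[THEN ElemEq_length] by auto
qed

text \<open>The transport term is scoped by its own arguments, so substituting \<open>k\<close> only
  acts on the vectors put into it. Naturality of the lift thus holds already for raw terms.\<close>

lemma transport_at_subst:
  assumes "Ty S \<Delta> B" "length f = length \<Delta>" "length g = length \<Delta>" "length \<alpha> = length \<Delta>"
  shows "subst (inst k) (transport_at B \<Delta> f \<alpha> g b) = transport_at B \<Delta> (vec_at f k) (vec_at \<alpha> k) (vec_at g k) (subst (inst k) b)"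
proof -
  interpret E: elim_step S B B \<Delta> \<Delta> by (rule elim_step_self[OF assms(1)])
  show ?thesis
    unfolding transport_at_def subst_subst
    by (rule E.transp_term_eqI) (use assms E.n_def in \<open>auto simp: inst_Cons inst_append nth_append vec_at_def inst_eq_nth\<close>)
qed

lemma subst_inst_vec_at: "Ty S \<Delta> B \<Longrightarrow> length f = length \<Delta> \<Longrightarrow> subst (inst k) (subst (inst f) B) = subst (inst (vec_at f k)) B"
  unfolding subst_subst by (rule subst_eqI_Ty) (auto simp: vec_at_def inst_eq_nth)

lemma lift_cell_subst:
  assumes "Ty S \<Delta> B" "length f = length \<Delta>" "length g = length \<Delta>" "length \<alpha> = length \<Delta>"
  shows "vec_at (lift_cell B \<Delta> f \<alpha> g b) k = lift_cell B \<Delta> (vec_at f k) (vec_at \<alpha> k) (vec_at g k) (subst (inst k) b)"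
  using assms by (simp add: lift_cell_def vec_at_Cons transport_at_subst subst_inst_vec_at)

text \<open>The head type is left existential because an entry of a vector is typed at the entries
  before it, so only the instance at \<alpha> matters.\<close>

lemma Id_ctxt_Cons:
  assumes "Ty S \<Delta> B" "length f = length \<Delta>" "length g = length \<Delta>" "length \<alpha> = length \<Delta>"
  shows "\<exists>H. Id_ctxt (B # \<Delta>) (t # f) (b # g) = H # Id_ctxt \<Delta> f g \<and>
    subst (inst \<alpha>) H = Id_type (subst (inst f) B) t (transport_at B \<Delta> f \<alpha> g b)"
proof -
  interpret E: elim_step S B B \<Delta> \<Delta> by (rule elim_step_self[OF assms(1)])
  note l = assms(2-4)[folded E.n_def]
  define \<rho> where "\<rho> = inst ((b # g) @ t # f)"
  define T where "T = Id_type (subst (inst (vars (2 * E.n + 2) E.n)) B) (Var (2 * E.n + 1))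
      (subst (inst (Var E.n # vars 0 E.n @ vars (E.n + 1) E.n @ vars (2 * E.n + 2) E.n)) (transp_term B \<Delta>))"
  have G: "Id_gen (B # \<Delta>) = T # subst_tele (inst (vars 1 E.n @ vars (E.n + 2) E.n)) (Id_gen \<Delta>)"
    unfolding Id_gen_Cons Let_def E.n_def[symmetric] T_def by (subst E.Id_over_eq) simp_all
  have 1: "Id_ctxt (B # \<Delta>) (t # f) (b # g) = subst (lifts E.n \<rho>) T # Id_ctxt \<Delta> f g"
  proof -
    have "subst_tele \<rho> (subst_tele (inst (vars 1 E.n @ vars (E.n + 2) E.n)) (Id_gen \<Delta>)) = Id_ctxt \<Delta> f g"
      unfolding Id_ctxt_def subst_tele_subst_tele
      by (rule Id_gen_eqI[OF E.Ctxt_\<Lambda>(1)]) (auto simp: \<rho>_def inst_simps l E.n_def[symmetric])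
    then show ?thesis
      unfolding Id_ctxt_def G \<rho>_def by (simp add: E.n_def)
  qed
  \<comment> \<open>The blocks \<open>\<alpha>, b, g, t, f\<close> fill the positions
    \<open>p, y', x', y, x\<close> read by \<open>T\<close>.\<close>
  have \<alpha>\<rho>: "subst (inst \<alpha>) (lifts E.n \<rho> i) = (if i < E.n then \<alpha> ! i else if i = E.n then b else
      if i < 2 * E.n + 1 then g ! (i - (E.n + 1)) else if i = 2 * E.n + 1 then t else inst f (i - (2 * E.n + 2)))" for i
  proof -
    have "subst (inst \<alpha>) (lifts E.n \<rho> i) = (if i < E.n then \<alpha> ! i else \<rho> (i - E.n))"
      by (auto simp: lifts_eq subst_subst inst_eq_nth l simp flip: l(3))
    then show ?thesis by (auto simp: \<rho>_def inst_Cons inst_append_eq inst_eq_nth l mult_2)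
  qed
  have 2: "subst (inst \<alpha>) (subst (lifts E.n \<rho>) (subst (inst (vars (2 * E.n + 2) E.n)) B)) = subst (inst f) B"
    unfolding subst_subst
    by (rule E.D_eqI) (auto simp: inst_vars_eq \<alpha>\<rho> inst_eq_nth l)
  have 3: "subst (inst \<alpha>) (subst (lifts E.n \<rho>) (subst (inst (Var E.n # vars 0 E.n @ vars (E.n + 1) E.n @ vars (2 * E.n + 2) E.n)) (transp_term B \<Delta>)))
     = transport_at B \<Delta> f \<alpha> g b"
    unfolding subst_subst transport_at_def
    by (rule E.transp_term_eqI) (auto simp: inst_vars_eq \<alpha>\<rho> inst_Cons inst_append_eq l inst_eq_nth mult_2)
  have 4: "subst (inst \<alpha>) (subst (lifts E.n \<rho>) (Var (2 * E.n + 1))) = t"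
    by (simp add: \<alpha>\<rho>)
  show ?thesis
    unfolding 1 by (rule exI, rule conjI, rule refl) (simp only: T_def subst_Id_type 2 3 4)
qed

lemma lift_cell_cong:
  assumes "lift_data S B \<Delta> \<Gamma> f \<alpha> g b f' \<alpha>' g' b'"
  shows "ElemEq S \<Gamma> (lift_cell B \<Delta> f \<alpha> g b) (lift_cell B \<Delta> f' \<alpha>' g' b') (Id_ctxt (B # \<Delta>) (transport_at B \<Delta> f \<alpha> g b # f) (b # g))"
proof -
  have a: "Ty S \<Delta> B" "ElemEq S \<Gamma> f f' \<Delta>" "ElemEq S \<Gamma> \<alpha> \<alpha>' (Id_ctxt \<Delta> f g)"
    using assms by (auto simp: lift_data_def)
  obtain H where H: "Id_ctxt (B # \<Delta>) (transport_at B \<Delta> f \<alpha> g b # f) (b # g) = H # Id_ctxt \<Delta> f g"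
    "subst (inst \<alpha>) H = Id_type (subst (inst f) B) (transport_at B \<Delta> f \<alpha> g b) (transport_at B \<Delta> f \<alpha> g b)"
    using Id_ctxt_Cons[OF a(1) lift_data_length(1,2,3)[OF assms]] by metis
  have "TyEq S \<Gamma> (subst (inst f) B) (subst (inst f') B)"
    using TyEq_SubEq[OF ElemEq_SubEq[OF a(2)] TyEq_refl[OF a(1)]] .
  from Refl_cong[OF this transport_at_cong[OF assms]] show ?thesis
    unfolding H lift_cell_def using a(3) by (simp add: H(2))
qed

text \<open>The transport and \<open>b\<close> are only definitionally equal, so the reflexivities
  match by \<open>Refl_cong\<close>. The identity context keeps the endpoint \<open>t\<close>, since
  it belongs to the class of the lift.\<close>

lemma lift_cell_refl:
  assumes "Ty S \<Delta> B" "Elem S \<Gamma> (b # g) (B # \<Delta>)"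
  defines "t \<equiv> transport_at B \<Delta> g (vec_at (refl_ctxt \<Delta>) g) g b"
  shows "ElemEq S \<Gamma> (lift_cell B \<Delta> g (vec_at (refl_ctxt \<Delta>) g) g b) (vec_at (refl_ctxt (B # \<Delta>)) (b # g)) (Id_ctxt (B # \<Delta>) (t # g) (b # g))"
proof -
  have l: "length g = length \<Delta>" using Elem_length[OF assms(2)] by simp
  have c: "Ctxt S \<Delta>" using assms(1) Ty_Ctxt by blast
  have g: "ElemEq S \<Gamma> g g \<Delta>" using assms(2) by (simp add: ElemEq_refl_iff)
  obtain H where H: "Id_ctxt (B # \<Delta>) (t # g) (b # g) = H # Id_ctxt \<Delta> g g"
    "subst (inst (vec_at (refl_ctxt \<Delta>) g)) H = Id_type (subst (inst g) B) t t"
    using Id_ctxt_Cons[OF assms(1) l l, of "vec_at (refl_ctxt \<Delta>) g" t b] unfolding t_def by auto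
  have r: "ElemEq S \<Gamma> (vec_at (refl_ctxt \<Delta>) g) (vec_at (refl_ctxt \<Delta>) g) (Id_ctxt \<Delta> g g)"
    using refl_at_cong[OF _ g] c CtxtEq_refl_iff by blast
  have e: "vec_at (refl_ctxt (B # \<Delta>)) (b # g) = Refl (subst (inst g) B) b # vec_at (refl_ctxt \<Delta>) g"
    by (simp add: vec_at_Cons map_shift_eq shift_eq_subst subst_subst) (simp add: vec_at_def subst_vec_subst_vec)
  have "TyEq S \<Gamma> (subst (inst g) B) (subst (inst g) B)"
    using TyEq_SubEq[OF ElemEq_SubEq[OF g] TyEq_refl[OF assms(1)]] .
  from Refl_cong[OF this transport_at_refl[OF assms(1,2)]] show ?thesis
    unfolding H e lift_cell_def using r by (simp add: H(2) t_def)
qed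

end

context discrete_identity_types begin

text \<open>\<open>\<pi>\<^sup>\<bullet>(p, q) = p\<close>, as both sides are \<open>r(x)\<close> on reflexivities.\<close>

lemma ap_gen_proj:
  assumes "Ty S \<Delta> B" "n = length \<Delta>"
  shows "ElemEq S (Id_vec_ctxt (B # \<Delta>)) (ap_gen (B # \<Delta>) (vars 1 n) \<Delta>) (vars 1 n)
      (Id_ctxt \<Delta> (vars (2 * n + 3) n) (vars (n + 2) n))"
proof -
  have c: "Ctxt S \<Delta>" "Ctxt S (B # \<Delta>)" using assms Ty_Ctxt by auto
  have P: "ElemEq S (B # \<Delta>) (vars 1 n) (vars 1 n) \<Delta>"
    using ElemEq_vars_closed[of "[B]" \<Delta> "[]" 1 n] c assms by simp
  let ?v = "vec_at (vars 1 n)" and ?m = "length (B # \<Delta>)"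
  \<comment> \<open>Positions in \<open>q, p, y', x', y, x\<close>, with blocks of length
    \<open>n\<close> for the contexts: \<open>p\<close> starts at \<open>1\<close>,
    \<open>x'\<close> at \<open>n + 2\<close> and \<open>x\<close> at
    \<open>2 * n + 3\<close>.\<close>
  have v: "?v (vars (2 * ?m) ?m) = vars (2 * n + 3) n" "?v (vars ?m ?m) = vars (n + 2) n"
    by (rule nth_equalityI; simp add: vec_at_def inst_vars_eq assms)+
  have C1: "CtxtEq S (B # \<Delta>) (B # \<Delta>)" "CtxtEq S \<Delta> \<Delta>" using c CtxtEq_refl_iff by blast+
  note ap = ap_gen[OF C1 P refl, unfolded v]
  let ?\<Theta> = "Id_ctxt \<Delta> (vars (2 * n + 3) n) (vars (n + 2) n)"
  have I: "Ctxt S (Id_vec_ctxt (B # \<Delta>))" using Ctxt_Id_vec[OF c(2)] unfolding Id_vec_ctxt_def .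
  have vv: "ElemEq S (Id_vec_ctxt (B # \<Delta>)) (vars (2 * n + 3) n) (vars (2 * n + 3) n) \<Delta>"
    "ElemEq S (Id_vec_ctxt (B # \<Delta>)) (vars (n + 2) n) (vars (n + 2) n) \<Delta>"
    using ElemEq_vec_at_closed[OF vars_Id_vec(2)[OF c(2) refl] P c(1)]
      ElemEq_vec_at_closed[OF vars_Id_vec(1)[OF c(2) refl] P c(1)] unfolding v .
  have \<Theta>: "Ctxt S (?\<Theta> @ Id_vec_ctxt (B # \<Delta>))"
    using CtxtEq_Id_ctxt[OF vv C1(2)] I CtxtEq_refl_iff by blast
  obtain T where G: "Id_vec_ctxt (B # \<Delta>) = [T] @ subst_tele (inst (vars 1 n @ vars (n + 2) n)) (Id_gen \<Delta>) @ (B # \<Delta>) @ (B # \<Delta>)"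
    unfolding Id_vec_ctxt_def Id_gen_Cons Let_def assms(2)[symmetric] by auto
  have "ElemEq S (Id_vec_ctxt (B # \<Delta>)) (vars 1 n) (vars 1 n)
     (subst_tele (\<lambda>i. Var (i + (1 + n))) (subst_tele (inst (vars 1 n @ vars (n + 2) n)) (Id_gen \<Delta>)))"
    unfolding G by (rule ElemEq_vars) (use I G assms in auto)
  also have "subst_tele (\<lambda>i. Var (i + (1 + n))) (subst_tele (inst (vars 1 n @ vars (n + 2) n)) (Id_gen \<Delta>)) = ?\<Theta>"
    unfolding Id_ctxt_def subst_tele_subst_tele
    by (rule Id_gen_eqI[OF c(1)]) (auto simp: inst_simps assms)
  finally have p: "ElemEq S (Id_vec_ctxt (B # \<Delta>)) (vars 1 n) (vars 1 n) ?\<Theta>" .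
  \<comment> \<open>Offset \<open>1\<close> skips the reflexivity at the last variable; what remains
    is \<open>refl_ctxt \<Delta>\<close> weakened past \<open>B\<close>.\<close>
  have d: "subst_vec (inst (diag (B # \<Delta>))) (vars 1 n) = vec_at (refl_ctxt \<Delta>) (vars 1 n)"
  proof -
    have "subst_vec (inst (diag (B # \<Delta>))) (vars 1 n) = subst_vec (\<lambda>i. Var (i + 1)) (refl_ctxt \<Delta>)"
      by (rule nth_equalityI) (auto simp: assms diag_eq shift_eq_subst nth_append)
    also have "\<dots> = vec_at (refl_ctxt \<Delta>) (vars 1 n)"
      unfolding vec_at_def
      by (rule subst_vec_eqI_Elem[OF ElemEq_Elem[OF refl_ctxt_cong[OF C1(2)]]]) (simp add: inst_vars_eq assms)
    finally show ?thesis .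
  qed
  have e: "subst_tele (inst (diag (B # \<Delta>))) ?\<Theta> = Id_ctxt \<Delta> (vars 1 n) (vars 1 n)"
  proof -
    have "subst_vec (inst (diag (B # \<Delta>))) (vars (2 * n + 3) n) = vars 1 n"
      "subst_vec (inst (diag (B # \<Delta>))) (vars (n + 2) n) = vars 1 n"
      by (rule nth_equalityI; simp add: assms diag_eq Let_def)+
    then show ?thesis by (simp add: subst_tele_Id_ctxt[OF c(1)] assms)
  qed
  show ?thesis
    by (rule Id_types_unique[OF c(2) Id_types_Id_ctxt \<Theta> ElemEq_Elem[OF ap(1)] ElemEq_Elem[OF p]])
      (unfold d e, rule ap(2))
qed

text \<open>Whiskering ranges over all representatives, so \<open>h\<close>, \<open>\<Phi>'\<close>,
  \<open>\<Theta>\<close> and the primed vectors are arbitrary ones equal to the intended data. Over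
  the generic identity context \<open>p\<close> equals the action of the projection on
  \<open>(p, q)\<close>, which equals that of \<open>h\<close>; this chain is then instantiated at
  the lifted cell.\<close>

lemma lwhisk_proj:
  assumes "lift_data S B \<Delta> \<Gamma> f \<alpha> g b f \<alpha> g b"
    "CtxtEq S (B # \<Delta>) \<Phi>'" "CtxtEq S \<Delta> \<Theta>" "ElemEq S (B # \<Delta>) (vars 1 (length \<Delta>)) h \<Delta>"
    "ElemEq S \<Gamma> (transport_at B \<Delta> f \<alpha> g b # f) s' (B # \<Delta>)" "ElemEq S \<Gamma> (b # g) g' (B # \<Delta>)"
    "ElemEq S \<Gamma> (lift_cell B \<Delta> f \<alpha> g b) \<sigma>' (Id_ctxt (B # \<Delta>) (transport_at B \<Delta> f \<alpha> g b # f) (b # g))"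
  shows "ElemEq S \<Gamma> \<alpha> (lwhisk_rep \<Phi>' h \<Theta> s' g' \<sigma>') (Id_ctxt \<Delta> f g)"
proof -
  define n where "n = length \<Delta>"
  have B: "Ty S \<Delta> B" and fg: "ElemEq S \<Gamma> f f \<Delta>" "ElemEq S \<Gamma> g g \<Delta>" using assms(1) by (auto simp: lift_data_def)
  have c: "Ctxt S \<Delta>" "Ctxt S (B # \<Delta>)" using B Ty_Ctxt by auto
  note l = lift_data_length[OF assms(1), folded n_def]
  let ?t = "transport_at B \<Delta> f \<alpha> g b" and ?\<sigma> = "lift_cell B \<Delta> f \<alpha> g b"
  let ?\<rho> = "?\<sigma> @ (b # g) @ ?t # f" and ?\<rho>' = "\<sigma>' @ g' @ s'"
  have l\<sigma>: "length ?\<sigma> = Suc n" by (simp add: lift_cell_def l)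
  have v: "vec_at (vars 1 n) (vars (2 * length (B # \<Delta>)) (length (B # \<Delta>))) = vars (2 * n + 3) n"
     "vec_at (vars 1 n) (vars (length (B # \<Delta>)) (length (B # \<Delta>))) = vars (n + 2) n"
    by (rule nth_equalityI; simp add: vec_at_def inst_vars_eq n_def)+
  let ?\<Theta> = "Id_ctxt \<Delta> (vars (2 * n + 3) n) (vars (n + 2) n)"
  let ?X = "Id_vec_ctxt (B # \<Delta>)"
  have 1: "ElemEq S ?X (ap_gen (B # \<Delta>) (vars 1 n) \<Delta>) (ap_gen \<Phi>' h \<Theta>) ?\<Theta>"
    using ap_gen(1)[OF assms(2-4) refl] unfolding n_def[symmetric] v .
  have 2: "ElemEq S ?X (ap_gen (B # \<Delta>) (vars 1 n) \<Delta>) (vars 1 n) ?\<Theta>"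
    by (rule ap_gen_proj[OF B n_def])
  have P: "ElemEq S (B # \<Delta>) (vars 1 n) (vars 1 n) \<Delta>"
    using ElemEq_vars_closed[of "[B]" \<Delta> "[]" 1 n] c n_def by simp
  have vv: "ElemEq S ?X (vars (2 * n + 3) n) (vars (2 * n + 3) n) \<Delta>"
    "ElemEq S ?X (vars (n + 2) n) (vars (n + 2) n) \<Delta>"
    using ElemEq_vec_at_closed[OF vars_Id_vec(2)[OF c(2) refl] P c(1)]
      ElemEq_vec_at_closed[OF vars_Id_vec(1)[OF c(2) refl] P c(1)] unfolding v .
  have "Ctxt S (?\<Theta> @ ?X)"
    using CtxtEq_Id_ctxt[OF vv] CtxtEq_refl_iff c ElemEq_Ctxt[OF 1] by blast
  from ElemEq_trans[OF this ElemEq_sym[OF this 2] 1]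
  have 3: "ElemEq S ?X (vars 1 n) (ap_gen \<Phi>' h \<Theta>) ?\<Theta>" .
  have \<rho>: "SubEq S \<Gamma> (inst ?\<rho>) (inst ?\<rho>') ?X"
    by (rule SubEq_Id_vec[OF assms(5,6,7) c(2)])
  have e1: "subst_vec (inst ?\<rho>) (vars 1 n) = \<alpha>"
    by (rule nth_equalityI) (auto simp: l l\<sigma> inst_append nth_append lift_cell_def)
  have e2: "subst_vec (inst ?\<rho>) (vars (2 * n + 3) n) = f"
    by (rule nth_equalityI) (auto simp: l inst_append inst_Cons nth_append lift_cell_def inst_eq_nth eval_nat_numeral)
  have e3: "subst_vec (inst ?\<rho>) (vars (n + 2) n) = g"
    by (rule nth_equalityI) (auto simp: l inst_append inst_Cons nth_append lift_cell_def inst_eq_nth eval_nat_numeral)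
  have "subst_tele (inst ?\<rho>) ?\<Theta> = Id_ctxt \<Delta> f g"
    by (subst subst_tele_Id_ctxt[OF c(1)]) (simp_all only: length_vars n_def e2[unfolded n_def] e3[unfolded n_def])
  then show ?thesis
    using ElemEq_SubEq_subst[OF \<rho> 3] unfolding e1 lwhisk_rep_def vec_at_def by simp
qed

end

section \<open>Cells of the 2-category of contexts\<close>

text \<open>Operations on classes are unions over representatives. Computing one amounts to two
  checks: every choice yields the same class, and some choice exists.\<close>

lemma Union_const: "(\<And>x. x \<in> A \<Longrightarrow> x = c) \<Longrightarrow> c \<in> A \<Longrightarrow> \<Union>A = c"
  by blast

definition arr_eq where
  "arr_eq S \<Gamma> f \<Delta> \<Gamma>' f' \<Delta>' \<longleftrightarrow> CtxtEq S \<Gamma> \<Gamma>' \<and> CtxtEq S \<Delta> \<Delta>' \<and> ElemEq S \<Gamma> f f' \<Delta>"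

definition cell_eq where
  "cell_eq S \<Gamma> f \<alpha> g \<Delta> \<Gamma>' f' \<alpha>' g' \<Delta>' \<longleftrightarrow> CtxtEq S \<Gamma> \<Gamma>' \<and> CtxtEq S \<Delta> \<Delta>' \<and> ElemEq S \<Gamma> f f' \<Delta> \<and>
     ElemEq S \<Gamma> g g' \<Delta> \<and> ElemEq S \<Gamma> \<alpha> \<alpha>' (Id_ctxt \<Delta> f g)"

lemma mem_arr_class: "(\<Gamma>', f', \<Delta>') \<in> arr_class S \<Gamma> f \<Delta> \<longleftrightarrow> arr_eq S \<Gamma> f \<Delta> \<Gamma>' f' \<Delta>'"
  by (simp add: arr_class_def arr_eq_def)

lemma mem_cell_class: "(\<Gamma>', f', \<alpha>', g', \<Delta>') \<in> cell_class S \<Gamma> f \<alpha> g \<Delta> \<longleftrightarrow> cell_eq S \<Gamma> f \<alpha> g \<Delta> \<Gamma>' f' \<alpha>' g' \<Delta>'"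
  by (simp add: cell_class_def cell_eq_def)

section \<open>Definitional equality of representatives as an equivalence relation\<close>

context identity_types begin

lemma arr_eq_refl: "Elem S \<Gamma> f \<Delta> \<Longrightarrow> Ctxt S \<Delta> \<Longrightarrow> arr_eq S \<Gamma> f \<Delta> \<Gamma> f \<Delta>"
  by (simp add: arr_eq_def CtxtEq_refl_iff ElemEq_refl_iff ElemEq_Ctxt[of \<Gamma> f f \<Delta>, unfolded ElemEq_refl_iff])

lemma arr_eq_sym:
  assumes "arr_eq S \<Gamma> f \<Delta> \<Gamma>' f' \<Delta>'"
  shows "arr_eq S \<Gamma>' f' \<Delta>' \<Gamma> f \<Delta>"
proof -
  have a: "CtxtEq S \<Gamma> \<Gamma>'" "CtxtEq S \<Delta> \<Delta>'" "ElemEq S \<Gamma> f f' \<Delta>" using assms by (auto simp: arr_eq_def)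
  have "Ctxt S (\<Delta> @ \<Gamma>)" using a Ctxt_append_closed CtxtEq_Ctxt1 by blast
  from ElemEq_ctxt_conv[OF a(1) ElemEq_sym[OF this a(3)]]
  have "ElemEq S \<Gamma>' f' f \<Delta>'"
    using ElemEq_conv[OF CtxtEq_append_closed[OF a(2)], of \<Gamma>'] CtxtEq_Ctxt2[OF a(1)] CtxtEq_refl_iff by blast
  then show ?thesis using a CtxtEq_sym by (simp add: arr_eq_def)
qed

lemma arr_eq_trans:
  assumes "arr_eq S \<Gamma> f \<Delta> \<Gamma>' f' \<Delta>'" "arr_eq S \<Gamma>' f' \<Delta>' \<Gamma>'' f'' \<Delta>''"
  shows "arr_eq S \<Gamma> f \<Delta> \<Gamma>'' f'' \<Delta>''"
proof -
  have a: "CtxtEq S \<Gamma> \<Gamma>'" "CtxtEq S \<Delta> \<Delta>'" "ElemEq S \<Gamma> f f' \<Delta>" using assms by (auto simp: arr_eq_def)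
  have b: "CtxtEq S \<Gamma>' \<Gamma>''" "CtxtEq S \<Delta>' \<Delta>''" "ElemEq S \<Gamma>' f' f'' \<Delta>'" using assms by (auto simp: arr_eq_def)
  have c: "Ctxt S (\<Delta> @ \<Gamma>)" "CtxtEq S \<Gamma> \<Gamma>" using a Ctxt_append_closed CtxtEq_Ctxt1 CtxtEq_refl_iff by blast+
  have "ElemEq S \<Gamma> f' f'' \<Delta>'" using ElemEq_ctxt_conv[OF CtxtEq_sym[OF a(1)] b(3)] .
  then have "ElemEq S \<Gamma> f' f'' \<Delta>"
    using ElemEq_conv[OF CtxtEq_append_closed[OF CtxtEq_sym[OF a(2)] c(2)]] by blast
  then show ?thesis
    using a b CtxtEq_trans ElemEq_trans[OF c(1) a(3)] unfolding arr_eq_def by blast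
qed

lemma cell_eq_refl:
  "Elem S \<Gamma> f \<Delta> \<Longrightarrow> Elem S \<Gamma> g \<Delta> \<Longrightarrow> Elem S \<Gamma> \<alpha> (Id_ctxt \<Delta> f g) \<Longrightarrow> Ctxt S \<Delta> \<Longrightarrow>
    cell_eq S \<Gamma> f \<alpha> g \<Delta> \<Gamma> f \<alpha> g \<Delta>"
  by (simp add: cell_eq_def CtxtEq_refl_iff ElemEq_refl_iff ElemEq_Ctxt[of \<Gamma> f f \<Delta>, unfolded ElemEq_refl_iff])

text \<open>\<alpha>' is converted twice, because both its ambient context and its identity context,
  which mentions \<open>f\<close> and \<open>g\<close>, change.\<close>

lemma cell_eq_sym:
  assumes "cell_eq S \<Gamma> f \<alpha> g \<Delta> \<Gamma>' f' \<alpha>' g' \<Delta>'"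
  shows "cell_eq S \<Gamma>' f' \<alpha>' g' \<Delta>' \<Gamma> f \<alpha> g \<Delta>"
proof -
  have a: "CtxtEq S \<Gamma> \<Gamma>'" "CtxtEq S \<Delta> \<Delta>'" "ElemEq S \<Gamma> f f' \<Delta>" "ElemEq S \<Gamma> g g' \<Delta>" "ElemEq S \<Gamma> \<alpha> \<alpha>' (Id_ctxt \<Delta> f g)"
    using assms by (auto simp: cell_eq_def)
  have fg: "arr_eq S \<Gamma>' f' \<Delta>' \<Gamma> f \<Delta>" "arr_eq S \<Gamma>' g' \<Delta>' \<Gamma> g \<Delta>"
    using a arr_eq_sym unfolding arr_eq_def by blast+
  have C: "CtxtEq S (Id_ctxt \<Delta> f g @ \<Gamma>) (Id_ctxt \<Delta>' f' g' @ \<Gamma>)"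
    using CtxtEq_Id_ctxt[OF a(3,4,2)] CtxtEq_Ctxt1[OF a(1)] CtxtEq_refl_iff by blast
  have "ElemEq S \<Gamma>' \<alpha>' \<alpha> (Id_ctxt \<Delta>' f' g')"
    using ElemEq_ctxt_conv[OF a(1) ElemEq_conv[OF C ElemEq_sym[OF CtxtEq_Ctxt1[OF C] a(5)]]] .
  then show ?thesis using fg by (simp add: cell_eq_def arr_eq_def)
qed

lemma cell_eq_trans:
  assumes "cell_eq S \<Gamma> f \<alpha> g \<Delta> \<Gamma>' f' \<alpha>' g' \<Delta>'" "cell_eq S \<Gamma>' f' \<alpha>' g' \<Delta>' \<Gamma>'' f'' \<alpha>'' g'' \<Delta>''"
  shows "cell_eq S \<Gamma> f \<alpha> g \<Delta> \<Gamma>'' f'' \<alpha>'' g'' \<Delta>''"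
proof -
  have a: "CtxtEq S \<Gamma> \<Gamma>'" "CtxtEq S \<Delta> \<Delta>'" "ElemEq S \<Gamma> f f' \<Delta>" "ElemEq S \<Gamma> g g' \<Delta>" "ElemEq S \<Gamma> \<alpha> \<alpha>' (Id_ctxt \<Delta> f g)"
    using assms by (auto simp: cell_eq_def)
  have fg: "arr_eq S \<Gamma> f \<Delta> \<Gamma>'' f'' \<Delta>''" "arr_eq S \<Gamma> g \<Delta> \<Gamma>'' g'' \<Delta>''"
    using assms arr_eq_trans unfolding arr_eq_def cell_eq_def by blast+
  have C: "CtxtEq S (Id_ctxt \<Delta> f g @ \<Gamma>) (Id_ctxt \<Delta>' f' g' @ \<Gamma>)"
    using CtxtEq_Id_ctxt[OF a(3,4,2)] CtxtEq_Ctxt1[OF a(1)] CtxtEq_refl_iff by blast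
  have "ElemEq S \<Gamma>' \<alpha>' \<alpha>'' (Id_ctxt \<Delta>' f' g')" using assms(2) by (simp add: cell_eq_def)
  from ElemEq_conv[OF CtxtEq_sym[OF C] ElemEq_ctxt_conv[OF CtxtEq_sym[OF a(1)] this]]
  have "ElemEq S \<Gamma> \<alpha> \<alpha>'' (Id_ctxt \<Delta> f g)"
    using ElemEq_trans[OF CtxtEq_Ctxt1[OF C] a(5)] by blast
  then show ?thesis using fg by (simp add: cell_eq_def arr_eq_def)
qed

lemma arr_class_eqI:
  assumes "arr_eq S \<Gamma> f \<Delta> \<Gamma>' f' \<Delta>'"
  shows "arr_class S \<Gamma> f \<Delta> = arr_class S \<Gamma>' f' \<Delta>'"
proof -
  have "x \<in> arr_class S \<Gamma> f \<Delta> \<longleftrightarrow> x \<in> arr_class S \<Gamma>' f' \<Delta>'" for x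
    using arr_eq_trans[OF assms] arr_eq_trans[OF arr_eq_sym[OF assms]]
    by (cases x) (auto simp: mem_arr_class)
  then show ?thesis by blast
qed

lemma cell_class_eqI:
  assumes "cell_eq S \<Gamma> f \<alpha> g \<Delta> \<Gamma>' f' \<alpha>' g' \<Delta>'"
  shows "cell_class S \<Gamma> f \<alpha> g \<Delta> = cell_class S \<Gamma>' f' \<alpha>' g' \<Delta>'"
proof -
  have "x \<in> cell_class S \<Gamma> f \<alpha> g \<Delta> \<longleftrightarrow> x \<in> cell_class S \<Gamma>' f' \<alpha>' g' \<Delta>'" for x
    using cell_eq_trans[OF assms] cell_eq_trans[OF cell_eq_sym[OF assms]]
    by (cases x) (auto simp: mem_cell_class)
  then show ?thesis by blast
qed

section \<open>Operations of the 2-category computed on representatives\<close>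

abbreviation "\<CC> \<equiv> ctxt_two_category S"

lemma comp1_class:
  assumes "Elem S \<Gamma> f \<Delta>" "Elem S \<Delta> g \<Theta>" "Ctxt S \<Theta>"
  shows "comp1 \<CC> (arr_class S \<Delta> g \<Theta>) (arr_class S \<Gamma> f \<Delta>) = arr_class S \<Gamma> (vec_at g f) \<Theta>"
proof -
  have c: "Ctxt S \<Delta>" using assms(2) ElemEq_refl_iff ElemEq_Ctxt by blast
  have eq: "arr_class S \<Gamma>' (vec_at g' f') \<Theta>' = arr_class S \<Gamma> (vec_at g f) \<Theta>"
    if "arr_eq S \<Gamma> f \<Delta> \<Gamma>' f' \<Delta>'" "arr_eq S \<Delta> g \<Theta> \<Delta>' g' \<Theta>'" for \<Gamma>' f' \<Delta>' g' \<Theta>'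
  proof (rule arr_class_eqI[symmetric])
    show "arr_eq S \<Gamma> (vec_at g f) \<Theta> \<Gamma>' (vec_at g' f') \<Theta>'"
      using that ElemEq_vec_at_closed[of \<Gamma> f f' \<Delta> g g' \<Theta>] assms(3) by (auto simp: arr_eq_def)
  qed
  show ?thesis
    unfolding ctxt_two_category_def two_category.simps
  proof (rule Union_const, goal_cases)
    case (1 x)
    then show ?case using eq by (auto simp: mem_arr_class)
  next
    case 2
    then show ?case using arr_eq_refl[OF assms(1) c] arr_eq_refl[OF assms(2,3)]
      unfolding mem_Collect_eq mem_arr_class by blast
  qed
qed

lemma rwhisk_class:
  assumes "Elem S \<Gamma> k \<Delta>" "Elem S \<Delta> f \<Theta>" "Elem S \<Delta> g \<Theta>" "Elem S \<Delta> \<alpha> (Id_ctxt \<Theta> f g)" "Ctxt S \<Theta>"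
  shows "rwhisk \<CC> (cell_class S \<Delta> f \<alpha> g \<Theta>) (arr_class S \<Gamma> k \<Delta>) =
    cell_class S \<Gamma> (vec_at f k) (vec_at \<alpha> k) (vec_at g k) \<Theta>"
proof -
  have c: "Ctxt S \<Delta>" using assms(2) ElemEq_refl_iff ElemEq_Ctxt by blast
  have l: "length f = length \<Theta>" "length g = length \<Theta>" using Elem_length assms by blast+
  have I: "subst_tele (inst k) (Id_ctxt \<Theta> f g) = Id_ctxt \<Theta> (vec_at f k) (vec_at g k)"
    by (simp add: subst_tele_Id_ctxt assms l vec_at_def)
  have eq: "cell_class S \<Gamma>' (vec_at f' k') (vec_at \<alpha>' k') (vec_at g' k') \<Theta>' =
      cell_class S \<Gamma> (vec_at f k) (vec_at \<alpha> k) (vec_at g k) \<Theta>"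
    if "arr_eq S \<Gamma> k \<Delta> \<Gamma>' k' \<Delta>'" "cell_eq S \<Delta> f \<alpha> g \<Theta> \<Delta>' f' \<alpha>' g' \<Theta>'" for \<Gamma>' k' \<Delta>' f' \<alpha>' g' \<Theta>'
  proof (rule cell_class_eqI[symmetric])
    show "cell_eq S \<Gamma> (vec_at f k) (vec_at \<alpha> k) (vec_at g k) \<Theta> \<Gamma>' (vec_at f' k') (vec_at \<alpha>' k') (vec_at g' k') \<Theta>'"
      using that ElemEq_vec_at_closed[of \<Gamma> k k' \<Delta> f f' \<Theta>] ElemEq_vec_at_closed[of \<Gamma> k k' \<Delta> g g' \<Theta>]
        ElemEq_vec_at[of \<Gamma> k k' \<Delta> \<alpha> \<alpha>' "Id_ctxt \<Theta> f g"] assms(5) I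
      by (auto simp: arr_eq_def cell_eq_def)
  qed
  have r: "arr_eq S \<Gamma> k \<Delta> \<Gamma> k \<Delta>" "cell_eq S \<Delta> f \<alpha> g \<Theta> \<Delta> f \<alpha> g \<Theta>"
    using arr_eq_refl cell_eq_refl assms c by blast+
  show ?thesis
    unfolding ctxt_two_category_def two_category.simps
  proof (rule Union_const, goal_cases)
    case (1 x)
    then show ?case using eq by (auto simp: mem_arr_class mem_cell_class)
  next
    case 2
    then show ?case using r unfolding mem_Collect_eq mem_arr_class mem_cell_class by blast
  qed
qed

lemma idcell_class:
  assumes "Elem S \<Gamma> f \<Delta>" "Ctxt S \<Delta>"
  shows "idcell \<CC> (arr_class S \<Gamma> f \<Delta>) = cell_class S \<Gamma> f (vec_at (refl_ctxt \<Delta>) f) f \<Delta>"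
proof -
  have eq: "cell_class S \<Gamma>' f' (vec_at (refl_ctxt \<Delta>') f') f' \<Delta>' = cell_class S \<Gamma> f (vec_at (refl_ctxt \<Delta>) f) f \<Delta>"
    if "arr_eq S \<Gamma> f \<Delta> \<Gamma>' f' \<Delta>'" for \<Gamma>' f' \<Delta>'
    by (rule cell_class_eqI[symmetric]) (use that refl_at_cong in \<open>auto simp: arr_eq_def cell_eq_def\<close>)
  show ?thesis
    unfolding ctxt_two_category_def two_category.simps
  proof (rule Union_const, goal_cases)
    case (1 x)
    then show ?case using eq by (auto simp: mem_arr_class)
  next
    case 2
    then show ?case using arr_eq_refl[OF assms] unfolding mem_Collect_eq mem_arr_class by blast
  qed
qed

text \<open>A union over representatives, like the operations of the 2-category, so that nothing is
  chosen. The codomains are the given \<open>\<Delta>\<close> and \<open>B # \<Delta>\<close>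
  literally, as transport is the term built from this presentation, and \<open>g\<close> is shared
  so that the two representatives fit together.\<close>

definition lift1 :: "'s exp \<Rightarrow> 's exp list \<Rightarrow> 's ob \<Rightarrow> 's arr \<Rightarrow> 's arr \<Rightarrow> 's cell \<Rightarrow> 's arr" where
  "lift1 B \<Delta> W F G A = \<Union>{arr_class S \<Gamma> (transport_at B \<Delta> f \<alpha> g b # f) (B # \<Delta>) | \<Gamma> f \<alpha> g b.
     (\<Gamma>, f, \<alpha>, g, \<Delta>) \<in> A \<and> (\<Gamma>, b # g, B # \<Delta>) \<in> G}"

definition lift2 :: "'s exp \<Rightarrow> 's exp list \<Rightarrow> 's ob \<Rightarrow> 's arr \<Rightarrow> 's arr \<Rightarrow> 's cell \<Rightarrow> 's cell" where
  "lift2 B \<Delta> W F G A = \<Union>{cell_class S \<Gamma> (transport_at B \<Delta> f \<alpha> g b # f) (lift_cell B \<Delta> f \<alpha> g b) (b # g) (B # \<Delta>) | \<Gamma> f \<alpha> g b.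
     (\<Gamma>, f, \<alpha>, g, \<Delta>) \<in> A \<and> (\<Gamma>, b # g, B # \<Delta>) \<in> G}"

text \<open>Independence of representatives is congruence of transport for the 1-cell and of
  \<open>lift_cell\<close> for the 2-cell; this is the use of \<open>lift_data\<close> with two
  different halves.\<close>

lemma lift_class:
  assumes "lift_data S B \<Delta> \<Gamma> f \<alpha> g b f \<alpha> g b"
  shows "lift1 B \<Delta> W F (arr_class S \<Gamma> (b # g) (B # \<Delta>)) (cell_class S \<Gamma> f \<alpha> g \<Delta>) =
      arr_class S \<Gamma> (transport_at B \<Delta> f \<alpha> g b # f) (B # \<Delta>)"
    "lift2 B \<Delta> W F (arr_class S \<Gamma> (b # g) (B # \<Delta>)) (cell_class S \<Gamma> f \<alpha> g \<Delta>) =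
      cell_class S \<Gamma> (transport_at B \<Delta> f \<alpha> g b # f) (lift_cell B \<Delta> f \<alpha> g b) (b # g) (B # \<Delta>)"
proof -
  have a: "Ty S \<Delta> B" "ElemEq S \<Gamma> f f \<Delta>" "ElemEq S \<Gamma> g g \<Delta>" "ElemEq S \<Gamma> \<alpha> \<alpha> (Id_ctxt \<Delta> f g)"
     "ElemEq S \<Gamma> (b # g) (b # g) (B # \<Delta>)"
    using assms by (auto simp: lift_data_def)
  have "Ctxt S (B # \<Delta>)" using a Ty_Ctxt by simp
  then have C: "CtxtEq S (B # \<Delta>) (B # \<Delta>)" "CtxtEq S \<Delta> \<Delta>"
    unfolding CtxtEq_refl_iff by auto
  have eq: "arr_eq S \<Gamma> (transport_at B \<Delta> f \<alpha> g b # f) (B # \<Delta>) \<Gamma>' (transport_at B \<Delta> f' \<alpha>' g' b' # f') (B # \<Delta>)"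
     "cell_eq S \<Gamma> (transport_at B \<Delta> f \<alpha> g b # f) (lift_cell B \<Delta> f \<alpha> g b) (b # g) (B # \<Delta>)
       \<Gamma>' (transport_at B \<Delta> f' \<alpha>' g' b' # f') (lift_cell B \<Delta> f' \<alpha>' g' b') (b' # g') (B # \<Delta>)"
    if "cell_eq S \<Gamma> f \<alpha> g \<Delta> \<Gamma>' f' \<alpha>' g' \<Delta>" "arr_eq S \<Gamma> (b # g) (B # \<Delta>) \<Gamma>' (b' # g') (B # \<Delta>)" for \<Gamma>' f' \<alpha>' g' b'
  proof -
    have L: "lift_data S B \<Delta> \<Gamma> f \<alpha> g b f' \<alpha>' g' b'"
      using that a(1) by (auto simp: lift_data_def cell_eq_def arr_eq_def)
    show "arr_eq S \<Gamma> (transport_at B \<Delta> f \<alpha> g b # f) (B # \<Delta>) \<Gamma>' (transport_at B \<Delta> f' \<alpha>' g' b' # f') (B # \<Delta>)"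
     "cell_eq S \<Gamma> (transport_at B \<Delta> f \<alpha> g b # f) (lift_cell B \<Delta> f \<alpha> g b) (b # g) (B # \<Delta>)
       \<Gamma>' (transport_at B \<Delta> f' \<alpha>' g' b' # f') (lift_cell B \<Delta> f' \<alpha>' g' b') (b' # g') (B # \<Delta>)"
      using that transport_at_cong[OF L] lift_cell_cong[OF L] C by (auto simp: cell_eq_def arr_eq_def)
  qed
  have r: "cell_eq S \<Gamma> f \<alpha> g \<Delta> \<Gamma> f \<alpha> g \<Delta>" "arr_eq S \<Gamma> (b # g) (B # \<Delta>) \<Gamma> (b # g) (B # \<Delta>)"
    using a C CtxtEq_refl_iff[of \<Gamma>] ElemEq_Ctxt[OF a(2)] by (auto simp: cell_eq_def arr_eq_def)
  show "lift1 B \<Delta> W F (arr_class S \<Gamma> (b # g) (B # \<Delta>)) (cell_class S \<Gamma> f \<alpha> g \<Delta>) =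
      arr_class S \<Gamma> (transport_at B \<Delta> f \<alpha> g b # f) (B # \<Delta>)"
    unfolding lift1_def
  proof (rule Union_const, goal_cases)
    case (1 x)
    then show ?case using eq(1)[THEN arr_class_eqI] by (auto simp: mem_arr_class mem_cell_class)
  next
    case 2
    then show ?case using r unfolding mem_Collect_eq mem_arr_class mem_cell_class by blast
  qed
  show "lift2 B \<Delta> W F (arr_class S \<Gamma> (b # g) (B # \<Delta>)) (cell_class S \<Gamma> f \<alpha> g \<Delta>) =
      cell_class S \<Gamma> (transport_at B \<Delta> f \<alpha> g b # f) (lift_cell B \<Delta> f \<alpha> g b) (b # g) (B # \<Delta>)"
    unfolding lift2_def
  proof (rule Union_const, goal_cases)
    case (1 x)
    then show ?case using eq(2)[THEN cell_class_eqI] by (auto simp: mem_arr_class mem_cell_class)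
  next
    case 2
    then show ?case using r unfolding mem_Collect_eq mem_arr_class mem_cell_class by blast
  qed
qed

section \<open>Representatives over prescribed contexts\<close>

lemma Hom_iff: "F \<in> Hom \<CC> X Y \<longleftrightarrow> (\<exists>\<Gamma> f \<Delta>. F = arr_class S \<Gamma> f \<Delta> \<and> \<Gamma> \<in> X \<and> \<Delta> \<in> Y \<and> Ctxt S \<Gamma> \<and> Ctxt S \<Delta> \<and> Elem S \<Gamma> f \<Delta>)"
  by (auto simp: ctxt_two_category_def)

lemma Cell_iff: "A \<in> Cell \<CC> F G \<longleftrightarrow> (\<exists>\<Gamma> f \<alpha> g \<Delta>. A = cell_class S \<Gamma> f \<alpha> g \<Delta> \<and> (\<Gamma>, f, \<Delta>) \<in> F \<and> (\<Gamma>, g, \<Delta>) \<in> G \<and>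
    Elem S \<Gamma> \<alpha> (Id_ctxt \<Delta> f g))"
  by (auto simp: ctxt_two_category_def)

lemma Obj_iff: "X \<in> Obj \<CC> \<longleftrightarrow> (\<exists>\<Gamma>. X = ob_class S \<Gamma> \<and> Ctxt S \<Gamma>)"
  by (auto simp: ctxt_two_category_def)

lemma mem_ob_class: "\<Gamma>' \<in> ob_class S \<Gamma> \<longleftrightarrow> CtxtEq S \<Gamma> \<Gamma>'"
  by (simp add: ob_class_def)

text \<open>A representative may live over any contexts in the two classes; conversion of both moves
  it onto the chosen \<Gamma> and \<Delta>.\<close>

lemma Hom_normal:
  assumes "F \<in> Hom \<CC> (ob_class S \<Gamma>) (ob_class S \<Delta>)"
  obtains f where "F = arr_class S \<Gamma> f \<Delta>" "Elem S \<Gamma> f \<Delta>"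
proof -
  obtain \<Gamma>' f \<Delta>' where F: "F = arr_class S \<Gamma>' f \<Delta>'" "CtxtEq S \<Gamma> \<Gamma>'" "CtxtEq S \<Delta> \<Delta>'" "Ctxt S \<Delta>'" "Elem S \<Gamma>' f \<Delta>'"
    using assms unfolding Hom_iff mem_ob_class by blast
  have "ElemEq S \<Gamma>' f f \<Delta>'" using F(5) ElemEq_refl_iff by blast
  then have e: "arr_eq S \<Gamma>' f \<Delta>' \<Gamma> f \<Delta>" using F CtxtEq_sym by (simp add: arr_eq_def)
  have "Elem S \<Gamma> f \<Delta>" using arr_eq_sym[OF e] ElemEq_refl_iff by (simp add: arr_eq_def)
  then show ?thesis using that F(1) arr_class_eqI[OF e] by blast
qed

lemma Hom_class:
  "Elem S \<Gamma> f \<Delta> \<Longrightarrow> Ctxt S \<Delta> \<Longrightarrow> arr_class S \<Gamma> f \<Delta> \<in> Hom \<CC> (ob_class S \<Gamma>) (ob_class S \<Delta>)"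
  unfolding Hom_iff mem_ob_class using arr_eq_refl[of \<Gamma> f \<Delta>] by (auto simp: arr_eq_def dest: CtxtEq_Ctxt1)

text \<open>Besides the contexts, the target can be fixed to a given \<open>g\<close>. This lets a
  2-cell into a projected arrow and that arrow itself be represented with the same vector.\<close>

lemma Cell_normal:
  assumes "A \<in> Cell \<CC> F (arr_class S \<Gamma> g \<Delta>)" "F \<in> Hom \<CC> (ob_class S \<Gamma>) (ob_class S \<Delta>)"
  obtains f \<alpha> where "F = arr_class S \<Gamma> f \<Delta>" "Elem S \<Gamma> f \<Delta>" "A = cell_class S \<Gamma> f \<alpha> g \<Delta>" "Elem S \<Gamma> \<alpha> (Id_ctxt \<Delta> f g)"
proof -
  obtain f0 where F: "F = arr_class S \<Gamma> f0 \<Delta>" "Elem S \<Gamma> f0 \<Delta>" using Hom_normal assms(2) by blast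
  obtain \<Gamma>' f \<alpha> g' \<Delta>' where A: "A = cell_class S \<Gamma>' f \<alpha> g' \<Delta>'" "arr_eq S \<Gamma> f0 \<Delta> \<Gamma>' f \<Delta>'" "arr_eq S \<Gamma> g \<Delta> \<Gamma>' g' \<Delta>'"
    "Elem S \<Gamma>' \<alpha> (Id_ctxt \<Delta>' f g')"
    using assms(1) unfolding Cell_iff F mem_arr_class by blast
  \<comment> \<open>The source is represented by the \<open>f\<close> that comes with the cell, so
    \<alpha> only needs conversion of its identity context; \<open>f0\<close> serves to type
    \<open>f\<close> over the chosen contexts.\<close>
  have e: "arr_eq S \<Gamma> f0 \<Delta> \<Gamma> f \<Delta>"
    using A(2) CtxtEq_Ctxt1 CtxtEq_refl_iff by (auto simp: arr_eq_def)
  have f: "Elem S \<Gamma> f \<Delta>" using arr_eq_sym[OF e] ElemEq_Elem by (auto simp: arr_eq_def)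
  have e': "arr_eq S \<Gamma>' f \<Delta>' \<Gamma> f \<Delta>" using arr_eq_trans[OF arr_eq_sym[OF A(2)] e] .
  have "ElemEq S \<Gamma>' \<alpha> \<alpha> (Id_ctxt \<Delta>' f g')" using A(4) ElemEq_refl_iff by blast
  then have c: "cell_eq S \<Gamma>' f \<alpha> g' \<Delta>' \<Gamma> f \<alpha> g \<Delta>"
    using e' arr_eq_sym[OF A(3)] by (simp add: cell_eq_def arr_eq_def)
  have "Elem S \<Gamma> \<alpha> (Id_ctxt \<Delta> f g)"
    using cell_eq_sym[OF c] ElemEq_Elem by (auto simp: cell_eq_def)
  then show ?thesis using that[of f \<alpha>] F(1) arr_class_eqI[OF e] f A(1) cell_class_eqI[OF c] by simp
qed

end

context discrete_identity_types begin

text \<open>The endpoints agree because the projection drops the heads of \<open>?t # f\<close> and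
  \<open>b # g\<close>; the cells agree by \<open>lwhisk_proj\<close>, applied to arbitrary
  representatives of the lifted cell and of the projection.\<close>

lemma lwhisk_class:
  assumes "lift_data S B \<Delta> \<Gamma> f \<alpha> g b f \<alpha> g b"
  shows "lwhisk \<CC> (dep_proj S \<Delta> B) (cell_class S \<Gamma> (transport_at B \<Delta> f \<alpha> g b # f) (lift_cell B \<Delta> f \<alpha> g b) (b # g) (B # \<Delta>)) =
    cell_class S \<Gamma> f \<alpha> g \<Delta>"
proof -
  define n where "n = length \<Delta>"
  have a: "Ty S \<Delta> B" "ElemEq S \<Gamma> f f \<Delta>" "ElemEq S \<Gamma> g g \<Delta>" "ElemEq S \<Gamma> (b # g) (b # g) (B # \<Delta>)"
    using assms by (auto simp: lift_data_def)
  have c: "Ctxt S \<Delta>" "Ctxt S (B # \<Delta>)" using a Ty_Ctxt by auto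
  have P: "ElemEq S (B # \<Delta>) (vars 1 n) (vars 1 n) \<Delta>"
    using ElemEq_vars_closed[of "[B]" \<Delta> "[]" 1 n] c n_def by simp
  let ?t = "transport_at B \<Delta> f \<alpha> g b" and ?\<sigma> = "lift_cell B \<Delta> f \<alpha> g b"
  have tf: "ElemEq S \<Gamma> (?t # f) (?t # f) (B # \<Delta>)" using a transport_at_cong[OF assms] by simp
  have l: "length f = n" "length g = n" using lift_data_length[OF assms] n_def by auto
  have r: "cell_eq S \<Gamma> (?t # f) ?\<sigma> (b # g) (B # \<Delta>) \<Gamma> (?t # f) ?\<sigma> (b # g) (B # \<Delta>)"
    "arr_eq S (B # \<Delta>) (vars 1 n) \<Delta> (B # \<Delta>) (vars 1 n) \<Delta>"
    using tf a(4) lift_cell_cong[OF assms] P c[folded CtxtEq_refl_iff] ElemEq_Ctxt[OF a(2), folded CtxtEq_refl_iff]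
    unfolding cell_eq_def arr_eq_def by blast+
  have eq: "cell_class S \<Gamma> f \<alpha> g \<Delta> = cell_class S \<Gamma>' (vec_at h s') (lwhisk_rep \<Phi> h \<Theta> s' g' \<sigma>') (vec_at h g') \<Theta>"
    if "cell_eq S \<Gamma> (?t # f) ?\<sigma> (b # g) (B # \<Delta>) \<Gamma>' s' \<sigma>' g' \<Phi>" "arr_eq S (B # \<Delta>) (vars 1 n) \<Delta> \<Phi> h \<Theta>" for \<Gamma>' s' \<sigma>' g' \<Phi> h \<Theta>
  proof (rule cell_class_eqI)
    have b: "CtxtEq S \<Gamma> \<Gamma>'" "CtxtEq S (B # \<Delta>) \<Phi>" "CtxtEq S \<Delta> \<Theta>" "ElemEq S (B # \<Delta>) (vars 1 n) h \<Delta>"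
      "ElemEq S \<Gamma> (?t # f) s' (B # \<Delta>)" "ElemEq S \<Gamma> (b # g) g' (B # \<Delta>)"
      "ElemEq S \<Gamma> ?\<sigma> \<sigma>' (Id_ctxt (B # \<Delta>) (?t # f) (b # g))"
      using that by (simp_all add: cell_eq_def arr_eq_def)
    have "ElemEq S \<Gamma> f (vec_at h s') \<Delta>" "ElemEq S \<Gamma> g (vec_at h g') \<Delta>"
      using ElemEq_vec_at_closed[OF b(5,4) c(1)] ElemEq_vec_at_closed[OF b(6,4) c(1)]
      by (simp_all only: vec_at_tl l)
    then show "cell_eq S \<Gamma> f \<alpha> g \<Delta> \<Gamma>' (vec_at h s') (lwhisk_rep \<Phi> h \<Theta> s' g' \<sigma>') (vec_at h g') \<Theta>"
      using b lwhisk_proj[OF assms b(2,3) b(4)[unfolded n_def] b(5-7)] by (simp add: cell_eq_def)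
  qed
  show ?thesis
    unfolding ctxt_two_category_def two_category.simps
  proof (rule Union_const, goal_cases)
    case (1 x)
    then show ?case using eq by (auto simp: mem_arr_class mem_cell_class dep_proj_def n_def)
  next
    case 2
    then show ?case using r eq[OF r] unfolding mem_Collect_eq mem_arr_class mem_cell_class dep_proj_def n_def by blast
  qed
qed

lemma dep_proj_normal:
  assumes "Ty S \<Delta> B"
  shows "normal_isofibration \<CC> (ob_class S (B # \<Delta>)) (ob_class S \<Delta>) (dep_proj S \<Delta> B) (lift1 B \<Delta>) (lift2 B \<Delta>)"
proof -
  define n where "n = length \<Delta>"
  have c: "Ctxt S \<Delta>" "Ctxt S (B # \<Delta>)" using assms Ty_Ctxt by auto
  have P: "Elem S (B # \<Delta>) (vars 1 n) \<Delta>"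
    using ElemEq_vars_closed[of "[B]" \<Delta> "[]" 1 n] c n_def ElemEq_refl_iff by simp
  have proj: "dep_proj S \<Delta> B = arr_class S (B # \<Delta>) (vars 1 n) \<Delta>"
    by (simp add: dep_proj_def n_def)
  have proj_comp: "comp1 \<CC> (dep_proj S \<Delta> B) (arr_class S \<Gamma> (b # g) (B # \<Delta>)) = arr_class S \<Gamma> g \<Delta>"
    if "Elem S \<Gamma> (b # g) (B # \<Delta>)" for \<Gamma> b g
  proof -
    have "length g = n" using Elem_length[OF that] by (simp add: n_def)
    then show ?thesis
      using comp1_class[OF that P c(1)] unfolding proj by (simp only: vec_at_tl)
  qed
  have Hom_Cons: "\<exists>b g. G = arr_class S \<Gamma> (b # g) (B # \<Delta>) \<and> Elem S \<Gamma> (b # g) (B # \<Delta>)"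
    if G: "G \<in> Hom \<CC> (ob_class S \<Gamma>) (ob_class S (B # \<Delta>))" for G \<Gamma>
  proof -
    obtain h where h: "G = arr_class S \<Gamma> h (B # \<Delta>)" "Elem S \<Gamma> h (B # \<Delta>)"
      by (rule Hom_normal[OF G])
    then show ?thesis using Elem_length[OF h(2)] by (cases h) auto
  qed
  show ?thesis
    unfolding normal_isofibration_def cloven_isofibration_def
  proof (intro conjI ballI allI impI)
    show "ob_class S (B # \<Delta>) \<in> Obj \<CC>" "ob_class S \<Delta> \<in> Obj \<CC>"
      using c unfolding Obj_iff by blast+
    show "dep_proj S \<Delta> B \<in> Hom \<CC> (ob_class S (B # \<Delta>)) (ob_class S \<Delta>)"
      unfolding proj by (rule Hom_class[OF P c(1)])
  next
    fix W F G A
    assume W: "W \<in> Obj \<CC>" and F: "F \<in> Hom \<CC> W (ob_class S \<Delta>)" and G: "G \<in> Hom \<CC> W (ob_class S (B # \<Delta>))"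
      and A: "invertible_cell \<CC> F (comp1 \<CC> (dep_proj S \<Delta> B) G) A"
    obtain \<Gamma> where \<Gamma>: "W = ob_class S \<Gamma>" "Ctxt S \<Gamma>" using W Obj_iff by blast
    obtain b g where g: "G = arr_class S \<Gamma> (b # g) (B # \<Delta>)" "Elem S \<Gamma> (b # g) (B # \<Delta>)"
      using Hom_Cons G \<Gamma>(1) by blast
    have g': "Elem S \<Gamma> g \<Delta>" using g(2) by simp
    \<comment> \<open>The target of \<open>A\<close> is the projection of \<open>G\<close>, computed
      as the class of \<open>g\<close>. Hence \<open>A\<close> has a representative ending in
      exactly the tail of \<open>b # g\<close>, as the definition of the lift demands.\<close>
    have "A \<in> Cell \<CC> F (arr_class S \<Gamma> g \<Delta>)"
      using A proj_comp[OF g(2)] unfolding invertible_cell_def g(1) by simp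
    then obtain f \<alpha> where f: "F = arr_class S \<Gamma> f \<Delta>" "Elem S \<Gamma> f \<Delta>"
      and \<alpha>: "A = cell_class S \<Gamma> f \<alpha> g \<Delta>" "Elem S \<Gamma> \<alpha> (Id_ctxt \<Delta> f g)"
      using Cell_normal F \<Gamma>(1) by blast
    have L: "lift_data S B \<Delta> \<Gamma> f \<alpha> g b f \<alpha> g b"
      unfolding lift_data_def ElemEq_refl_iff using assms f(2) \<alpha>(2) g(2) by blast
    note len = lift_data_length[OF L]
    let ?t = "transport_at B \<Delta> f \<alpha> g b" and ?\<sigma> = "lift_cell B \<Delta> f \<alpha> g b"
    have s: "lift1 B \<Delta> W F G A = arr_class S \<Gamma> (?t # f) (B # \<Delta>)"
      and \<sigma>: "lift2 B \<Delta> W F G A = cell_class S \<Gamma> (?t # f) ?\<sigma> (b # g) (B # \<Delta>)"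
      unfolding g(1) \<alpha>(1) by (rule lift_class[OF L])+
    have tf: "Elem S \<Gamma> (?t # f) (B # \<Delta>)"
      using f(2) TmEqD(1)[OF transport_at_cong[OF L]] by simp
    have \<sigma>': "Elem S \<Gamma> ?\<sigma> (Id_ctxt (B # \<Delta>) (?t # f) (b # g))"
      using lift_cell_cong[OF L] ElemEq_refl_iff by blast
    show "lift1 B \<Delta> W F G A \<in> Hom \<CC> W (ob_class S (B # \<Delta>))"
      unfolding s unfolding \<Gamma>(1) by (rule Hom_class[OF tf c(2)])
    show "lift2 B \<Delta> W F G A \<in> Cell \<CC> (lift1 B \<Delta> W F G A) G"
      unfolding s \<sigma> unfolding g(1) Cell_iff
      using \<sigma>' arr_eq_refl[OF tf c(2)] arr_eq_refl[OF g(2) c(2)] mem_arr_class by blast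
    show "comp1 \<CC> (dep_proj S \<Delta> B) (lift1 B \<Delta> W F G A) = F"
      unfolding s unfolding f(1) by (rule proj_comp[OF tf])
    show "lwhisk \<CC> (dep_proj S \<Delta> B) (lift2 B \<Delta> W F G A) = A"
      unfolding \<sigma> unfolding \<alpha>(1) by (rule lwhisk_class[OF L])
    fix W' K
    assume W': "W' \<in> Obj \<CC>" and K: "K \<in> Hom \<CC> W' W"
    obtain \<Gamma>' where \<Gamma>': "W' = ob_class S \<Gamma>'" "Ctxt S \<Gamma>'" using W' Obj_iff by blast
    obtain k where k: "K = arr_class S \<Gamma>' k \<Gamma>" "Elem S \<Gamma>' k \<Gamma>"
      using Hom_normal K \<Gamma>(1) \<Gamma>'(1) by blast
    have Fk: "comp1 \<CC> F K = arr_class S \<Gamma>' (vec_at f k) \<Delta>"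
      unfolding f(1) k(1) by (rule comp1_class[OF k(2) f(2) c(1)])
    have Gk: "comp1 \<CC> G K = arr_class S \<Gamma>' (subst (inst k) b # vec_at g k) (B # \<Delta>)"
      unfolding g(1) k(1) using comp1_class[OF k(2) g(2) c(2)] by (simp only: vec_at_Cons)
    have Ak: "rwhisk \<CC> A K = cell_class S \<Gamma>' (vec_at f k) (vec_at \<alpha> k) (vec_at g k) \<Delta>"
      unfolding \<alpha>(1) k(1) by (rule rwhisk_class[OF k(2) f(2) g' \<alpha>(2) c(1)])
    have k': "ElemEq S \<Gamma>' k k \<Gamma>" using k(2) ElemEq_refl_iff by blast
    \<comment> \<open>The problem pulled back along \<open>k\<close> is again a lifting problem, so
      \<open>lift_class\<close> computes its lift; by \<open>transport_at_subst\<close> this is the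
      original lift composed with \<open>k\<close>, already on representatives.\<close>
    have Lk: "lift_data S B \<Delta> \<Gamma>' (vec_at f k) (vec_at \<alpha> k) (vec_at g k) (subst (inst k) b)
        (vec_at f k) (vec_at \<alpha> k) (vec_at g k) (subst (inst k) b)"
    proof -
      have 1: "subst_tele (inst k) (Id_ctxt \<Delta> f g) = Id_ctxt \<Delta> (vec_at f k) (vec_at g k)"
        using subst_tele_Id_ctxt[OF c(1) len(1,2)] by (simp add: vec_at_def)
      show ?thesis
        using L ElemEq_vec_at_closed[OF k' _ c(1), of f f] ElemEq_vec_at[OF k', of \<alpha> \<alpha> "Id_ctxt \<Delta> f g"]
          ElemEq_vec_at_closed[OF k' _ c(2), of "b # g" "b # g"]
        unfolding lift_data_def 1 vec_at_Cons by blast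
    qed
    have tk: "vec_at (?t # f) k = transport_at B \<Delta> (vec_at f k) (vec_at \<alpha> k) (vec_at g k) (subst (inst k) b) # vec_at f k"
      unfolding vec_at_Cons transport_at_subst[OF assms len(1-3)] ..
    show "lift1 B \<Delta> W' (comp1 \<CC> F K) (comp1 \<CC> G K) (rwhisk \<CC> A K) = comp1 \<CC> (lift1 B \<Delta> W F G A) K"
      unfolding s Gk Ak unfolding k(1) comp1_class[OF k(2) tf c(2)] tk by (rule lift_class(1)[OF Lk])
    show "lift2 B \<Delta> W' (comp1 \<CC> F K) (comp1 \<CC> G K) (rwhisk \<CC> A K) = rwhisk \<CC> (lift2 B \<Delta> W F G A) K"
      unfolding \<sigma> Gk Ak unfolding k(1) rwhisk_class[OF k(2) tf g(2) \<sigma>' c(2)] lift_cell_subst[OF assms len(1-3)] vec_at_Cons transport_at_subst[OF assms len(1-3)]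
      by (rule lift_class(2)[OF Lk])
  next
    fix W G
    assume W: "W \<in> Obj \<CC>" and G: "G \<in> Hom \<CC> W (ob_class S (B # \<Delta>))"
    obtain \<Gamma> where \<Gamma>: "W = ob_class S \<Gamma>" "Ctxt S \<Gamma>" using W Obj_iff by blast
    obtain b g where g: "G = arr_class S \<Gamma> (b # g) (B # \<Delta>)" "Elem S \<Gamma> (b # g) (B # \<Delta>)"
      using Hom_Cons G \<Gamma>(1) by blast
    have g': "Elem S \<Gamma> g \<Delta>" using g(2) by simp
    let ?r = "vec_at (refl_ctxt \<Delta>) g"
    have pg: "comp1 \<CC> (dep_proj S \<Delta> B) G = arr_class S \<Gamma> g \<Delta>"
      unfolding g(1) by (rule proj_comp[OF g(2)])
    have i: "idcell \<CC> (arr_class S \<Gamma> g \<Delta>) = cell_class S \<Gamma> g ?r g \<Delta>"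
      by (rule idcell_class[OF g' c(1)])
    have L: "lift_data S B \<Delta> \<Gamma> g ?r g b g ?r g b"
      using assms g' g(2) refl_at_cong[OF c(1)[folded CtxtEq_refl_iff], of \<Gamma> g g]
      unfolding lift_data_def ElemEq_refl_iff by blast
    \<comment> \<open>Transport along reflexivity equals \<open>b\<close> only definitionally, so
      normality holds for classes and not for raw vectors.\<close>
    have t: "arr_eq S \<Gamma> (transport_at B \<Delta> g ?r g b # g) (B # \<Delta>) \<Gamma> (b # g) (B # \<Delta>)"
      using transport_at_refl[OF assms g(2)] g'[folded ElemEq_refl_iff] c(2)[folded CtxtEq_refl_iff] \<Gamma>(2)[folded CtxtEq_refl_iff]
      unfolding arr_eq_def by simp
    have r: "cell_eq S \<Gamma> (transport_at B \<Delta> g ?r g b # g) (lift_cell B \<Delta> g ?r g b) (b # g) (B # \<Delta>)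
        \<Gamma> (b # g) (vec_at (refl_ctxt (B # \<Delta>)) (b # g)) (b # g) (B # \<Delta>)"
      using t lift_cell_refl[OF assms g(2)] g(2)[folded ElemEq_refl_iff] unfolding cell_eq_def arr_eq_def by blast
    show "lift1 B \<Delta> W (comp1 \<CC> (dep_proj S \<Delta> B) G) G (idcell \<CC> (comp1 \<CC> (dep_proj S \<Delta> B) G)) = G"
      unfolding pg i unfolding g(1) lift_class(1)[OF L] by (rule arr_class_eqI[OF t])
    show "lift2 B \<Delta> W (comp1 \<CC> (dep_proj S \<Delta> B) G) G (idcell \<CC> (comp1 \<CC> (dep_proj S \<Delta> B) G)) = idcell \<CC> G"
      unfolding pg i unfolding g(1) lift_class(2)[OF L] idcell_class[OF g(2) c(2)] by (rule cell_class_eqI[OF r])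
  qed
qed

end

theorem proposition3p4p7:
  fixes S :: "'s judgements" and \<Delta> :: "'s exp list" and B :: "'s exp"
  assumes "discrete_identity_types S"
    and "Ctxt S \<Delta>" and "Ty S \<Delta> B"
  shows "\<exists>s \<sigma>. normal_isofibration (ctxt_two_category S)
           (ob_class S (B # \<Delta>)) (ob_class S \<Delta>) (dep_proj S \<Delta> B) s \<sigma>"
  using discrete_identity_types.dep_proj_normal[OF assms(1,3)] by blast

end
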